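(* Let $B$ be a closed manifold endowed with an almost contact-symplectic structure $(\beta,\eta,\psi)$ such that $\eta$ represents an integral cohomology class, and let $\pi:M\to B$ be the corresponding Boothby--Wang fibration, with connection form $\alpha_1$ satisfying $d\alpha_1=\pi^*\eta$. Let $\alpha_2=\pi^*\beta$ and let $\phi$ be the endomorphism of $TM$ given by $\phi_pX=(\psi\,\pi_*X)^*_p$ for $X\in T_pM$, where $Y_p^*$ denotes the horizontal lift at $p$, with respect to $\alpha_1$, of a vector $Y$ tangent to $B$ at $\pi(p)$. Then $(\alpha_1,\alpha_2,\phi)$ is an $\mathbb{S}^1$-invariant contact pair structure on $M$. Moreover, if $\psi$ is decomposable, then so is $\phi$.
   Context: All objects are smooth. Contact-symplectic pairs. A contact-symplectic pair of type $(h,k)$ on a $(2h+2k+1)$-dimensional manifold $B$ consists of a $1$-form $\beta$ and a closed $2$-form $\eta$ such that $\beta\wedge(d\beta)^h\wedge\eta^k$ is a volume form, $(d\beta)^{h+1}=0$ and $\eta^{k+1}=0$. Its Reeb vector field $W$ is uniquely defined by $\beta(W)=1$, $i_Wd\beta=i_W\eta=0$. Its characteristic foliations are the foliation with tangent distribution $\ker\eta=\{v: i_v\eta=0\}$ and the foliation with tangent distribution $\ker\beta\cap\ker d\beta$. An almost contact-symplectic structure is a triple $(\beta,\eta,\psi)$ with $(\beta,\eta)$ a contact-symplectic pair and $\psi$ an endomorphism of $TB$ with $\psi^2=-\mathrm{Id}+\beta\otimes W$. The endomorphism $\psi$ is decomposable if it preserves the tangent distributions of both characteristic foliations. Contact pairs.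 A contact pair of type $(h,k)$ on a $(2h+2k+2)$-dimensional manifold $M$ is a pair $(\alpha_1,\alpha_2)$ of $1$-forms such that $\alpha_1\wedge(d\alpha_1)^h\wedge\alpha_2\wedge(d\alpha_2)^k$ is a volume form, $(d\alpha_1)^{h+1}=0$ and $(d\alpha_2)^{k+1}=0$. Its Reeb vector fields $Z_1,Z_2$ are uniquely determined by $\alpha_i(Z_j)=\delta_{ij}$ and $i_{Z_j}d\alpha_i=0$ for $i,j\in\{1,2\}$. The characteristic foliation $\mathcal{F}_i$ of $\alpha_i$ is the one with tangent distribution $T\mathcal{F}_i=\ker\alpha_i\cap\ker d\alpha_i$, $i=1,2$. A contact pair structure on $M$ is a triple $(\alpha_1,\alpha_2,\phi)$ where $(\alpha_1,\alpha_2)$ is a contact pair and $\phi$ is a tensor field of type $(1,1)$ with $\phi^2=-\mathrm{Id}+\alpha_1\otimes Z_1+\alpha_2\otimes Z_2$ and $\phi(Z_1)=\phi(Z_2)=0$. The endomorphism $\phi$ is decomposable if $\phi(T\mathcal{F}_i)\subset T\mathcal{F}_i$ for $i=1,2$. Boothby--Wang fibration. If the closed $2$-form $\eta$ on the closed manifold $B$ represents an integral class, the corresponding Boothby--Wang fibration is the principal $\mathbb{S}^1$-bundle $\pi:M\to B$ with Euler class $[\eta]$, endowed with a connection $1$-form $\alpha_1$ with curvature $\eta$, i.e. $d\alpha_1=\pi^*\eta$ (the connection form is regarded as a real-valued $\mathbb{S}^1$-invariant $1$-form, normalized to equal $1$ on the generator of the circle action, up to the choice of normalization of the period). The horizontal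 lift of a vector is the unique lift lying in $\ker\alpha_1$. A structure on $M$ is $\mathbb{S}^1$-invariant if all its tensors are invariant under the principal circle action. *)

theory Defs
  imports "HOL-Analysis.Analysis" "HOL-Homology.Homology"
begin

section \<open>Smooth manifolds and smooth maps\<close>

text \<open>Only meant for open \<open>S\<close>, where it is the usual class of $C^n$ maps.\<close>

primrec Ck_on :: "nat \<Rightarrow> 'e::real_normed_vector set \<Rightarrow> ('e \<Rightarrow> 'f::real_normed_vector) \<Rightarrow> bool" where
  "Ck_on 0 S f \<longleftrightarrow> continuous_on S f"
| "Ck_on (Suc n) S f \<longleftrightarrow>
     (\<forall>x\<in>S. f differentiable (at x)) \<and> (\<forall>v. Ck_on n S (\<lambda>x. frechet_derivative f (at x) v))"

definition smooth_on :: "'e::real_normed_vector set \<Rightarrow> ('e \<Rightarrow> 'f::real_normed_vector) \<Rightarrow> bool" where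
  "smooth_on S f \<longleftrightarrow> (\<forall>n. Ck_on n S f)"

text \<open>
  The underlying set of a manifold is a whole type. A chart is a pair of a domain and a coordinate
  map, whose values outside the domain are irrelevant.
  Atlases are not required to be maximal.
\<close>

type_synonym ('a, 'e) chart = "'a set \<times> ('a \<Rightarrow> 'e)"

definition smooth_atlas ::
    "('a::{t2_space,second_countable_topology}, 'e::euclidean_space) chart set \<Rightarrow> bool" where
  "smooth_atlas A \<longleftrightarrow>
     (\<Union>(U, x)\<in>A. U) = UNIV \<and>
     (\<forall>(U, x)\<in>A. open U \<and> open (x ` U) \<and> homeomorphism U (x ` U) x (inv_into U x)) \<and>
     (\<forall>(U, x)\<in>A. \<forall>(V, y)\<in>A. smooth_on (x ` (U \<inter> V)) (y \<circ> inv_into U x))"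

definition closed_manifold ::
    "('a::{t2_space,second_countable_topology}, 'e::euclidean_space) chart set \<Rightarrow> bool" where
  "closed_manifold A \<longleftrightarrow> smooth_atlas A \<and> compact (UNIV :: 'a set)"

definition euclidean_atlas :: "('e::euclidean_space, 'e) chart set" where
  "euclidean_atlas = {(UNIV, \<lambda>x. x)}"

definition prod_atlas :: "('a, 'e) chart set \<Rightarrow> ('b, 'f) chart set \<Rightarrow> ('a \<times> 'b, 'e \<times> 'f) chart set" where
  "prod_atlas A B = {(U \<times> V, map_prod x y) | U x V y. (U, x) \<in> A \<and> (V, y) \<in> B}"

definition smooth_map_on ::
    "('a::topological_space, 'e::euclidean_space) chart set \<Rightarrow>
     ('b::topological_space, 'f::euclidean_space) chart set \<Rightarrow> 'a set \<Rightarrow> ('a \<Rightarrow> 'b) \<Rightarrow> bool" where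
  "smooth_map_on A B S f \<longleftrightarrow>
     open S \<and> continuous_on S f \<and>
     (\<forall>(U, x)\<in>A. \<forall>(V, y)\<in>B. smooth_on (x ` (U \<inter> S \<inter> f -` V)) (y \<circ> f \<circ> inv_into U x))"

definition smooth_near ::
    "('a::topological_space, 'e::euclidean_space) chart set \<Rightarrow> 'a \<Rightarrow> ('a \<Rightarrow> real) \<Rightarrow> bool" where
  "smooth_near A p f \<longleftrightarrow> (\<exists>S. p \<in> S \<and> smooth_map_on A euclidean_atlas S f)"


section \<open>Tangent vectors\<close>

text \<open>
  A tangent vector at \<open>p\<close> is the velocity of a smooth curve through \<open>p\<close>, regarded as an operator on
  the functions that are smooth near \<open>p\<close>. By convention the operator is \<open>0\<close> on all other functions,
  so that equality of tangent vectors is equality of operators and the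
  vector space operations are pointwise.
\<close>

type_synonym 'a tangent = "('a \<Rightarrow> real) \<Rightarrow> real"

definition velocity ::
    "('a::topological_space, 'e::euclidean_space) chart set \<Rightarrow> (real \<Rightarrow> 'a) \<Rightarrow> 'a tangent" where
  "velocity A c = (\<lambda>f. if smooth_near A (c 0) f then deriv (\<lambda>t. f (c t)) 0 else 0)"

definition tangent_space ::
    "('a::topological_space, 'e::euclidean_space) chart set \<Rightarrow> 'a \<Rightarrow> 'a tangent set" where
  "tangent_space A p =
     {velocity A c | c. c 0 = p \<and> (\<exists>\<epsilon>>0. smooth_map_on euclidean_atlas A {-\<epsilon><..<\<epsilon>} c)}"

abbreviation zero_tangent :: "'a tangent" where
  "zero_tangent \<equiv> (\<lambda>f. 0)"

definition pushforward ::
    "('a::topological_space, 'e::euclidean_space) chart set \<Rightarrow>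
     ('b::topological_space, 'f::euclidean_space) chart set \<Rightarrow>
     ('a \<Rightarrow> 'b) \<Rightarrow> 'a \<Rightarrow> 'a tangent \<Rightarrow> 'b tangent" where
  "pushforward A B F p v = (\<lambda>f. if smooth_near B (F p) f then v (f \<circ> F) else 0)"

text \<open>
  The vector at \<open>q\<close> with constant components \<open>e\<close> in the given chart, and conversely the
  components of a vector.
\<close>

definition coord_vector ::
    "('a::topological_space, 'e::euclidean_space) chart set \<Rightarrow> ('a, 'e) chart \<Rightarrow> 'e \<Rightarrow> 'a \<Rightarrow> 'a tangent" where
  "coord_vector A c e q =
     velocity A (\<lambda>t. inv_into (fst c) (snd c) (snd c q + t *\<^sub>R e))"

definition components :: "('a, 'e::euclidean_space) chart \<Rightarrow> 'a tangent \<Rightarrow> 'e" where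
  "components c v = (\<Sum>b\<in>Basis. v (\<lambda>q. snd c q \<bullet> b) *\<^sub>R b)"

definition smooth_vector_field_on ::
    "('a::topological_space, 'e::euclidean_space) chart set \<Rightarrow> 'a set \<Rightarrow> ('a \<Rightarrow> 'a tangent) \<Rightarrow> bool" where
  "smooth_vector_field_on A S X \<longleftrightarrow>
     (\<forall>p\<in>S. X p \<in> tangent_space A p \<and>
            (\<forall>f. smooth_near A p f \<longrightarrow> smooth_near A p (\<lambda>q. X q f)))"

definition smooth_endomorphism ::
    "('a::topological_space, 'e::euclidean_space) chart set \<Rightarrow> ('a \<Rightarrow> 'a tangent \<Rightarrow> 'a tangent) \<Rightarrow> bool" where
  "smooth_endomorphism A \<psi> \<longleftrightarrow>
     (\<forall>p. \<forall>v\<in>tangent_space A p. \<psi> p v \<in> tangent_space A p) \<and>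
     (\<forall>p. \<forall>u\<in>tangent_space A p. \<forall>v\<in>tangent_space A p. \<forall>a b.
        \<psi> p (\<lambda>f. a * u f + b * v f) = (\<lambda>f. a * \<psi> p u f + b * \<psi> p v f)) \<and>
     (\<forall>c\<in>A. \<forall>e. smooth_vector_field_on A (fst c) (\<lambda>q. \<psi> q (coord_vector A c e q)))"


section \<open>Differential forms\<close>

text \<open>
  A \<open>k\<close>-form takes at each point a list of \<open>k\<close> tangent vectors at that point; its values on other
  lists carry no meaning, and equality of forms is the relation \<open>form_eq\<close> below.
\<close>

type_synonym 'a form = "'a \<Rightarrow> 'a tangent list \<Rightarrow> real"

definition tangent_lists ::
    "('a::topological_space, 'e::euclidean_space) chart set \<Rightarrow> nat \<Rightarrow> 'a \<Rightarrow> 'a tangent list set" where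
  "tangent_lists A k p = {vs. length vs = k \<and> set vs \<subseteq> tangent_space A p}"

definition is_form ::
    "('a::topological_space, 'e::euclidean_space) chart set \<Rightarrow> nat \<Rightarrow> 'a form \<Rightarrow> bool" where
  "is_form A k \<omega> \<longleftrightarrow>
     (\<forall>p. \<forall>vs\<in>tangent_lists A k p. \<forall>i<k.
        \<forall>u\<in>tangent_space A p. \<forall>v\<in>tangent_space A p. \<forall>a b.
          \<omega> p (vs[i := (\<lambda>f. a * u f + b * v f)]) = a * \<omega> p (vs[i := u]) + b * \<omega> p (vs[i := v])) \<and>
     (\<forall>p. \<forall>vs\<in>tangent_lists A k p. \<forall>i j. i < j \<and> j < k \<and> vs ! i = vs ! j \<longrightarrow> \<omega> p vs = 0) \<and>
     (\<forall>c\<in>A. \<forall>p\<in>fst c. \<forall>es. length es = k \<longrightarrow>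
        smooth_near A p (\<lambda>q. \<omega> q (map (\<lambda>e. coord_vector A c e q) es)))"

definition form_eq ::
    "('a::topological_space, 'e::euclidean_space) chart set \<Rightarrow> nat \<Rightarrow> 'a form \<Rightarrow> 'a form \<Rightarrow> bool" where
  "form_eq A k \<omega> \<theta> \<longleftrightarrow> (\<forall>p. \<forall>vs\<in>tangent_lists A k p. \<omega> p vs = \<theta> p vs)"

abbreviation zero_form :: "'a form" where
  "zero_form \<equiv> (\<lambda>p vs. 0)"

definition nowhere_vanishing ::
    "('a::topological_space, 'e::euclidean_space) chart set \<Rightarrow> nat \<Rightarrow> 'a form \<Rightarrow> bool" where
  "nowhere_vanishing A k \<omega> \<longleftrightarrow> (\<forall>p. \<exists>vs\<in>tangent_lists A k p. \<omega> p vs \<noteq> 0)"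

definition wedge :: "nat \<Rightarrow> nat \<Rightarrow> 'a form \<Rightarrow> 'a form \<Rightarrow> 'a form" where
  "wedge k l \<omega> \<theta> = (\<lambda>p vs.
     (\<Sum>\<sigma> | \<sigma> permutes {..<k + l}.
        of_int (sign \<sigma>) * \<omega> p (map (\<lambda>i. vs ! \<sigma> i) [0..<k]) * \<theta> p (map (\<lambda>i. vs ! \<sigma> i) [k..<k + l]))
     / (fact k * fact l))"

primrec wedge_power :: "nat \<Rightarrow> 'a form \<Rightarrow> nat \<Rightarrow> 'a form" where
  "wedge_power k \<omega> 0 = (\<lambda>p vs. 1)"
| "wedge_power k \<omega> (Suc n) = wedge k (k * n) \<omega> (wedge_power k \<omega> n)"

definition pullback ::
    "('a::topological_space, 'e::euclidean_space) chart set \<Rightarrow>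
     ('b::topological_space, 'f::euclidean_space) chart set \<Rightarrow> ('a \<Rightarrow> 'b) \<Rightarrow> 'b form \<Rightarrow> 'a form" where
  "pullback A B F \<omega> = (\<lambda>p vs. \<omega> (F p) (map (pushforward A B F p) vs))"

text \<open>
  For vector fields $X_0, \dots, X_k$ with constant components in a chart, whose Lie brackets
  therefore vanish, the invariant formula for the exterior derivative reads
  $d\omega(X_0, \dots, X_k) = \sum_i (-1)^i X_i(\omega(X_0, \dots, \widehat{X_i}, \dots, X_k))$.
  On smooth forms the result does not depend on the chosen chart.
\<close>

definition ext_deriv_chart ::
    "('a::topological_space, 'e::euclidean_space) chart set \<Rightarrow> ('a, 'e) chart \<Rightarrow> 'a form \<Rightarrow> 'a form" where
  "ext_deriv_chart A c \<omega> = (\<lambda>p vs.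
     \<Sum>i<length vs. (-1) ^ i *
       (vs ! i) (\<lambda>q. \<omega> q (map (\<lambda>v. coord_vector A c (components c v) q)
                              (take i vs @ drop (Suc i) vs))))"

definition ext_deriv ::
    "('a::topological_space, 'e::euclidean_space) chart set \<Rightarrow> 'a form \<Rightarrow> 'a form" where
  "ext_deriv A \<omega> = (\<lambda>p. ext_deriv_chart A (SOME c. c \<in> A \<and> p \<in> fst c) \<omega> p)"

definition closed_form ::
    "('a::topological_space, 'e::euclidean_space) chart set \<Rightarrow> nat \<Rightarrow> 'a form \<Rightarrow> bool" where
  "closed_form A k \<omega> \<longleftrightarrow> is_form A k \<omega> \<and> form_eq A (Suc k) (ext_deriv A \<omega>) zero_form"


section \<open>Integral classes\<close>

text \<open>Barycentric coordinates identify a triangle in the plane with the standard 2-simplex.\<close>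

definition barycentric :: "real \<times> real \<Rightarrow> nat \<Rightarrow> real" where
  "barycentric = (\<lambda>(s, t) i. if i = 0 then 1 - s - t else if i = 1 then s else if i = 2 then t else 0)"

definition smooth_singular_2_simplex ::
    "('a::topological_space, 'e::euclidean_space) chart set \<Rightarrow> ((nat \<Rightarrow> real) \<Rightarrow> 'a) \<Rightarrow> bool" where
  "smooth_singular_2_simplex A \<sigma> \<longleftrightarrow>
     singular_simplex 2 euclidean \<sigma> \<and>
     (\<exists>W F. {(s, t). 0 \<le> s \<and> 0 \<le> t \<and> s + t \<le> 1} \<subseteq> W \<and> smooth_map_on euclidean_atlas A W F \<and>
            (\<forall>s t. 0 \<le> s \<and> 0 \<le> t \<and> s + t \<le> 1 \<longrightarrow> F (s, t) = \<sigma> (barycentric (s, t))))"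

definition integral_2_simplex ::
    "('a::topological_space, 'e::euclidean_space) chart set \<Rightarrow> 'a form \<Rightarrow> ((nat \<Rightarrow> real) \<Rightarrow> 'a) \<Rightarrow> real" where
  "integral_2_simplex A \<omega> \<sigma> =
     integral {(s, t). 0 < s \<and> 0 < t \<and> s + t < 1}
       (\<lambda>(s, t). \<omega> (\<sigma> (barycentric (s, t)))
          [velocity A (\<lambda>h. \<sigma> (barycentric (s + h, t))), velocity A (\<lambda>h. \<sigma> (barycentric (s, t + h)))])"

text \<open>
  The class of the closed 2-form \<open>\<omega>\<close> divided by \<open>T\<close> is integral, that is, all the periods of \<open>\<omega>\<close>
  over smooth singular cycles with integer coefficients lie in $T\mathbb{Z}$.
\<close>

definition represents_integral_class ::
    "('a::topological_space, 'e::euclidean_space) chart set \<Rightarrow> real \<Rightarrow> 'a form \<Rightarrow> bool" where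
  "represents_integral_class A T \<omega> \<longleftrightarrow>
     closed_form A 2 \<omega> \<and>
     (\<forall>z :: 'a chain.
        (\<forall>\<sigma>\<in>Poly_Mapping.keys z. smooth_singular_2_simplex A \<sigma>) \<and> chain_boundary 2 z = 0 \<longrightarrow>
        (\<exists>n::int. (\<Sum>\<sigma>\<in>Poly_Mapping.keys z.
            of_int (Poly_Mapping.lookup z \<sigma>) * integral_2_simplex A \<omega> \<sigma>) = T * of_int n))"


section \<open>Contact-symplectic pairs and contact pairs\<close>

text \<open>
  The exterior products below are automatically smooth forms of top degree, so being a volume
  form means vanishing nowhere.
\<close>

definition contact_symplectic_pair ::
    "('a::topological_space, 'e::euclidean_space) chart set \<Rightarrow> nat \<Rightarrow> nat \<Rightarrow> 'a form \<Rightarrow> 'a form \<Rightarrow> bool" where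
  "contact_symplectic_pair A h k \<beta> \<eta> \<longleftrightarrow>
     DIM('e) = 2 * h + 2 * k + 1 \<and>
     is_form A 1 \<beta> \<and> closed_form A 2 \<eta> \<and>
     nowhere_vanishing A (2 * h + 2 * k + 1)
       (wedge 1 (2 * h + 2 * k) \<beta>
         (wedge (2 * h) (2 * k) (wedge_power 2 (ext_deriv A \<beta>) h) (wedge_power 2 \<eta> k))) \<and>
     form_eq A (2 * (h + 1)) (wedge_power 2 (ext_deriv A \<beta>) (h + 1)) zero_form \<and>
     form_eq A (2 * (k + 1)) (wedge_power 2 \<eta> (k + 1)) zero_form"

text \<open>
  The Reeb field is unique and automatically smooth, so the existential quantifiers over Reeb fields
  in the structures below just name it.
\<close>

definition contact_symplectic_reeb ::
    "('a::topological_space, 'e::euclidean_space) chart set \<Rightarrow> 'a form \<Rightarrow> 'a form \<Rightarrow> ('a \<Rightarrow> 'a tangent) \<Rightarrow> bool" where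
  "contact_symplectic_reeb A \<beta> \<eta> W \<longleftrightarrow>
     smooth_vector_field_on A UNIV W \<and>
     (\<forall>p. \<beta> p [W p] = 1 \<and>
          (\<forall>v\<in>tangent_space A p. ext_deriv A \<beta> p [W p, v] = 0 \<and> \<eta> p [W p, v] = 0))"

definition ker_1form ::
    "('a::topological_space, 'e::euclidean_space) chart set \<Rightarrow> 'a form \<Rightarrow> 'a \<Rightarrow> 'a tangent set" where
  "ker_1form A \<alpha> p = {v \<in> tangent_space A p. \<alpha> p [v] = 0}"

definition ker_2form ::
    "('a::topological_space, 'e::euclidean_space) chart set \<Rightarrow> 'a form \<Rightarrow> 'a \<Rightarrow> 'a tangent set" where
  "ker_2form A \<omega> p = {v \<in> tangent_space A p. \<forall>w\<in>tangent_space A p. \<omega> p [v, w] = 0}"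

text \<open>The tangent distribution of the characteristic foliation of a 1-form.\<close>

definition characteristic_distribution ::
    "('a::topological_space, 'e::euclidean_space) chart set \<Rightarrow> 'a form \<Rightarrow> 'a \<Rightarrow> 'a tangent set" where
  "characteristic_distribution A \<alpha> p = ker_1form A \<alpha> p \<inter> ker_2form A (ext_deriv A \<alpha>) p"

definition preserves_distribution ::
    "('a \<Rightarrow> 'a tangent \<Rightarrow> 'a tangent) \<Rightarrow> ('a \<Rightarrow> 'a tangent set) \<Rightarrow> bool" where
  "preserves_distribution \<psi> D \<longleftrightarrow> (\<forall>p. \<psi> p ` D p \<subseteq> D p)"

definition almost_contact_symplectic_structure ::
    "('a::topological_space, 'e::euclidean_space) chart set \<Rightarrow> nat \<Rightarrow> nat \<Rightarrow>
     'a form \<Rightarrow> 'a form \<Rightarrow> ('a \<Rightarrow> 'a tangent \<Rightarrow> 'a tangent) \<Rightarrow> bool" where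
  "almost_contact_symplectic_structure A h k \<beta> \<eta> \<psi> \<longleftrightarrow>
     contact_symplectic_pair A h k \<beta> \<eta> \<and> smooth_endomorphism A \<psi> \<and>
     (\<exists>W. contact_symplectic_reeb A \<beta> \<eta> W \<and>
        (\<forall>p. \<forall>v\<in>tangent_space A p. \<psi> p (\<psi> p v) = (\<lambda>f. - v f + \<beta> p [v] * W p f)))"

definition contact_symplectic_decomposable ::
    "('a::topological_space, 'e::euclidean_space) chart set \<Rightarrow>
     'a form \<Rightarrow> 'a form \<Rightarrow> ('a \<Rightarrow> 'a tangent \<Rightarrow> 'a tangent) \<Rightarrow> bool" where
  "contact_symplectic_decomposable A \<beta> \<eta> \<psi> \<longleftrightarrow>
     preserves_distribution \<psi> (ker_2form A \<eta>) \<and>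
     preserves_distribution \<psi> (characteristic_distribution A \<beta>)"

definition contact_pair ::
    "('a::topological_space, 'e::euclidean_space) chart set \<Rightarrow> nat \<Rightarrow> nat \<Rightarrow> 'a form \<Rightarrow> 'a form \<Rightarrow> bool" where
  "contact_pair A h k \<alpha>\<^sub>1 \<alpha>\<^sub>2 \<longleftrightarrow>
     DIM('e) = 2 * h + 2 * k + 2 \<and>
     is_form A 1 \<alpha>\<^sub>1 \<and> is_form A 1 \<alpha>\<^sub>2 \<and>
     nowhere_vanishing A (2 * h + 2 * k + 2)
       (wedge 1 (2 * h + (1 + 2 * k)) \<alpha>\<^sub>1
         (wedge (2 * h) (1 + 2 * k) (wedge_power 2 (ext_deriv A \<alpha>\<^sub>1) h)
           (wedge 1 (2 * k) \<alpha>\<^sub>2 (wedge_power 2 (ext_deriv A \<alpha>\<^sub>2) k)))) \<and>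
     form_eq A (2 * (h + 1)) (wedge_power 2 (ext_deriv A \<alpha>\<^sub>1) (h + 1)) zero_form \<and>
     form_eq A (2 * (k + 1)) (wedge_power 2 (ext_deriv A \<alpha>\<^sub>2) (k + 1)) zero_form"

definition contact_pair_reeb ::
    "('a::topological_space, 'e::euclidean_space) chart set \<Rightarrow> 'a form \<Rightarrow> 'a form \<Rightarrow>
     ('a \<Rightarrow> 'a tangent) \<Rightarrow> ('a \<Rightarrow> 'a tangent) \<Rightarrow> bool" where
  "contact_pair_reeb A \<alpha>\<^sub>1 \<alpha>\<^sub>2 Z\<^sub>1 Z\<^sub>2 \<longleftrightarrow>
     smooth_vector_field_on A UNIV Z\<^sub>1 \<and> smooth_vector_field_on A UNIV Z\<^sub>2 \<and>
     (\<forall>p. \<alpha>\<^sub>1 p [Z\<^sub>1 p] = 1 \<and> \<alpha>\<^sub>1 p [Z\<^sub>2 p] = 0 \<and> \<alpha>\<^sub>2 p [Z\<^sub>1 p] = 0 \<and> \<alpha>\<^sub>2 p [Z\<^sub>2 p] = 1 \<and>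
          (\<forall>v\<in>tangent_space A p.
             ext_deriv A \<alpha>\<^sub>1 p [Z\<^sub>1 p, v] = 0 \<and> ext_deriv A \<alpha>\<^sub>2 p [Z\<^sub>1 p, v] = 0 \<and>
             ext_deriv A \<alpha>\<^sub>1 p [Z\<^sub>2 p, v] = 0 \<and> ext_deriv A \<alpha>\<^sub>2 p [Z\<^sub>2 p, v] = 0))"

definition contact_pair_structure ::
    "('a::topological_space, 'e::euclidean_space) chart set \<Rightarrow> nat \<Rightarrow> nat \<Rightarrow>
     'a form \<Rightarrow> 'a form \<Rightarrow> ('a \<Rightarrow> 'a tangent \<Rightarrow> 'a tangent) \<Rightarrow> bool" where
  "contact_pair_structure A h k \<alpha>\<^sub>1 \<alpha>\<^sub>2 \<phi> \<longleftrightarrow>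
     contact_pair A h k \<alpha>\<^sub>1 \<alpha>\<^sub>2 \<and> smooth_endomorphism A \<phi> \<and>
     (\<exists>Z\<^sub>1 Z\<^sub>2. contact_pair_reeb A \<alpha>\<^sub>1 \<alpha>\<^sub>2 Z\<^sub>1 Z\<^sub>2 \<and>
        (\<forall>p. \<forall>v\<in>tangent_space A p.
           \<phi> p (\<phi> p v) = (\<lambda>f. - v f + \<alpha>\<^sub>1 p [v] * Z\<^sub>1 p f + \<alpha>\<^sub>2 p [v] * Z\<^sub>2 p f)) \<and>
        (\<forall>p. \<phi> p (Z\<^sub>1 p) = zero_tangent \<and> \<phi> p (Z\<^sub>2 p) = zero_tangent))"

definition contact_pair_decomposable ::
    "('a::topological_space, 'e::euclidean_space) chart set \<Rightarrow>
     'a form \<Rightarrow> 'a form \<Rightarrow> ('a \<Rightarrow> 'a tangent \<Rightarrow> 'a tangent) \<Rightarrow> bool" where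
  "contact_pair_decomposable A \<alpha>\<^sub>1 \<alpha>\<^sub>2 \<phi> \<longleftrightarrow>
     preserves_distribution \<phi> (characteristic_distribution A \<alpha>\<^sub>1) \<and>
     preserves_distribution \<phi> (characteristic_distribution A \<alpha>\<^sub>2)"


section \<open>Principal circle bundles\<close>

text \<open>
  The circle is the unit circle in the complex plane with the smooth structure for which \<open>cis\<close> is a
  local diffeomorphism: a map out of a product with the circle is smooth iff it is so after
  composition with \<open>cis\<close>, and a map into the circle is smooth iff it is so as a complex function.
  The actions below are only meaningful for complex numbers of norm 1.
\<close>

definition principal_circle_bundle ::
    "('m::topological_space, 'e::euclidean_space) chart set \<Rightarrow>
     ('b::topological_space, 'f::euclidean_space) chart set \<Rightarrow>
     ('m \<Rightarrow> 'b) \<Rightarrow> (complex \<Rightarrow> 'm \<Rightarrow> 'm) \<Rightarrow> bool" where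
  "principal_circle_bundle AM AB \<pi> act \<longleftrightarrow>
     smooth_map_on AM AB UNIV \<pi> \<and>
     (\<forall>p. act 1 p = p) \<and>
     (\<forall>z w p. norm z = 1 \<and> norm w = 1 \<longrightarrow> act (z * w) p = act z (act w p)) \<and>
     smooth_map_on (prod_atlas (euclidean_atlas :: (real, real) chart set) AM) AM UNIV
       (\<lambda>(t, p). act (cis t) p) \<and>
     (\<forall>z p. norm z = 1 \<longrightarrow> \<pi> (act z p) = \<pi> p) \<and>
     (\<forall>b. \<exists>U g. open U \<and> b \<in> U \<and>
        (\<forall>z p. norm z = 1 \<and> \<pi> p \<in> U \<longrightarrow> g (act z p) = z * g p) \<and>
        smooth_map_on AM (euclidean_atlas :: (complex, complex) chart set) (\<pi> -` U) g \<and>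
        bij_betw (\<lambda>p. (\<pi> p, g p)) (\<pi> -` U) (U \<times> sphere 0 1) \<and>
        smooth_map_on (prod_atlas AB (euclidean_atlas :: (real, real) chart set)) AM (U \<times> UNIV)
          (\<lambda>(b, t). inv_into (\<pi> -` U) (\<lambda>p. (\<pi> p, g p)) (b, cis t)))"

definition circle_invariant_form ::
    "('m::topological_space, 'e::euclidean_space) chart set \<Rightarrow> (complex \<Rightarrow> 'm \<Rightarrow> 'm) \<Rightarrow>
     nat \<Rightarrow> 'm form \<Rightarrow> bool" where
  "circle_invariant_form A act k \<omega> \<longleftrightarrow>
     (\<forall>z. norm z = 1 \<longrightarrow> form_eq A k (pullback A A (act z) \<omega>) \<omega>)"

definition circle_invariant_endomorphism ::
    "('m::topological_space, 'e::euclidean_space) chart set \<Rightarrow> (complex \<Rightarrow> 'm \<Rightarrow> 'm) \<Rightarrow>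
     ('m \<Rightarrow> 'm tangent \<Rightarrow> 'm tangent) \<Rightarrow> bool" where
  "circle_invariant_endomorphism A act \<phi> \<longleftrightarrow>
     (\<forall>z. norm z = 1 \<longrightarrow> (\<forall>p. \<forall>v\<in>tangent_space A p.
        pushforward A A (act z) p (\<phi> p v) = \<phi> (act z p) (pushforward A A (act z) p v)))"

definition circle_invariant_structure ::
    "('m::topological_space, 'e::euclidean_space) chart set \<Rightarrow> (complex \<Rightarrow> 'm \<Rightarrow> 'm) \<Rightarrow>
     'm form \<Rightarrow> 'm form \<Rightarrow> ('m \<Rightarrow> 'm tangent \<Rightarrow> 'm tangent) \<Rightarrow> bool" where
  "circle_invariant_structure A act \<alpha>\<^sub>1 \<alpha>\<^sub>2 \<phi> \<longleftrightarrow>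
     circle_invariant_form A act 1 \<alpha>\<^sub>1 \<and> circle_invariant_form A act 1 \<alpha>\<^sub>2 \<and>
     circle_invariant_endomorphism A act \<phi>"

text \<open>
  The generator of the action whose flow has period \<open>T\<close>; the usual normalizations
  are \<open>T = 1\<close> and \<open>T = 2 * pi\<close>.
\<close>

definition circle_generator ::
    "('m::topological_space, 'e::euclidean_space) chart set \<Rightarrow> (complex \<Rightarrow> 'm \<Rightarrow> 'm) \<Rightarrow>
     real \<Rightarrow> 'm \<Rightarrow> 'm tangent" where
  "circle_generator A act T p = velocity A (\<lambda>t. act (cis (2 * pi * t / T)) p)"

definition connection_form ::
    "('m::topological_space, 'e::euclidean_space) chart set \<Rightarrow> (complex \<Rightarrow> 'm \<Rightarrow> 'm) \<Rightarrow>
     real \<Rightarrow> 'm form \<Rightarrow> bool" where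
  "connection_form A act T \<alpha> \<longleftrightarrow>
     is_form A 1 \<alpha> \<and> circle_invariant_form A act 1 \<alpha> \<and> (\<forall>p. \<alpha> p [circle_generator A act T p] = 1)"

text \<open>
  A principal circle bundle with a connection form of curvature \<open>\<eta>\<close>. By Chern--Weil theory the
  last condition makes $[\eta]/T$ the (real) Euler class of the bundle, up to the sign convention.
\<close>

definition boothby_wang_fibration ::
    "('m::topological_space, 'e::euclidean_space) chart set \<Rightarrow>
     ('b::topological_space, 'f::euclidean_space) chart set \<Rightarrow>
     ('m \<Rightarrow> 'b) \<Rightarrow> (complex \<Rightarrow> 'm \<Rightarrow> 'm) \<Rightarrow> real \<Rightarrow> 'b form \<Rightarrow> 'm form \<Rightarrow> bool" where
  "boothby_wang_fibration AM AB \<pi> act T \<eta> \<alpha> \<longleftrightarrow>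
     principal_circle_bundle AM AB \<pi> act \<and> connection_form AM act T \<alpha> \<and>
     form_eq AM 2 (ext_deriv AM \<alpha>) (pullback AM AB \<pi> \<eta>)"

definition horizontal_lift ::
    "('m::topological_space, 'e::euclidean_space) chart set \<Rightarrow>
     ('b::topological_space, 'f::euclidean_space) chart set \<Rightarrow>
     ('m \<Rightarrow> 'b) \<Rightarrow> 'm form \<Rightarrow> 'm \<Rightarrow> 'b tangent \<Rightarrow> 'm tangent" where
  "horizontal_lift AM AB \<pi> \<alpha> p Y =
     (THE u. u \<in> ker_1form AM \<alpha> p \<and> pushforward AM AB \<pi> p u = Y)"

end

theory Submission
  imports Defs
begin

text \<open>
  The vertical field \<open>V\<close> (the generator of the action) and the horizontal lifts split \<open>T\<^sub>pM\<close> as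
  $\mathbb{R} V \oplus T_{\pi(p)}B$, because in a local trivialization \<open>B \<times> \<real>\<close> the kernel of \<open>\<pi>\<^sub>*\<close> is the
  fibre direction. Since \<open>d\<alpha>\<^sub>1 = \<pi>\<^sup>*\<eta>\<close> and \<open>d\<alpha>\<^sub>2 = \<pi>\<^sup>*d\<beta>\<close>, the top form of the contact pair is, up to sign,
  \<open>\<alpha>\<^sub>1\<close> wedge the pullback of the volume form of \<open>B\<close>, and every identity on \<open>M\<close> is the identity on \<open>B\<close>
  applied to \<open>\<pi>\<^sub>*\<close>. The Reeb fields are \<open>V\<close> and the horizontal lift of \<open>W\<close>.
\<close>

subsection \<open>Calculus of \<open>C\<^sup>n\<close> maps\<close>

text \<open>The circle carries no charts here: actions and trivializations are smooth only through
  \<open>cis\<close>. Near each point of M the circle-valued trivialization is therefore replaced by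
  a real angle, a branch of the logarithm, and this is why the fibre is unrolled to the real line.
  Two definitions give no handle by themselves. \<open>horizontal_lift\<close> is a definite
  description, so its smoothness comes from explicit local lifts together with uniqueness.
  \<open>ext_deriv\<close> evaluates in an arbitrarily chosen chart, so its compatibility with
  pullback must absorb a change of charts; there the symmetry of second derivatives enters, and it
  is proved from the mean value theorem. The type (h, k) on B becomes (k, h) on M, because
  \<open>d\<alpha>\<^sub>1\<close> comes from \<eta>, whose power k + 1 vanishes, and
  \<open>d\<alpha>\<^sub>2\<close> comes from d\<beta>, whose power h + 1 vanishes.\<close>

lemma Ck_on_cong:
  assumes "open S" "\<And>x. x \<in> S \<Longrightarrow> f x = g x" "Ck_on n S f"
  shows "Ck_on n S g"
  using assms(2,3)
proof (induction n arbitrary: f g)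
  case 0
  then show ?case by (simp cong: continuous_on_cong)
next
  case (Suc n)
  have d: "(g has_derivative frechet_derivative f (at x)) (at x)" if "x \<in> S" for x
    using Suc.prems that assms(1) has_derivative_transform_within_open[of f _ x UNIV S g]
    by (simp add: frechet_derivative_works)
  have "frechet_derivative f (at x) = frechet_derivative g (at x)" if "x \<in> S" for x
    using d[OF that] frechet_derivative_at by blast
  moreover have "g differentiable (at x)" if "x \<in> S" for x
    using d[OF that] by (rule differentiableI)
  ultimately show ?case
    using Suc.prems(2) Suc.IH[of "\<lambda>x. frechet_derivative f (at x) v" "\<lambda>x. frechet_derivative g (at x) v" for v]
    by simp
qed

lemma Ck_on_subset: "Ck_on n S f \<Longrightarrow> T \<subseteq> S \<Longrightarrow> Ck_on n T f"
  by (induction n arbitrary: f) (auto intro: continuous_on_subset)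

lemma Ck_on_continuous: "Ck_on n S f \<Longrightarrow> continuous_on S f"
  by (cases n) (auto intro: continuous_at_imp_continuous_on differentiable_imp_continuous_within)

text \<open>\<open>Ck_on\<close> speaks of the chosen \<open>frechet_derivative\<close>. Uniqueness
  of derivatives lets any explicit formula stand in for it, so the closure properties below reduce
  to a differentiation rule and an induction on \<open>n\<close>.\<close>

lemma Ck_on_SucI:
  assumes "open S" "\<And>x. x \<in> S \<Longrightarrow> (f has_derivative f' x) (at x)" "\<And>v. Ck_on n S (\<lambda>x. f' x v)"
  shows "Ck_on (Suc n) S f"
proof -
  have "frechet_derivative f (at x) = f' x" if "x \<in> S" for x
    using assms(2)[OF that] frechet_derivative_at by metis
  then show ?thesis
    using assms Ck_on_cong[OF assms(1) _ assms(3)] by (auto intro: differentiableI)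
qed

lemma Ck_on_Suc_derivative:
  "Ck_on (Suc n) S f \<Longrightarrow> x \<in> S \<Longrightarrow> (f has_derivative frechet_derivative f (at x)) (at x)"
  by (simp add: frechet_derivative_works)

lemma Ck_on_SucD: "Ck_on (Suc n) S f \<Longrightarrow> Ck_on n S f"
proof (induction n arbitrary: f)
  case 0
  then show ?case using Ck_on_continuous[of "Suc 0"] by simp
next
  case (Suc n)
  then have "Ck_on n S (\<lambda>x. frechet_derivative f (at x) v)" for v
    by (metis Ck_on.simps(2))
  then show ?case using Suc.prems by simp
qed

lemma Ck_on_const: "open S \<Longrightarrow> Ck_on n S (\<lambda>x. c)"
proof (induction n arbitrary: c)
  case (Suc n)
  then show ?case by (intro Ck_on_SucI[where f' = "\<lambda>x v. 0"]) auto
qed simp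

lemma Ck_on_linear:
  assumes "open S" "bounded_linear L"
  shows "Ck_on n S L"
proof (cases n)
  case 0
  then show ?thesis using assms by (simp add: linear_continuous_on)
next
  case (Suc m)
  have "Ck_on (Suc m) S L"
    by (rule Ck_on_SucI[where f' = "\<lambda>x. L"])
      (use assms in \<open>auto intro: Ck_on_const bounded_linear_imp_has_derivative\<close>)
  then show ?thesis using Suc by simp
qed

lemma Ck_on_linear_compose:
  assumes "open S" "bounded_linear L" "Ck_on n S f"
  shows "Ck_on n S (\<lambda>x. L (f x))"
  using assms(3)
proof (induction n arbitrary: f)
  case 0
  then show ?case
    using assms bounded_linear.continuous_on by auto
next
  case (Suc n)
  have *: "((\<lambda>x. L (f x)) has_derivative (\<lambda>v. L (frechet_derivative f (at x) v))) (at x)" if "x \<in> S" for x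
    using bounded_linear.has_derivative[OF assms(2) Ck_on_Suc_derivative[OF Suc.prems that]] .
  show ?case
    by (rule Ck_on_SucI[OF assms(1) *]) (use Suc in auto)
qed

lemma Ck_on_add:
  assumes "open S" "Ck_on n S f" "Ck_on n S g"
  shows "Ck_on n S (\<lambda>x. f x + g x)"
  using assms(2,3)
proof (induction n arbitrary: f g)
  case 0
  then show ?case by (simp add: continuous_on_add)
next
  case (Suc n)
  have *: "((\<lambda>x. f x + g x) has_derivative
      (\<lambda>v. frechet_derivative f (at x) v + frechet_derivative g (at x) v)) (at x)" if "x \<in> S" for x
    by (intro has_derivative_add Ck_on_Suc_derivative[OF Suc.prems(1) that] Ck_on_Suc_derivative[OF Suc.prems(2) that])
  show ?case
    by (rule Ck_on_SucI[OF assms(1) *]) (use Suc in auto)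
qed

lemma Ck_on_sum:
  assumes "open S" "finite I" "\<And>i. i \<in> I \<Longrightarrow> Ck_on n S (f i)"
  shows "Ck_on n S (\<lambda>x. \<Sum>i\<in>I. f i x)"
  using assms(2,3) by induction (auto intro: Ck_on_add Ck_on_const assms(1))

text \<open>The product rule mixes each function with the derivative of the other, so the induction
  hypothesis is applied to \<open>f\<close> and \<open>g\<close> themselves at the lower order;
  \<open>Ck_on_SucD\<close> provides that.\<close>

lemma Ck_on_bilinear:
  assumes "open S" "bounded_bilinear B" "Ck_on n S f" "Ck_on n S g"
  shows "Ck_on n S (\<lambda>x. B (f x) (g x))"
  using assms(3,4)
proof (induction n arbitrary: f g)
  case 0
  then show ?case using bounded_bilinear.continuous_on[OF assms(2)] by auto
next
  case (Suc n)
  have *: "((\<lambda>x. B (f x) (g x)) has_derivative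
      (\<lambda>v. B (f x) (frechet_derivative g (at x) v) + B (frechet_derivative f (at x) v) (g x))) (at x)"
    if "x \<in> S" for x
    by (intro bounded_bilinear.FDERIV assms(2) Ck_on_Suc_derivative[OF Suc.prems(1) that] Ck_on_Suc_derivative[OF Suc.prems(2) that])
  have "Ck_on n S (\<lambda>x. B (f x) (frechet_derivative g (at x) v) + B (frechet_derivative f (at x) v) (g x))" for v
    using Suc.prems by (intro Ck_on_add assms(1) Suc.IH Suc.prems[THEN Ck_on_SucD]) auto
  then show ?case using Ck_on_SucI[OF assms(1) *] by blast
qed

lemma Ck_on_mult:
  fixes f g :: "'e::real_normed_vector \<Rightarrow> 'f::real_normed_algebra"
  shows "open S \<Longrightarrow> Ck_on n S f \<Longrightarrow> Ck_on n S g \<Longrightarrow> Ck_on n S (\<lambda>x. f x * g x)"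
  by (rule Ck_on_bilinear[OF _ bounded_bilinear_mult])

text \<open>The chain rule evaluates the derivative of \<open>g\<close> in a direction that varies
  with the point, whereas \<open>Ck_on\<close> controls it only in fixed directions. Expanding the
  direction in the basis turns the derivative into a finite sum of products, to which the induction
  hypothesis and the bilinear rule apply.\<close>

lemma Ck_on_compose:
  fixes g :: "'f::euclidean_space \<Rightarrow> 'g::real_normed_vector"
  assumes "open S" "open T" "f ` S \<subseteq> T" "Ck_on n S f" "Ck_on n T g"
  shows "Ck_on n S (\<lambda>x. g (f x))"
  using assms(4,5)
proof (induction n arbitrary: g)
  case 0
  then show ?case using continuous_on_compose2[of T g S f] assms(3) by simp
next
  case (Suc n)
  have *: "((\<lambda>x. g (f x)) has_derivative
      (\<lambda>v. \<Sum>b\<in>Basis. (frechet_derivative f (at x) v \<bullet> b) *\<^sub>R frechet_derivative g (at (f x)) b)) (at x)"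
    if x: "x \<in> S" for x
  proof -
    have g: "(g has_derivative frechet_derivative g (at (f x))) (at (f x))"
      using Ck_on_Suc_derivative[OF Suc.prems(2)] x assms(3) by auto
    have "((\<lambda>x. g (f x)) has_derivative
      (\<lambda>v. frechet_derivative g (at (f x)) (frechet_derivative f (at x) v))) (at x)"
      using diff_chain_at[OF Ck_on_Suc_derivative[OF Suc.prems(1) x] g] by (simp add: o_def)
    also have "(\<lambda>v. frechet_derivative g (at (f x)) (frechet_derivative f (at x) v)) =
        (\<lambda>v. \<Sum>b\<in>Basis. (frechet_derivative f (at x) v \<bullet> b) *\<^sub>R frechet_derivative g (at (f x)) b)"
    proof
      fix v
      let ?D = "frechet_derivative g (at (f x))" and ?w = "frechet_derivative f (at x) v"
      have "?D ?w = ?D (\<Sum>b\<in>Basis. (?w \<bullet> b) *\<^sub>R b)" by (simp only: euclidean_representation)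
      then show "?D ?w = (\<Sum>b\<in>Basis. (?w \<bullet> b) *\<^sub>R ?D b)"
        using has_derivative_linear[OF g] by (simp only: linear_sum linear_cmul)
    qed
    finally show ?thesis .
  qed
  have "Ck_on n S f" using Suc.prems(1) by (rule Ck_on_SucD)
  then have g': "Ck_on n S (\<lambda>x. frechet_derivative g (at (f x)) b)" for b
    using Suc.prems by (intro Suc.IH) auto
  have f': "Ck_on n S (\<lambda>x. frechet_derivative f (at x) v \<bullet> b)" for v b
    using Suc.prems by (intro Ck_on_linear_compose[OF assms(1) bounded_linear_inner_left]) auto
  have "Ck_on n S (\<lambda>x. \<Sum>b\<in>Basis. (frechet_derivative f (at x) v \<bullet> b) *\<^sub>R frechet_derivative g (at (f x)) b)" for v
    by (intro Ck_on_sum Ck_on_bilinear[OF _ bounded_bilinear_scaleR] assms(1) f' g' finite_Basis)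
  then show ?case using Ck_on_SucI[OF assms(1) *] by blast
qed

lemma Ck_on_Pair:
  assumes "open S" "Ck_on n S f" "Ck_on n S g"
  shows "Ck_on n S (\<lambda>x. (f x, g x))"
proof -
  have "Ck_on n S (\<lambda>x. (f x, 0) + (0, g x))"
    by (intro Ck_on_add assms Ck_on_linear_compose[where L="\<lambda>y. (y, 0)"]
      Ck_on_linear_compose[where L="\<lambda>y. (0, y)"]
      bounded_linear_Pair bounded_linear_ident bounded_linear_zero)
  then show ?thesis by simp
qed

section \<open>Smooth functions on open subsets of normed spaces\<close>

lemma smooth_on_cong: "open S \<Longrightarrow> (\<And>x. x \<in> S \<Longrightarrow> f x = g x) \<Longrightarrow> smooth_on S f \<Longrightarrow> smooth_on S g"
  unfolding smooth_on_def using Ck_on_cong by blast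

lemma smooth_on_subset: "smooth_on S f \<Longrightarrow> T \<subseteq> S \<Longrightarrow> smooth_on T f"
  unfolding smooth_on_def using Ck_on_subset by blast

lemma smooth_on_continuous: "smooth_on S f \<Longrightarrow> continuous_on S f"
  unfolding smooth_on_def using Ck_on_continuous by blast

lemma smooth_on_has_derivative:
  "smooth_on S f \<Longrightarrow> x \<in> S \<Longrightarrow> (f has_derivative frechet_derivative f (at x)) (at x)"
  unfolding smooth_on_def using Ck_on_Suc_derivative by blast

lemma smooth_on_derivative: "smooth_on S f \<Longrightarrow> smooth_on S (\<lambda>x. frechet_derivative f (at x) v)"
  unfolding smooth_on_def by (metis Ck_on.simps(2))

lemma smooth_on_const: "open S \<Longrightarrow> smooth_on S (\<lambda>x. c)"
  unfolding smooth_on_def using Ck_on_const by blast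

lemma smooth_on_linear: "open S \<Longrightarrow> bounded_linear L \<Longrightarrow> smooth_on S L"
  unfolding smooth_on_def using Ck_on_linear by blast

lemma smooth_on_add:
  "open S \<Longrightarrow> smooth_on S f \<Longrightarrow> smooth_on S g \<Longrightarrow> smooth_on S (\<lambda>x. f x + g x)"
  unfolding smooth_on_def using Ck_on_add by blast

lemma smooth_on_mult:
  fixes f g :: "'e::real_normed_vector \<Rightarrow> 'f::real_normed_algebra"
  shows "open S \<Longrightarrow> smooth_on S f \<Longrightarrow> smooth_on S g \<Longrightarrow> smooth_on S (\<lambda>x. f x * g x)"
  unfolding smooth_on_def using Ck_on_mult by blast

lemma smooth_on_compose:
  fixes g :: "'f::euclidean_space \<Rightarrow> 'g::real_normed_vector"
  shows "open S \<Longrightarrow> open T \<Longrightarrow> f ` S \<subseteq> T \<Longrightarrow> smooth_on S f \<Longrightarrow> smooth_on T g \<Longrightarrow>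
    smooth_on S (\<lambda>x. g (f x))"
  unfolding smooth_on_def using Ck_on_compose by blast

lemma smooth_on_Pair:
  "open S \<Longrightarrow> smooth_on S f \<Longrightarrow> smooth_on S g \<Longrightarrow> smooth_on S (\<lambda>x. (f x, g x))"
  unfolding smooth_on_def using Ck_on_Pair by blast

text \<open>The multiples of negative powers are closed under differentiation, the direction
  \<open>v\<close> being absorbed into the constant; hence the induction over all \<open>c\<close>
  and \<open>m\<close> at once. The case \<open>m = 1\<close> is the derivative of the
  logarithm.\<close>

lemma smooth_on_inverse_power:
  fixes S :: "complex set"
  assumes "open S" "0 \<notin> S"
  shows "smooth_on S (\<lambda>z. c * inverse z ^ m)"
  unfolding smooth_on_def
proof
  fix n
  show "Ck_on n S (\<lambda>z. c * inverse z ^ m)"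
  proof (induction n arbitrary: c m)
    case 0
    then show ?case using assms by (auto intro!: continuous_intros)
  next
    case (Suc n)
    have *: "((\<lambda>z. c * inverse z ^ m) has_derivative (\<lambda>v. v * (- c * of_nat m * inverse z ^ Suc m))) (at z)"
      if "z \<in> S" for z
    proof -
      have "z \<noteq> 0" using that assms by auto
      then have "((\<lambda>z. c * inverse z ^ m) has_field_derivative (- c * of_nat m * inverse z ^ Suc m)) (at z)"
      proof (cases m)
        case (Suc k)
        show ?thesis
          unfolding Suc
          by (rule DERIV_cong[OF DERIV_cmult[OF DERIV_power_Suc[OF DERIV_inverse[OF \<open>z \<noteq> 0\<close>]]]])
            (simp add: algebra_simps)
      qed simp
      then show ?thesis by (simp only: has_field_derivative_def mult_commute_abs)
    qed
    show ?case
    proof (rule Ck_on_SucI[OF assms(1) *])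
      show "Ck_on n S (\<lambda>z. v * (- c * of_nat m * inverse z ^ Suc m))" for v
        using Suc[of "v * (- c * of_nat m)" "Suc m"] by (simp add: mult.assoc)
    qed auto
  qed
qed

text \<open>The principal branch serves later to extract a smooth real angle from a circle-valued
  function.\<close>

lemma smooth_on_Ln: "smooth_on (- \<real>\<^sub>\<le>\<^sub>0) Ln"
  unfolding smooth_on_def
proof
  fix n
  have o: "open (- \<real>\<^sub>\<le>\<^sub>0 :: complex set)" by (simp add: open_Compl)
  have d: "(Ln has_derivative (\<lambda>v. v * inverse z ^ 1)) (at z)" if "z \<in> - \<real>\<^sub>\<le>\<^sub>0" for z
    using has_field_derivative_Ln[of z] that by (simp add: has_field_derivative_def mult_commute_abs)
  have "Ck_on (Suc n) (- \<real>\<^sub>\<le>\<^sub>0) Ln"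
    by (rule Ck_on_SucI[OF o d])
      (use smooth_on_inverse_power[OF o, of _ 1] in \<open>auto simp: smooth_on_def\<close>)
  then show "Ck_on n (- \<real>\<^sub>\<le>\<^sub>0) Ln" by (rule Ck_on_SucD)
qed

text \<open>The mean value theorem is applied twice to the second difference over a parallelogram:
  along \<open>a\<close> to the difference of \<open>f\<close> on two opposite sides, then along
  \<open>b\<close> to the derivative of \<open>f\<close> in direction \<open>a\<close>.\<close>

lemma mixed_difference_mean_value:
  fixes f :: "'e::real_normed_vector \<Rightarrow> real"
  assumes "h > 0"
    and f: "\<And>s t. 0 \<le> s \<Longrightarrow> s \<le> h \<Longrightarrow> 0 \<le> t \<Longrightarrow> t \<le> h \<Longrightarrow>
        (f has_derivative f' (x + s *\<^sub>R a + t *\<^sub>R b)) (at (x + s *\<^sub>R a + t *\<^sub>R b))"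
    and f': "\<And>s t. 0 \<le> s \<Longrightarrow> s \<le> h \<Longrightarrow> 0 \<le> t \<Longrightarrow> t \<le> h \<Longrightarrow>
        ((\<lambda>y. f' y a) has_derivative f'' (x + s *\<^sub>R a + t *\<^sub>R b)) (at (x + s *\<^sub>R a + t *\<^sub>R b))"
  shows "\<exists>s t. 0 < s \<and> s < h \<and> 0 < t \<and> t < h \<and>
    f (x + h *\<^sub>R a + h *\<^sub>R b) - f (x + h *\<^sub>R a) - f (x + h *\<^sub>R b) + f x =
      h * h * f'' (x + s *\<^sub>R a + t *\<^sub>R b) b"
proof -
  \<comment> \<open>The values of \<open>g\<close> at \<open>h\<close> and at 0 differ by the mixed
    second difference. The summand \<open>0 *\<^sub>R b\<close> is kept so that both terms have the
    shape covered by \<open>line\<close>.\<close>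
  define g where "g s = f (x + s *\<^sub>R a + h *\<^sub>R b) - f (x + s *\<^sub>R a + 0 *\<^sub>R b)" for s
  have line: "((\<lambda>s. F (x + s *\<^sub>R a + t *\<^sub>R b)) has_real_derivative D a) (at s)"
    if "(F has_derivative D) (at (x + s *\<^sub>R a + t *\<^sub>R b))" for F D s t
  proof -
    have "((\<lambda>s. F (x + s *\<^sub>R a + t *\<^sub>R b)) has_derivative (\<lambda>u. D (u *\<^sub>R a))) (at s)"
      by (rule has_derivative_compose[of "\<lambda>s. x + s *\<^sub>R a + t *\<^sub>R b", OF _ that])
        (auto intro!: derivative_eq_intros)
    moreover have "D (u *\<^sub>R a) = D a * u" for u
      using has_derivative_linear[OF that] by (simp add: linear_cmul)
    ultimately show ?thesis by (simp add: has_field_derivative_def)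
  qed
  have line': "((\<lambda>t. F (x + s *\<^sub>R a + t *\<^sub>R b)) has_real_derivative D b) (at t)"
    if "(F has_derivative D) (at (x + s *\<^sub>R a + t *\<^sub>R b))" for F D s t
  proof -
    have "((\<lambda>t. F (x + s *\<^sub>R a + t *\<^sub>R b)) has_derivative (\<lambda>u. D (u *\<^sub>R b))) (at t)"
      by (rule has_derivative_compose[of "\<lambda>t. x + s *\<^sub>R a + t *\<^sub>R b", OF _ that])
        (auto intro!: derivative_eq_intros)
    moreover have "D (u *\<^sub>R b) = D b * u" for u
      using has_derivative_linear[OF that] by (simp add: linear_cmul)
    ultimately show ?thesis by (simp add: has_field_derivative_def)
  qed
  have "\<exists>s. 0 < s \<and> s < h \<and> g h - g 0 = (h - 0) * (f' (x + s *\<^sub>R a + h *\<^sub>R b) a - f' (x + s *\<^sub>R a + 0 *\<^sub>R b) a)"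
  proof (rule MVT2)
    show "(g has_real_derivative f' (x + s *\<^sub>R a + h *\<^sub>R b) a - f' (x + s *\<^sub>R a + 0 *\<^sub>R b) a) (at s)"
      if "0 \<le> s" "s \<le> h" for s
      unfolding g_def
      by (rule DERIV_diff line f that order_refl less_imp_le[OF assms(1)])+
  qed (use assms in auto)
  then obtain s where s: "0 < s" "s < h"
    "g h - g 0 = h * (f' (x + s *\<^sub>R a + h *\<^sub>R b) a - f' (x + s *\<^sub>R a + 0 *\<^sub>R b) a)" by auto
  have "\<exists>t. 0 < t \<and> t < h \<and> f' (x + s *\<^sub>R a + h *\<^sub>R b) a - f' (x + s *\<^sub>R a + 0 *\<^sub>R b) a =
      (h - 0) * f'' (x + s *\<^sub>R a + t *\<^sub>R b) b"
  proof (rule MVT2)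
    show "((\<lambda>t. f' (x + s *\<^sub>R a + t *\<^sub>R b) a) has_real_derivative f'' (x + s *\<^sub>R a + t *\<^sub>R b) b) (at t)"
      if "0 \<le> t" "t \<le> h" for t
      by (rule line'[where F = "\<lambda>y. f' y a"]) (use f' that s in auto)
  qed (use assms in auto)
  then obtain t where t: "0 < t" "t < h"
    "f' (x + s *\<^sub>R a + h *\<^sub>R b) a - f' (x + s *\<^sub>R a + 0 *\<^sub>R b) a = h * f'' (x + s *\<^sub>R a + t *\<^sub>R b) b"
    by auto
  have "g h - g 0 = h * h * f'' (x + s *\<^sub>R a + t *\<^sub>R b) b" using s(3) t(3) by simp
  then show ?thesis using s t unfolding g_def by (intro exI[of _ s] exI[of _ t]) simp
qed

text \<open>The second difference is symmetric in \<open>a\<close> and \<open>b\<close>. At every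
  small scale it equals a value of each mixed derivative at some nearby point, so continuity of both
  forces them to agree at \<open>x\<close>.\<close>

lemma frechet_derivative_commute:
  fixes f :: "'e::real_normed_vector \<Rightarrow> real"
  assumes S: "open S" "x \<in> S" and f: "smooth_on S f"
  shows "frechet_derivative (\<lambda>y. frechet_derivative f (at y) a) (at x) b =
         frechet_derivative (\<lambda>y. frechet_derivative f (at y) b) (at x) a"
proof -
  define G where "G a b y = frechet_derivative (\<lambda>y. frechet_derivative f (at y) a) (at y) b" for a b y
  have sG: "continuous_on S (G a b)" for a b
    unfolding G_def by (intro smooth_on_continuous smooth_on_derivative f)
  have "\<bar>G a b x - G b a x\<bar> < e" if e: "e > 0" for e
  proof -
    have "\<exists>d>0. \<forall>y. dist y x < d \<longrightarrow> y \<in> S \<and> dist (G a b y) (G a b x) < e / 2" for a b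
    proof -
      obtain d where "d > 0" "ball x d \<subseteq> S" using S openE by blast
      moreover obtain d' where "d' > 0" "\<forall>y\<in>S. dist y x < d' \<longrightarrow> dist (G a b y) (G a b x) < e / 2"
        using sG[of a b] S e unfolding continuous_on_iff by (meson half_gt_zero)
      ultimately show ?thesis
        by (intro exI[of _ "min d d'"]) (auto simp: dist_commute subset_iff)
    qed
    then obtain d1 d2 where d: "d1 > 0" "d2 > 0"
      "\<And>y. dist y x < d1 \<Longrightarrow> y \<in> S \<and> dist (G a b y) (G a b x) < e / 2"
      "\<And>y. dist y x < d2 \<Longrightarrow> y \<in> S \<and> dist (G b a y) (G b a x) < e / 2"
      by meson
    \<comment> \<open>This scale keeps the whole parallelogram with sides
      \<open>h *\<^sub>R a\<close> and \<open>h *\<^sub>R b\<close> within both radii; the summand 1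
      makes the denominator positive even for zero vectors.\<close>
    define h where "h = min d1 d2 / (norm a + norm b + 1)"
    have h: "h > 0" using d unfolding h_def by (auto simp: add_nonneg_pos)
    have near: "dist (x + s *\<^sub>R a + t *\<^sub>R b) x < min d1 d2"
      if "0 \<le> s" "s \<le> h" "0 \<le> t" "t \<le> h" for s t
    proof -
      have "dist (x + s *\<^sub>R a + t *\<^sub>R b) x \<le> norm (s *\<^sub>R a) + norm (t *\<^sub>R b)"
        using norm_triangle_ineq[of "s *\<^sub>R a" "t *\<^sub>R b"] by (simp add: dist_norm add.assoc)
      also have "\<dots> \<le> h * norm a + h * norm b"
        using that by (auto intro!: add_mono mult_right_mono)
      also have "\<dots> < h * (norm a + norm b + 1)" using h by (simp add: algebra_simps)
      also have "\<dots> = min d1 d2"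
      proof -
        have "norm a + norm b + 1 \<noteq> 0" by (smt (verit) norm_ge_zero)
        then show ?thesis unfolding h_def by simp
      qed
      finally show ?thesis .
    qed
    have near': "dist (x + s *\<^sub>R b + t *\<^sub>R a) x < min d1 d2"
      if "0 \<le> s" "s \<le> h" "0 \<le> t" "t \<le> h" for s t
      using near[OF that(3,4,1,2)] by (simp add: algebra_simps)
    have D: "(f has_derivative frechet_derivative f (at y)) (at y)"
      and D': "((\<lambda>y. frechet_derivative f (at y) c) has_derivative
        frechet_derivative (\<lambda>y. frechet_derivative f (at y) c) (at y)) (at y)"
      if "dist y x < min d1 d2" for y c
      using that d smooth_on_has_derivative[OF f] smooth_on_has_derivative[OF smooth_on_derivative[OF f]]
      by auto
    obtain s t where st: "0 < s" "s < h" "0 < t" "t < h"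
      "f (x + h *\<^sub>R a + h *\<^sub>R b) - f (x + h *\<^sub>R a) - f (x + h *\<^sub>R b) + f x = h * h * G a b (x + s *\<^sub>R a + t *\<^sub>R b)"
      using mixed_difference_mean_value[OF h D[OF near] D'[OF near]] unfolding G_def by blast
    obtain s' t' where st': "0 < s'" "s' < h" "0 < t'" "t' < h"
      "f (x + h *\<^sub>R b + h *\<^sub>R a) - f (x + h *\<^sub>R b) - f (x + h *\<^sub>R a) + f x = h * h * G b a (x + s' *\<^sub>R b + t' *\<^sub>R a)"
      using mixed_difference_mean_value[OF h D[OF near'] D'[OF near']] unfolding G_def by blast
    have "h * h * G a b (x + s *\<^sub>R a + t *\<^sub>R b) = h * h * G b a (x + s' *\<^sub>R b + t' *\<^sub>R a)"
      using st(5) st'(5) by (simp add: algebra_simps)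
    then have "G a b (x + s *\<^sub>R a + t *\<^sub>R b) = G b a (x + s' *\<^sub>R b + t' *\<^sub>R a)"
      using h by simp
    moreover have "dist (G a b (x + s *\<^sub>R a + t *\<^sub>R b)) (G a b x) < e / 2"
      using d(3) near[of s t] st by simp
    moreover have "dist (G b a (x + s' *\<^sub>R b + t' *\<^sub>R a)) (G b a x) < e / 2"
      using d(4) near'[of s' t'] st' by simp
    ultimately show ?thesis unfolding dist_real_def by linarith
  qed
  \<comment> \<open>If the difference were nonzero, it could itself be taken as the error bound and
    would be smaller than itself.\<close>
  from this[of "\<bar>G a b x - G b a x\<bar>"] have "G a b x = G b a x" by auto
  then show ?thesis unfolding G_def .
qed

subsection \<open>Smooth maps between manifolds\<close>

text \<open>Smoothness as a property of germs, so that composition and localization need no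
  bookkeeping of domains. The neighbourhood is open because \<open>smooth_map_on\<close> demands
  it.\<close>

definition smooth_at ::
    "('a::topological_space, 'e::euclidean_space) chart set \<Rightarrow>
     ('b::topological_space, 'f::euclidean_space) chart set \<Rightarrow> 'a \<Rightarrow> ('a \<Rightarrow> 'b) \<Rightarrow> bool" where
  "smooth_at A B p F \<longleftrightarrow> (\<exists>S. p \<in> S \<and> smooth_map_on A B S F)"

lemma smooth_near_eq: "smooth_near A p f \<longleftrightarrow> smooth_at A euclidean_atlas p f"
  by (simp add: smooth_near_def smooth_at_def)

lemma atlas_cover: "smooth_atlas A \<Longrightarrow> \<exists>U x. (U, x) \<in> A \<and> p \<in> U"
proof -
  assume "smooth_atlas A"
  then have "p \<in> (\<Union>(U, x)\<in>A. U)" unfolding smooth_atlas_def by simp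
  then show ?thesis by blast
qed

lemma chart_open: "smooth_atlas A \<Longrightarrow> (U, x) \<in> A \<Longrightarrow> open U"
  and chart_homeomorphism: "smooth_atlas A \<Longrightarrow> (U, x) \<in> A \<Longrightarrow> homeomorphism U (x ` U) x (inv_into U x)"
  and chart_open_range: "smooth_atlas A \<Longrightarrow> (U, x) \<in> A \<Longrightarrow> open (x ` U)"
  unfolding smooth_atlas_def by blast+

lemma chart_inj: "smooth_atlas A \<Longrightarrow> (U, x) \<in> A \<Longrightarrow> inj_on x U"
  using chart_homeomorphism[of A U x] by (auto simp: homeomorphism_def intro: inj_on_inverseI)

lemma chart_inv: "smooth_atlas A \<Longrightarrow> (U, x) \<in> A \<Longrightarrow> q \<in> U \<Longrightarrow> inv_into U x (x q) = q"
  using chart_inj inv_into_f_f by metis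

lemma chart_continuous: "smooth_atlas A \<Longrightarrow> (U, x) \<in> A \<Longrightarrow> continuous_on U x"
  and chart_inv_continuous: "smooth_atlas A \<Longrightarrow> (U, x) \<in> A \<Longrightarrow> continuous_on (x ` U) (inv_into U x)"
  using chart_homeomorphism unfolding homeomorphism_def by blast+

lemma chart_open_image:
  assumes "smooth_atlas A" "(U, x) \<in> A" "open S" "S \<subseteq> U"
  shows "open (x ` S)"
proof -
  have "openin (top_of_set (x ` U)) (x ` S)"
    using homeomorphism_imp_open_map[OF chart_homeomorphism[OF assms(1,2)], of S] assms(3,4)
      chart_open[OF assms(1,2)] by (simp add: openin_open_eq)
  then show ?thesis
    using chart_open_range[OF assms(1,2)] by (simp add: openin_open_eq)
qed

lemma transition_smooth:
  "smooth_atlas A \<Longrightarrow> (U, x) \<in> A \<Longrightarrow> (V, y) \<in> A \<Longrightarrow> smooth_on (x ` (U \<inter> V)) (y \<circ> inv_into U x)"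
  unfolding smooth_atlas_def by blast

text \<open>\<open>smooth_map_on\<close> quantifies over all pairs of charts. One pair that contains
  the domain and the image suffices: in any other pair the map is the given expression between two
  smooth transition maps.\<close>

lemma smooth_map_onI:
  assumes A: "smooth_atlas A" "(U, x) \<in> A" and B: "smooth_atlas B" "(V, y) \<in> B"
    and S: "open S" "S \<subseteq> U" "F ` S \<subseteq> V"
    and F: "smooth_on (x ` S) (\<lambda>\<xi>. y (F (inv_into U x \<xi>)))"
  shows "smooth_map_on A B S F"
  unfolding smooth_map_on_def
proof (intro conjI ballI)
  show cont: "continuous_on S F"
  proof -
    have "continuous_on S (\<lambda>q. inv_into V y (y (F (inv_into U x (x q)))))"
    proof (rule continuous_on_compose2[OF chart_inv_continuous[OF B]])
      show "continuous_on S (\<lambda>q. y (F (inv_into U x (x q))))"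
        by (rule continuous_on_compose2[OF smooth_on_continuous[OF F]])
          (use chart_continuous[OF A] S continuous_on_subset in auto)
    qed (use S chart_inv[OF A] in \<open>auto simp: subset_iff\<close>)
    then show ?thesis
      by (rule continuous_on_cong[THEN iffD1, rotated -1])
        (use S chart_inv[OF A] chart_inv[OF B] in \<open>auto simp: subset_iff\<close>)
  qed
  show "case c of (U', x') \<Rightarrow> \<forall>(V', y')\<in>B. smooth_on (x' ` (U' \<inter> S \<inter> F -` V')) (y' \<circ> F \<circ> inv_into U' x')"
    if "c \<in> A" for c
  proof (cases c, simp only: split_conv, intro ballI, clarify)
    fix U' x' V' y'
    assume c: "c = (U', x')" and y': "(V', y') \<in> B"
    have x': "(U', x') \<in> A" using that c by simp
    define R where "R = U' \<inter> S \<inter> F -` V'"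
    have R: "open R" "R \<subseteq> U'" "R \<subseteq> U" "R \<subseteq> S"
      using continuous_open_preimage[OF cont S(1) chart_open[OF B(1) y']] chart_open[OF A(1) x'] S(2)
      unfolding R_def by (auto simp: Int_assoc)
    have 1: "smooth_on (x' ` R) (\<lambda>\<xi>. x (inv_into U' x' \<xi>))"
      using smooth_on_subset[OF transition_smooth[OF A(1) x' A(2)], of "x' ` R"] R by (auto simp: o_def)
    have 2: "smooth_on (x' ` R) (\<lambda>\<xi>. y (F (inv_into U x (x (inv_into U' x' \<xi>)))))"
      by (rule smooth_on_compose[OF chart_open_image[OF A(1) x' R(1,2)]
            chart_open_image[OF A(1,2) S(1,2)] _ 1 F])
         (use R chart_inv[OF A(1) x'] in \<open>force simp: subset_iff\<close>)
    have 3: "smooth_on (x' ` R) (\<lambda>\<xi>. y' (inv_into V y (y (F (inv_into U x (x (inv_into U' x' \<xi>)))))))"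
    proof (rule smooth_on_compose[OF chart_open_image[OF A(1) x' R(1,2)] _ _ 2])
      show "smooth_on (y ` (V \<inter> V')) (\<lambda>\<xi>. y' (inv_into V y \<xi>))"
        using transition_smooth[OF B y'] by (simp add: o_def)
      show "open (y ` (V \<inter> V'))"
        using chart_open_image[OF B] chart_open[OF B] chart_open[OF B(1) y'] by blast
      show "(\<lambda>\<xi>. y (F (inv_into U x (x (inv_into U' x' \<xi>))))) ` x' ` R \<subseteq> y ` (V \<inter> V')"
        using R S chart_inv[OF A(1) x'] chart_inv[OF A] unfolding R_def by (auto simp: subset_iff)
    qed
    have "smooth_on (x' ` R) (y' \<circ> F \<circ> inv_into U' x')"
      by (rule smooth_on_cong[OF chart_open_image[OF A(1) x' R(1,2)] _ 3])
        (use R S chart_inv[OF A(1) x'] chart_inv[OF A] chart_inv[OF B] in \<open>auto simp: subset_iff\<close>)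
    then show "smooth_on (x' ` (U' \<inter> S \<inter> F -` V')) (y' \<circ> F \<circ> inv_into U' x')" unfolding R_def .
  qed
qed fact

lemma smooth_map_on_subset:
  "smooth_map_on A B S F \<Longrightarrow> open T \<Longrightarrow> T \<subseteq> S \<Longrightarrow> smooth_map_on A B T F"
  unfolding smooth_map_on_def
  by (auto intro: continuous_on_subset) (rule smooth_on_subset, blast, blast)

lemma smooth_atI:
  assumes "smooth_atlas A" "(U, x) \<in> A" "smooth_atlas B" "(V, y) \<in> B"
    and "open S" "p \<in> S" "S \<subseteq> U" "F ` S \<subseteq> V"
    and "smooth_on (x ` S) (\<lambda>\<xi>. y (F (inv_into U x \<xi>)))"
  shows "smooth_at A B p F"
  using smooth_map_onI[OF assms(1-5,7-9)] assms(6) unfolding smooth_at_def by blast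

text \<open>Continuity lets the neighbourhood shrink until source and image each lie in one
  prescribed chart; there smoothness is that of a map between Euclidean spaces.\<close>

lemma smooth_atE:
  assumes "smooth_atlas A" "(U, x) \<in> A" "p \<in> U" "smooth_atlas B" "(V, y) \<in> B" "F p \<in> V"
    and "smooth_at A B p F"
  obtains S where "open S" "p \<in> S" "S \<subseteq> U" "F ` S \<subseteq> V" "continuous_on S F"
    "smooth_map_on A B S F" "open (x ` S)" "smooth_on (x ` S) (\<lambda>\<xi>. y (F (inv_into U x \<xi>)))"
proof -
  obtain T where T: "p \<in> T" "smooth_map_on A B T F" using assms(7) unfolding smooth_at_def by blast
  then have T': "open T" "continuous_on T F" unfolding smooth_map_on_def by auto
  define S where "S = U \<inter> T \<inter> F -` V"
  have S: "open S"
    using continuous_open_preimage[OF T'(2,1) chart_open[OF assms(4,5)]] chart_open[OF assms(1,2)]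
    unfolding S_def by (auto simp: Int_assoc)
  have "smooth_on (x ` S) (y \<circ> F \<circ> inv_into U x)"
    using T(2) assms(2,5) unfolding smooth_map_on_def S_def by blast
  then show ?thesis
    using that[of S] S T T' assms(3,6) smooth_map_on_subset[OF T(2) S]
      chart_open_image[OF assms(1,2) S] continuous_on_subset[OF T'(2), of S]
    unfolding S_def by (auto simp: o_def)
qed

lemma smooth_at_eventually:
  assumes "smooth_at A B p F"
  obtains S where "open S" "p \<in> S" "\<And>q. q \<in> S \<Longrightarrow> smooth_at A B q F"
  using assms unfolding smooth_at_def smooth_map_on_def by blast

lemma smooth_at_preimage:
  assumes "smooth_at A B p F" "open V" "F p \<in> V"
  obtains S where "open S" "p \<in> S" "F ` S \<subseteq> V" "\<And>q. q \<in> S \<Longrightarrow> smooth_at A B q F"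
proof -
  obtain T where T: "p \<in> T" "smooth_map_on A B T F" using assms(1) unfolding smooth_at_def by blast
  then have "open (T \<inter> F -` V)"
    using continuous_open_preimage assms(2) unfolding smooth_map_on_def by blast
  then show ?thesis using that[of "T \<inter> F -` V"] T assms(3) unfolding smooth_at_def by blast
qed

lemma smooth_at_compose:
  assumes A: "smooth_atlas A" and B: "smooth_atlas B" and C: "smooth_atlas C"
    and F: "smooth_at A B p F" and G: "smooth_at B C (F p) G"
  shows "smooth_at A C p (\<lambda>q. G (F q))"
proof -
  obtain U x V y W z where x: "(U, x) \<in> A" "p \<in> U" and y: "(V, y) \<in> B" "F p \<in> V"
    and z: "(W, z) \<in> C" "G (F p) \<in> W"
    using atlas_cover[OF A] atlas_cover[OF B] atlas_cover[OF C] by meson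
  obtain S where S: "open S" "p \<in> S" "S \<subseteq> U" "F ` S \<subseteq> V" "continuous_on S F"
      "smooth_on (x ` S) (\<lambda>\<xi>. y (F (inv_into U x \<xi>)))"
    by (rule smooth_atE[OF A x B y F])
  obtain R where R: "open R" "F p \<in> R" "R \<subseteq> V" "G ` R \<subseteq> W" "open (y ` R)"
      "smooth_on (y ` R) (\<lambda>\<xi>. z (G (inv_into V y \<xi>)))"
    by (rule smooth_atE[OF B y C z G])
  define S' where "S' = S \<inter> F -` R"
  have S': "open S'" "p \<in> S'" "S' \<subseteq> U" "S' \<subseteq> S"
    using continuous_open_preimage[OF S(5,1) R(1)] S R unfolding S'_def by auto
  note inv = chart_inv[OF A x(1)] chart_inv[OF B y(1)]
  have o: "open (x ` S')" by (rule chart_open_image[OF A x(1) S'(1,3)])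
  have "smooth_on (x ` S') (\<lambda>\<xi>. z (G (inv_into V y (y (F (inv_into U x \<xi>))))))"
  proof (rule smooth_on_compose[OF o R(5) _ _ R(6)])
    show "(\<lambda>\<xi>. y (F (inv_into U x \<xi>))) ` x ` S' \<subseteq> y ` R"
      using S'(3) inv unfolding S'_def by (auto simp: subset_iff)
    show "smooth_on (x ` S') (\<lambda>\<xi>. y (F (inv_into U x \<xi>)))"
      using S(6) S'(4) by (blast intro: smooth_on_subset)
  qed
  then have "smooth_on (x ` S') (\<lambda>\<xi>. z (G (F (inv_into U x \<xi>))))"
    by (rule smooth_on_cong[OF o, rotated])
      (use S'(3) S(4) R(3) inv in \<open>auto simp: subset_iff S'_def\<close>)
  then show ?thesis
    by (rule smooth_atI[OF A x(1) C z(1) S'(1,2,3), rotated]) (use R(4) in \<open>auto simp: S'_def\<close>)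
qed

lemma smooth_at_cong:
  assumes A: "smooth_atlas A" and B: "smooth_atlas B"
    and F: "smooth_at A B p F" and T: "open T" "p \<in> T" "\<And>q. q \<in> T \<Longrightarrow> F q = G q"
  shows "smooth_at A B p G"
proof -
  obtain U x V y where x: "(U, x) \<in> A" "p \<in> U" and y: "(V, y) \<in> B" "F p \<in> V"
    using atlas_cover[OF A] atlas_cover[OF B] by meson
  obtain S where S: "open S" "p \<in> S" "S \<subseteq> U" "F ` S \<subseteq> V"
      "smooth_on (x ` S) (\<lambda>\<xi>. y (F (inv_into U x \<xi>)))"
    by (rule smooth_atE[OF A x B y F])
  have o: "open (x ` (S \<inter> T))" using chart_open_image[OF A x(1)] S T by blast
  have "smooth_on (x ` (S \<inter> T)) (\<lambda>\<xi>. y (G (inv_into U x \<xi>)))"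
    by (rule smooth_on_cong[OF o _ smooth_on_subset[OF S(5)]])
      (use chart_inv[OF A x(1)] S T in \<open>auto simp: subset_iff\<close>)
  then show ?thesis
    by (rule smooth_atI[OF A x(1) B y(1), rotated -1]) (use S T in auto)
qed

section \<open>Functions with values in a Euclidean space\<close>

lemma smooth_atlas_euclidean [simp]: "smooth_atlas (euclidean_atlas :: ('e::euclidean_space, 'e) chart set)"
  unfolding smooth_atlas_def euclidean_atlas_def
  by (auto simp: homeomorphism_def o_def intro!: smooth_on_linear bounded_linear_ident)

lemma euclidean_chart: "(UNIV, \<lambda>x. x) \<in> euclidean_atlas"
  by (simp add: euclidean_atlas_def)

lemma smooth_at_euclidean:
  "smooth_at euclidean_atlas euclidean_atlas p f \<longleftrightarrow> (\<exists>S. open S \<and> p \<in> S \<and> smooth_on S f)"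
proof
  assume "smooth_at euclidean_atlas euclidean_atlas p f"
  then show "\<exists>S. open S \<and> p \<in> S \<and> smooth_on S f"
    by (rule smooth_atE[OF smooth_atlas_euclidean euclidean_chart _ smooth_atlas_euclidean euclidean_chart, rotated 2])
      auto
next
  assume "\<exists>S. open S \<and> p \<in> S \<and> smooth_on S f"
  then show "smooth_at euclidean_atlas euclidean_atlas p f"
    using smooth_atI[OF smooth_atlas_euclidean euclidean_chart smooth_atlas_euclidean euclidean_chart,
        of _ p f] by auto
qed

lemma smooth_near_chart:
  assumes "smooth_atlas A" "(U, x) \<in> A" "p \<in> U"
  shows "smooth_at A euclidean_atlas p f \<longleftrightarrow>
    (\<exists>S. open S \<and> p \<in> S \<and> S \<subseteq> U \<and> smooth_on (x ` S) (\<lambda>\<xi>. f (inv_into U x \<xi>)))" (is "?L = ?R")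
proof
  assume ?L
  then show ?R by (rule smooth_atE[OF assms smooth_atlas_euclidean euclidean_chart, rotated]) auto
next
  assume ?R
  then show ?L using smooth_atI[OF assms(1,2) smooth_atlas_euclidean euclidean_chart] by auto
qed

lemma smooth_at_id: "smooth_atlas A \<Longrightarrow> smooth_at A A p (\<lambda>q. q)"
proof -
  assume A: "smooth_atlas A"
  obtain U x where x: "(U, x) \<in> A" "p \<in> U" using atlas_cover[OF A] by meson
  show ?thesis
  proof (rule smooth_atI[OF A x(1) A x(1) chart_open[OF A x(1)] x(2)])
    show "smooth_on (x ` U) (\<lambda>\<xi>. x (inv_into U x \<xi>))"
      using transition_smooth[OF A x(1) x(1)] by (simp add: o_def)
  qed auto
qed

lemma smooth_at_const: "smooth_atlas A \<Longrightarrow> smooth_atlas B \<Longrightarrow> smooth_at A B p (\<lambda>q. b)"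
proof -
  assume A: "smooth_atlas A" and B: "smooth_atlas B"
  obtain U x V y where x: "(U, x) \<in> A" "p \<in> U" and y: "(V, y) \<in> B" "b \<in> V"
    using atlas_cover[OF A] atlas_cover[OF B] by meson
  show ?thesis
    by (rule smooth_atI[OF A x(1) B y(1) chart_open[OF A x(1)] x(2)])
      (use y chart_open_range[OF A x(1)] in \<open>auto intro: smooth_on_const\<close>)
qed

lemma smooth_at_chart_map:
  assumes A: "smooth_atlas A" "(U, x) \<in> A" "p \<in> U"
  shows "smooth_at A euclidean_atlas p x"
proof (rule smooth_atI[OF A(1,2) smooth_atlas_euclidean euclidean_chart chart_open[OF A(1,2)] A(3)])
  show "smooth_on (x ` U) (\<lambda>\<xi>. x (inv_into U x \<xi>))"
    using transition_smooth[OF A(1,2,2)] by (simp add: o_def)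
qed auto

lemma smooth_at_chart_inv:
  assumes A: "smooth_atlas A" "(U, x) \<in> A" "\<xi> \<in> x ` U"
  shows "smooth_at euclidean_atlas A \<xi> (inv_into U x)"
proof (rule smooth_atI[OF smooth_atlas_euclidean euclidean_chart A(1,2) chart_open_range[OF A(1,2)] A(3)])
  show "smooth_on ((\<lambda>x. x) ` x ` U) (\<lambda>\<xi>. x (inv_into U x (inv_into UNIV (\<lambda>x. x) \<xi>)))"
    using transition_smooth[OF A(1,2,2)] by (simp add: o_def image_image)
qed (auto simp: chart_inv[OF A(1,2)])

lemma smooth_at_compose_linear:
  assumes "smooth_atlas A" "bounded_linear L" "smooth_at A euclidean_atlas p f"
  shows "smooth_at A euclidean_atlas p (\<lambda>q. L (f q))"
  by (rule smooth_at_compose[OF assms(1) smooth_atlas_euclidean smooth_atlas_euclidean assms(3)])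
    (use smooth_on_linear[OF open_UNIV assms(2)] in \<open>auto simp: smooth_at_euclidean\<close>)

lemma smooth_at_Pair_euclidean:
  assumes A: "smooth_atlas A" and f: "smooth_at A euclidean_atlas p f"
    and g: "smooth_at A euclidean_atlas p g"
  shows "smooth_at A euclidean_atlas p (\<lambda>q. (f q, g q))"
proof -
  obtain U x where x: "(U, x) \<in> A" "p \<in> U" using atlas_cover[OF A] by meson
  obtain S T where S: "open S" "p \<in> S" "S \<subseteq> U" "smooth_on (x ` S) (\<lambda>\<xi>. f (inv_into U x \<xi>))"
    and T: "open T" "p \<in> T" "T \<subseteq> U" "smooth_on (x ` T) (\<lambda>\<xi>. g (inv_into U x \<xi>))"
    using f g unfolding smooth_near_chart[OF A x] by meson
  have "smooth_on (x ` (S \<inter> T)) (\<lambda>\<xi>. (f (inv_into U x \<xi>), g (inv_into U x \<xi>)))"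
    using S T chart_open_image[OF A x(1), of "S \<inter> T"]
    by (intro smooth_on_Pair) (auto elim: smooth_on_subset)
  then show ?thesis unfolding smooth_near_chart[OF A x] using S T by (intro exI[of _ "S \<inter> T"]) auto
qed

lemma smooth_at_add:
  assumes "smooth_atlas A" "smooth_at A euclidean_atlas p f" "smooth_at A euclidean_atlas p g"
  shows "smooth_at A euclidean_atlas p (\<lambda>q. f q + g q)"
  using smooth_at_compose_linear[OF assms(1) _ smooth_at_Pair_euclidean[OF assms], of "\<lambda>z. fst z + snd z"]
  by (simp add: bounded_linear_add bounded_linear_fst bounded_linear_snd)

lemma smooth_at_mult:
  fixes f g :: "_ \<Rightarrow> real"
  assumes "smooth_atlas A" "smooth_at A euclidean_atlas p f" "smooth_at A euclidean_atlas p g"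
  shows "smooth_at A euclidean_atlas p (\<lambda>q. f q * g q)"
proof -
  have "smooth_on UNIV (\<lambda>z::real\<times>real. fst z * snd z)"
    by (intro smooth_on_mult smooth_on_linear open_UNIV bounded_linear_fst bounded_linear_snd)
  then have "smooth_at euclidean_atlas euclidean_atlas (f p, g p) (\<lambda>z. fst z * snd z)"
    unfolding smooth_at_euclidean by blast
  then show ?thesis
    using smooth_at_compose[OF assms(1) smooth_atlas_euclidean smooth_atlas_euclidean
        smooth_at_Pair_euclidean[OF assms], of "\<lambda>z. fst z * snd z"] by simp
qed

lemma smooth_at_sum:
  assumes "smooth_atlas A" "finite I" "\<And>i. i \<in> I \<Longrightarrow> smooth_at A euclidean_atlas p (f i)"
  shows "smooth_at A euclidean_atlas p (\<lambda>q. \<Sum>i\<in>I. f i q)"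
  using assms(2,3)
  by induction (auto intro: smooth_at_add smooth_at_const assms(1) smooth_atlas_euclidean)

lemma smooth_at_uminus:
  "smooth_atlas A \<Longrightarrow> smooth_at A euclidean_atlas p f \<Longrightarrow> smooth_at A euclidean_atlas p (\<lambda>q. - f q)"
  by (rule smooth_at_compose_linear[OF _ bounded_linear_minus[OF bounded_linear_ident]])

subsection \<open>Product manifolds\<close>

lemma inv_into_map_prod:
  assumes "inj_on x U" "inj_on y V" "z \<in> x ` U" "w \<in> y ` V"
  shows "inv_into (U \<times> V) (map_prod x y) (z, w) = (inv_into U x z, inv_into V y w)"
  by (rule inv_into_f_eq)
    (use assms in \<open>auto simp: inj_on_def f_inv_into_f inv_into_into\<close>)

text \<open>Two products occur later: \<real> x M as the domain of the circle action, and B x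
  \<real> as the model of the total space near a fibre. All the conditions split into the
  factors.\<close>

lemma smooth_atlas_prod:
  assumes A: "smooth_atlas A" and B: "smooth_atlas B"
  shows "smooth_atlas (prod_atlas A B)"
  unfolding smooth_atlas_def
proof (intro conjI)
  have "pq \<in> (\<Union>(W, z)\<in>prod_atlas A B. W)" for pq
  proof -
    obtain p q where pq: "pq = (p, q)" by fastforce
    obtain U x V y where x: "(U, x) \<in> A" "p \<in> U" and y: "(V, y) \<in> B" "q \<in> V"
      using atlas_cover[OF A] atlas_cover[OF B] by meson
    then have "(U \<times> V, map_prod x y) \<in> prod_atlas A B" unfolding prod_atlas_def by blast
    then show ?thesis using x y pq by blast
  qed
  then show "(\<Union>(W, z)\<in>prod_atlas A B. W) = UNIV" by blast
  have inv: "inv_into (U \<times> V) (map_prod x y) \<zeta> = (inv_into U x (fst \<zeta>), inv_into V y (snd \<zeta>))"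
    if "(U, x) \<in> A" "(V, y) \<in> B" "\<zeta> \<in> x ` U \<times> y ` V" for U x V y \<zeta>
    using inv_into_map_prod[OF chart_inj[OF A that(1)] chart_inj[OF B that(2)], of "fst \<zeta>" "snd \<zeta>"] that(3)
    by auto
  show "\<forall>(W, z)\<in>prod_atlas A B. open W \<and> open (z ` W) \<and> homeomorphism W (z ` W) z (inv_into W z)"
  proof clarify
    fix W z assume "(W, z) \<in> prod_atlas A B"
    then obtain U x V y where W: "W = U \<times> V" "z = map_prod x y" and x: "(U, x) \<in> A" and y: "(V, y) \<in> B"
      unfolding prod_atlas_def by blast
    have im: "z ` W = x ` U \<times> y ` V" unfolding W by auto
    have "continuous_on W z"
      unfolding W map_prod_def case_prod_unfold
      by (intro continuous_on_Pair continuous_on_compose2[OF chart_continuous[OF A x] continuous_on_fst]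
          continuous_on_compose2[OF chart_continuous[OF B y] continuous_on_snd] continuous_on_id) auto
    moreover have "continuous_on (x ` U \<times> y ` V) (\<lambda>\<zeta>. (inv_into U x (fst \<zeta>), inv_into V y (snd \<zeta>)))"
      by (intro continuous_on_Pair continuous_on_compose2[OF chart_inv_continuous[OF A x] continuous_on_fst]
          continuous_on_compose2[OF chart_inv_continuous[OF B y] continuous_on_snd] continuous_on_id) auto
    then have "continuous_on (z ` W) (inv_into W z)"
      unfolding im by (rule continuous_on_eq) (use inv[OF x y] W in auto)
    moreover have "inj_on z W"
      using chart_inj[OF A x] chart_inj[OF B y] unfolding W inj_on_def by auto
    ultimately have "homeomorphism W (z ` W) z (inv_into W z)"
      unfolding homeomorphism_def by (auto simp: f_inv_into_f)
    moreover have "open W" "open (z ` W)"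
      using chart_open[OF A x] chart_open[OF B y] chart_open_range[OF A x] chart_open_range[OF B y]
      unfolding im unfolding W(1) by (auto intro: open_Times)
    ultimately show "open W \<and> open (z ` W) \<and> homeomorphism W (z ` W) z (inv_into W z)" by blast
  qed
  show "\<forall>(W, z)\<in>prod_atlas A B. \<forall>(W', z')\<in>prod_atlas A B. smooth_on (z ` (W \<inter> W')) (z' \<circ> inv_into W z)"
  proof clarify
    fix W z W' z' assume "(W, z) \<in> prod_atlas A B" "(W', z') \<in> prod_atlas A B"
    then obtain U x V y U' x' V' y' where
      W: "W = U \<times> V" "z = map_prod x y" and x: "(U, x) \<in> A" and y: "(V, y) \<in> B" and
      W': "W' = U' \<times> V'" "z' = map_prod x' y'" and x': "(U', x') \<in> A" and y': "(V', y') \<in> B"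
      unfolding prod_atlas_def by blast
    have im: "z ` (W \<inter> W') = x ` (U \<inter> U') \<times> y ` (V \<inter> V')" unfolding W W' by auto
    have o: "open (x ` (U \<inter> U'))" "open (y ` (V \<inter> V'))"
      using chart_open_image[OF A x] chart_open_image[OF B y] chart_open[OF A x] chart_open[OF B y]
        chart_open[OF A x'] chart_open[OF B y'] by blast+
    have "smooth_on (x ` (U \<inter> U') \<times> y ` (V \<inter> V'))
        (\<lambda>\<zeta>. ((x' \<circ> inv_into U x) (fst \<zeta>), (y' \<circ> inv_into V y) (snd \<zeta>)))"
      by (intro smooth_on_Pair smooth_on_compose[OF _ _ _ _ transition_smooth[OF A x x']]
          smooth_on_compose[OF _ _ _ _ transition_smooth[OF B y y']] open_Times o
          smooth_on_linear bounded_linear_fst bounded_linear_snd) auto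
    then show "smooth_on (z ` (W \<inter> W')) (z' \<circ> inv_into W z)"
      unfolding im by (rule smooth_on_cong[rotated 2])
        (use inv[OF x y] W W' o in \<open>auto simp: open_Times\<close>)
  qed
qed

lemma prod_atlas_chart: "(U, x) \<in> A \<Longrightarrow> (V, y) \<in> B \<Longrightarrow> (U \<times> V, map_prod x y) \<in> prod_atlas A B"
  unfolding prod_atlas_def by blast

lemma smooth_at_fst:
  assumes A: "smooth_atlas A" and B: "smooth_atlas B"
  shows "smooth_at (prod_atlas A B) A pq fst"
proof -
  obtain U x V y where x: "(U, x) \<in> A" "fst pq \<in> U" and y: "(V, y) \<in> B" "snd pq \<in> V"
    using atlas_cover[OF A] atlas_cover[OF B] by meson
  have im: "map_prod x y ` (U \<times> V) = x ` U \<times> y ` V" by auto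
  have o: "open (x ` U \<times> y ` V)"
    using chart_open_range[OF A x(1)] chart_open_range[OF B y(1)] by (rule open_Times)
  show ?thesis
  proof (rule smooth_atI[OF smooth_atlas_prod[OF A B] prod_atlas_chart[OF x(1) y(1)] A x(1)])
    show "smooth_on (map_prod x y ` (U \<times> V)) (\<lambda>\<xi>. x (fst (inv_into (U \<times> V) (map_prod x y) \<xi>)))"
      unfolding im
      by (rule smooth_on_cong[OF o _ smooth_on_linear[OF o bounded_linear_fst]])
        (auto simp: inv_into_map_prod chart_inj[OF A x(1)] chart_inj[OF B y(1)] chart_inv[OF A x(1)])
  qed (use x y chart_open[OF A x(1)] chart_open[OF B y(1)] in \<open>auto simp: open_Times mem_Times_iff\<close>)
qed

lemma smooth_at_Pair:
  assumes C: "smooth_atlas C" and A: "smooth_atlas A" and B: "smooth_atlas B"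
    and f: "smooth_at C A p f" and g: "smooth_at C B p g"
  shows "smooth_at C (prod_atlas A B) p (\<lambda>q. (f q, g q))"
proof -
  obtain W z U x V y where z: "(W, z) \<in> C" "p \<in> W" and x: "(U, x) \<in> A" "f p \<in> U"
    and y: "(V, y) \<in> B" "g p \<in> V"
    using atlas_cover[OF A] atlas_cover[OF B] atlas_cover[OF C] by meson
  obtain S where S: "open S" "p \<in> S" "S \<subseteq> W" "f ` S \<subseteq> U"
      "smooth_on (z ` S) (\<lambda>\<xi>. x (f (inv_into W z \<xi>)))"
    by (rule smooth_atE[OF C z A x f])
  obtain T where T: "open T" "p \<in> T" "T \<subseteq> W" "g ` T \<subseteq> V"
      "smooth_on (z ` T) (\<lambda>\<xi>. y (g (inv_into W z \<xi>)))"
    by (rule smooth_atE[OF C z B y g])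
  have o: "open (z ` (S \<inter> T))" using chart_open_image[OF C z(1), of "S \<inter> T"] S T by blast
  show ?thesis
  proof (rule smooth_atI[OF C z(1) smooth_atlas_prod[OF A B] prod_atlas_chart[OF x(1) y(1)]])
    show "smooth_on (z ` (S \<inter> T)) (\<lambda>\<xi>. map_prod x y (f (inv_into W z \<xi>), g (inv_into W z \<xi>)))"
      unfolding map_prod_simp
      by (intro smooth_on_Pair o smooth_on_subset[OF S(5)] smooth_on_subset[OF T(5)]) auto
  qed (use S T in auto)
qed

subsection \<open>Tangent vectors\<close>

lemma tangent_spaceI:
  assumes "smooth_at euclidean_atlas A 0 c"
  shows "velocity A c \<in> tangent_space A (c 0)"
proof -
  obtain S where S: "0 \<in> S" "smooth_map_on euclidean_atlas A S c"
    using assms unfolding smooth_at_def by blast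
  then have "open S" unfolding smooth_map_on_def by blast
  then obtain e where "e > 0" "ball 0 e \<subseteq> S" using S(1) openE by blast
  then have "smooth_map_on euclidean_atlas A {-e<..<e} c"
    by (intro smooth_map_on_subset[OF S(2)]) (auto simp: ball_eq_greaterThanLessThan)
  then show ?thesis using \<open>e > 0\<close> unfolding tangent_space_def by blast
qed

lemma tangent_spaceE:
  assumes "v \<in> tangent_space A p"
  obtains c where "c 0 = p" "v = velocity A c" "smooth_at euclidean_atlas A 0 c"
proof -
  obtain c e where "c 0 = p" "v = velocity A c" "e > 0" "smooth_map_on euclidean_atlas A {-e<..<e} c"
    using assms unfolding tangent_space_def by blast
  moreover have "0 \<in> {-e<..<e}" using \<open>e > 0\<close> by simp
  ultimately show ?thesis using that unfolding smooth_at_def by blast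
qed

lemma smooth_at_real_derivative:
  fixes f :: "real \<Rightarrow> real"
  assumes "smooth_at euclidean_atlas euclidean_atlas t f"
  shows "(f has_real_derivative deriv f t) (at t)"
proof -
  obtain S where "open S" "t \<in> S" "smooth_on S f" using assms unfolding smooth_at_euclidean by blast
  then have "f differentiable (at t)" using smooth_on_has_derivative differentiableI by blast
  then show ?thesis by (simp add: real_differentiable_def DERIV_deriv_iff_real_differentiable)
qed

text \<open>\<open>deriv\<close> is informative only where a derivative exists. This form can be fed
  to the differentiation rules and compared by uniqueness.\<close>

lemma velocity_has_derivative:
  assumes "smooth_atlas A" "smooth_at euclidean_atlas A 0 c" "smooth_at A euclidean_atlas (c 0) f"
  shows "((\<lambda>t. f (c t)) has_real_derivative velocity A c f) (at 0)"
  using smooth_at_real_derivative[OF smooth_at_compose[OF smooth_atlas_euclidean assms(1) smooth_atlas_euclidean assms(2,3)]]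
    assms(3) by (simp add: velocity_def smooth_near_eq)

lemma velocity_cong:
  assumes "open S" "0 \<in> S" "\<And>t. t \<in> S \<Longrightarrow> c t = d t"
  shows "velocity A c = velocity A d"
proof -
  show ?thesis
  proof
    fix f :: "_ \<Rightarrow> real"
    have "deriv (\<lambda>t. f (c t)) 0 = deriv (\<lambda>t. f (d t)) 0"
      by (rule deriv_cong_ev) (use assms in \<open>auto simp: eventually_nhds intro!: exI[of _ S]\<close>)
    then show "velocity A c f = velocity A d f" using assms by (simp add: velocity_def)
  qed
qed

lemma velocity_const: "velocity A (\<lambda>t. p) = zero_tangent"
  by (auto simp: velocity_def)

lemma tangent_not_smooth:
  "v \<in> tangent_space A p \<Longrightarrow> \<not> smooth_at A euclidean_atlas p f \<Longrightarrow> v f = 0"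
  by (erule tangent_spaceE) (simp add: velocity_def smooth_near_eq)

text \<open>On functions that are not smooth near \<open>p\<close> both operators take the default
  value 0.\<close>

lemma tangent_eqI:
  assumes "u \<in> tangent_space A p" "v \<in> tangent_space A p"
    and "\<And>f. smooth_at A euclidean_atlas p f \<Longrightarrow> u f = v f"
  shows "u = v"
  using assms tangent_not_smooth[OF assms(1)] tangent_not_smooth[OF assms(2)] by fastforce

text \<open>Besides the derivative along the curve, the default branch has to agree:
  \<open>f\<close> is smooth near \<open>p\<close> exactly if \<open>g\<close> is.\<close>

lemma tangent_local:
  assumes A: "smooth_atlas A" and v: "v \<in> tangent_space A p"
    and S: "open S" "p \<in> S" "\<And>q. q \<in> S \<Longrightarrow> f q = g q"
  shows "v f = v g"
proof -
  obtain c where c: "c 0 = p" "v = velocity A c" "smooth_at euclidean_atlas A 0 c"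
    by (rule tangent_spaceE[OF v])
  have iff: "smooth_at A euclidean_atlas p f \<longleftrightarrow> smooth_at A euclidean_atlas p g"
    using smooth_at_cong[OF A smooth_atlas_euclidean, of p f S g]
      smooth_at_cong[OF A smooth_atlas_euclidean, of p g S f] S by metis
  obtain R where R: "open R" "0 \<in> R" "c ` R \<subseteq> S"
    using smooth_at_preimage[OF c(3) S(1)] S(2) c(1) by metis
  have "deriv (\<lambda>t. f (c t)) 0 = deriv (\<lambda>t. g (c t)) 0"
    by (rule deriv_cong_ev) (use R S in \<open>auto simp: eventually_nhds intro!: exI[of _ R]\<close>)
  then show ?thesis using iff c by (simp add: velocity_def smooth_near_eq)
qed

lemma
  assumes A: "smooth_atlas A" and v: "v \<in> tangent_space A p"
    and f: "smooth_at A euclidean_atlas p f" and g: "smooth_at A euclidean_atlas p g"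
  shows tangent_add: "v (\<lambda>q. f q + g q) = v f + v g"
    and tangent_mult: "v (\<lambda>q. f q * g q) = f p * v g + v f * g p"
proof -
  obtain c where c: "c 0 = p" "v = velocity A c" "smooth_at euclidean_atlas A 0 c"
    by (rule tangent_spaceE[OF v])
  note d = velocity_has_derivative[OF A c(3), unfolded c(1), folded c(2)]
  show "v (\<lambda>q. f q + g q) = v f + v g"
    using DERIV_add[OF d[OF f] d[OF g]] d[OF smooth_at_add[OF A f g]] DERIV_unique by blast
  show "v (\<lambda>q. f q * g q) = f p * v g + v f * g p"
    using DERIV_unique[OF d[OF smooth_at_mult[OF A f g]] DERIV_mult'[OF d[OF f] d[OF g]]] c(1) by simp
qed

lemma tangent_const:
  assumes "smooth_atlas A" "v \<in> tangent_space A p"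
  shows "v (\<lambda>q. a) = 0"
  using assms(2) by (rule tangent_spaceE) (simp add: velocity_def)

lemma tangent_cmult:
  assumes A: "smooth_atlas A" and v: "v \<in> tangent_space A p" and f: "smooth_at A euclidean_atlas p f"
  shows "v (\<lambda>q. a * f q) = a * v f"
  using tangent_mult[OF A v smooth_at_const[OF A smooth_atlas_euclidean] f] tangent_const[OF A v] by simp

lemma tangent_sum:
  assumes A: "smooth_atlas A" and v: "v \<in> tangent_space A p"
    and f: "finite I" "\<And>i. i \<in> I \<Longrightarrow> smooth_at A euclidean_atlas p (f i)"
  shows "v (\<lambda>q. \<Sum>i\<in>I. f i q) = (\<Sum>i\<in>I. v (f i))"
  using f
proof induction
  case empty
  then show ?case by (simp add: tangent_const[OF A v])
next
  case (insert i I)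
  then show ?case by (simp add: tangent_add[OF A v _ smooth_at_sum[OF A]])
qed

section \<open>Coordinate vectors and components\<close>

lemma smooth_at_coordinate:
  assumes "smooth_atlas A" "(U, x) \<in> A" "p \<in> U"
  shows "smooth_at A euclidean_atlas p (\<lambda>q. x q \<bullet> b)"
  by (rule smooth_at_compose_linear[OF assms(1) bounded_linear_inner_left smooth_at_chart_map[OF assms]])

lemma coord_curve_smooth:
  assumes A: "smooth_atlas A" "(U, x) \<in> A" "q \<in> U"
  shows "smooth_at euclidean_atlas A 0 (\<lambda>t. inv_into U x (x q + t *\<^sub>R e))"
proof (rule smooth_at_compose[OF smooth_atlas_euclidean smooth_atlas_euclidean A(1)])
  have "smooth_on UNIV (\<lambda>t. x q + t *\<^sub>R e)"
    by (intro smooth_on_add smooth_on_const smooth_on_linear open_UNIV bounded_linear_scaleR_left)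
  then show "smooth_at euclidean_atlas euclidean_atlas 0 (\<lambda>t. x q + t *\<^sub>R e)"
    unfolding smooth_at_euclidean by blast
  show "smooth_at euclidean_atlas A (x q + 0 *\<^sub>R e) (inv_into U x)"
    using smooth_at_chart_inv[OF A(1,2)] A(3) by simp
qed

lemma coord_vector_tangent:
  assumes A: "smooth_atlas A" "(U, x) \<in> A" "q \<in> U"
  shows "coord_vector A (U, x) e q \<in> tangent_space A q"
  using tangent_spaceI[OF coord_curve_smooth[OF A]] chart_inv[OF A] unfolding coord_vector_def by simp

lemma chart_expression_has_derivative:
  assumes A: "smooth_atlas A" "(U, x) \<in> A" "q \<in> U" and f: "smooth_at A euclidean_atlas q f"
  shows "((\<lambda>\<xi>. f (inv_into U x \<xi>)) has_derivative frechet_derivative (\<lambda>\<xi>. f (inv_into U x \<xi>)) (at (x q))) (at (x q))"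
  using f smooth_on_has_derivative unfolding smooth_near_chart[OF A] by blast

lemma coord_vector_apply:
  assumes A: "smooth_atlas A" "(U, x) \<in> A" "q \<in> U" and f: "smooth_at A euclidean_atlas q f"
  shows "coord_vector A (U, x) e q f = frechet_derivative (\<lambda>\<xi>. f (inv_into U x \<xi>)) (at (x q)) e"
proof -
  let ?D = "frechet_derivative (\<lambda>\<xi>. f (inv_into U x \<xi>)) (at (x q))"
  have "((\<lambda>t. f (inv_into U x (x q + t *\<^sub>R e))) has_derivative (\<lambda>s. ?D (s *\<^sub>R e))) (at 0)"
    by (rule has_derivative_compose[of "\<lambda>t. x q + t *\<^sub>R e"])
      (use chart_expression_has_derivative[OF assms] in \<open>auto intro!: derivative_eq_intros\<close>)
  moreover have "?D (s *\<^sub>R e) = ?D e * s" for s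
    using has_derivative_linear[OF chart_expression_has_derivative[OF assms]] by (simp add: linear_cmul)
  ultimately have "((\<lambda>t. f (inv_into U x (x q + t *\<^sub>R e))) has_real_derivative ?D e) (at 0)"
    by (simp add: has_field_derivative_def)
  then show ?thesis
    using DERIV_imp_deriv f chart_inv[OF A] by (simp add: coord_vector_def velocity_def smooth_near_eq)
qed

lemma coord_vector_linear:
  assumes A: "smooth_atlas A" "(U, x) \<in> A" "q \<in> U"
  shows "coord_vector A (U, x) (a *\<^sub>R e + b *\<^sub>R e') q =
    (\<lambda>f. a * coord_vector A (U, x) e q f + b * coord_vector A (U, x) e' q f)"
proof
  fix f
  show "coord_vector A (U, x) (a *\<^sub>R e + b *\<^sub>R e') q f =
    a * coord_vector A (U, x) e q f + b * coord_vector A (U, x) e' q f"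
  proof (cases "smooth_at A euclidean_atlas q f")
    case True
    then show ?thesis
      using has_derivative_linear[OF chart_expression_has_derivative[OF A True]]
      by (simp add: coord_vector_apply[OF A True] linear_add linear_cmul)
  next
    case False
    then show ?thesis by (simp add: tangent_not_smooth[OF coord_vector_tangent[OF A]])
  qed
qed

lemma coord_vector_zero: "coord_vector A c 0 q = zero_tangent"
  unfolding coord_vector_def by (simp add: velocity_const)

lemma coord_vector_coordinate:
  assumes A: "smooth_atlas A" "(U, x) \<in> A" "q \<in> U"
  shows "coord_vector A (U, x) e q (\<lambda>r. x r \<bullet> b) = e \<bullet> b"
proof -
  have "((\<lambda>\<xi>. \<xi> \<bullet> b) has_derivative (\<lambda>v. v \<bullet> b)) (at (x q))"
    by (intro bounded_linear_imp_has_derivative bounded_linear_inner_left)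
  then have "((\<lambda>\<xi>. x (inv_into U x \<xi>) \<bullet> b) has_derivative (\<lambda>v. v \<bullet> b)) (at (x q))"
    by (rule has_derivative_transform_within_open[OF _ chart_open_range[OF A(1,2)]])
      (use A(3) in \<open>auto simp: f_inv_into_f\<close>)
  then show ?thesis
    using frechet_derivative_at by (metis coord_vector_apply[OF A smooth_at_coordinate[OF A]])
qed

lemma components_coord_vector:
  assumes "smooth_atlas A" "(U, x) \<in> A" "q \<in> U"
  shows "components (U, x) (coord_vector A (U, x) e q) = e"
  by (simp add: components_def coord_vector_coordinate[OF assms] euclidean_representation)

lemma components_inner: "b \<in> Basis \<Longrightarrow> components (U, x) v \<bullet> b = v (\<lambda>q. x q \<bullet> b)"
  by (simp add: components_def)

lemma components_lincomb:
  "components c (\<lambda>f. a * u f + b * v f) = a *\<^sub>R components c u + b *\<^sub>R components c v"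
  by (simp add: components_def sum.distrib scaleR_sum_right scaleR_add_left)

text \<open>By the chain rule in the chart, a curve acts on functions only through the derivative of
  its coordinate expression at 0, which is \<open>D 1\<close> below. It may therefore be replaced by
  a straight coordinate line.\<close>

lemma coord_vector_components:
  assumes A: "smooth_atlas A" "(U, x) \<in> A" "p \<in> U" and v: "v \<in> tangent_space A p"
  shows "coord_vector A (U, x) (components (U, x) v) p = v"
proof (rule tangent_eqI[OF coord_vector_tangent[OF A] v])
  fix f :: "_ \<Rightarrow> real" assume f: "smooth_at A euclidean_atlas p f"
  obtain c where c: "c 0 = p" "v = velocity A c" "smooth_at euclidean_atlas A 0 c"
    by (rule tangent_spaceE[OF v])
  have "smooth_at euclidean_atlas euclidean_atlas 0 (\<lambda>t. x (c t))"
    using smooth_at_compose[OF smooth_atlas_euclidean A(1) smooth_atlas_euclidean c(3)]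
      smooth_at_chart_map[OF A] c(1) by simp
  then obtain D where D: "((\<lambda>t. x (c t)) has_derivative D) (at 0)"
    unfolding smooth_at_euclidean using smooth_on_has_derivative by blast
  have lin: "D s = s *\<^sub>R D 1" for s
    using linear_cmul[OF has_derivative_linear[OF D], of s 1] by simp
  have Db: "((\<lambda>t. x (c t) \<bullet> b) has_real_derivative D 1 \<bullet> b) (at 0)" for b
  proof -
    have "D s \<bullet> b = (D 1 \<bullet> b) * s" for s using arg_cong[OF lin[of s], of "\<lambda>w. w \<bullet> b"] by simp
    then have "(\<lambda>s. D s \<bullet> b) = (*) (D 1 \<bullet> b)" by (rule ext)
    then show ?thesis
      using has_derivative_inner_left[OF D, of b] by (simp only: has_field_derivative_def)
  qed
  have "v (\<lambda>q. x q \<bullet> b) = D 1 \<bullet> b" for b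
    using velocity_has_derivative[OF A(1) c(3), of "\<lambda>q. x q \<bullet> b"] smooth_at_coordinate[OF A] Db
      DERIV_unique c by metis
  then have comp: "components (U, x) v = D 1"
    by (simp add: components_def euclidean_representation)
  let ?g = "\<lambda>\<xi>. f (inv_into U x \<xi>)"
  obtain S where S: "open S" "0 \<in> S" "c ` S \<subseteq> U"
    using smooth_at_preimage[OF c(3) chart_open[OF A(1,2)]] A(3) c(1) by metis
  have "((\<lambda>t. ?g (x (c t))) has_derivative (\<lambda>s. frechet_derivative ?g (at (x p)) (D s))) (at 0)"
    by (rule has_derivative_compose[OF D]) (use chart_expression_has_derivative[OF A f] c(1) in simp)
  then have "((\<lambda>t. f (c t)) has_derivative (\<lambda>s. frechet_derivative ?g (at (x p)) (D s))) (at 0)"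
    by (rule has_derivative_transform_within_open[OF _ S(1,2)])
      (use S(3) chart_inv[OF A(1,2)] in auto)
  moreover have "frechet_derivative ?g (at (x p)) (D s) = frechet_derivative ?g (at (x p)) (D 1) * s" for s
    using linear_cmul[OF has_derivative_linear[OF chart_expression_has_derivative[OF A f]], of s "D 1"]
    unfolding lin[of s, symmetric] by simp
  then have "(\<lambda>s. frechet_derivative ?g (at (x p)) (D s)) = (*) (frechet_derivative ?g (at (x p)) (D 1))"
    by (rule ext)
  ultimately have "((\<lambda>t. f (c t)) has_real_derivative frechet_derivative ?g (at (x p)) (D 1)) (at 0)"
    by (simp only: has_field_derivative_def)
  then show "coord_vector A (U, x) (components (U, x) v) p f = v f"
    using velocity_has_derivative[OF A(1) c(3), of f] f c DERIV_unique
      coord_vector_apply[OF A f] comp by metis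
qed

lemma tangent_eq_componentsI:
  assumes "smooth_atlas A" "(U, x) \<in> A" "p \<in> U" "u \<in> tangent_space A p" "v \<in> tangent_space A p"
    and "\<And>b. b \<in> Basis \<Longrightarrow> u (\<lambda>q. x q \<bullet> b) = v (\<lambda>q. x q \<bullet> b)"
  shows "u = v"
proof -
  have "components (U, x) u = components (U, x) v" using assms(6) by (simp add: components_def)
  then show ?thesis using coord_vector_components[OF assms(1-3)] assms(4,5) by metis
qed

text \<open>Curves cannot be added, but straight coordinate lines can: the combination is the
  velocity of the line whose direction is the combination of the components.\<close>

lemma tangent_lincomb:
  assumes A: "smooth_atlas A" and "u \<in> tangent_space A p" "v \<in> tangent_space A p"
  shows "(\<lambda>f. a * u f + b * v f) \<in> tangent_space A p"
proof -
  obtain U x where x: "(U, x) \<in> A" "p \<in> U" using atlas_cover[OF A] by meson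
  have "(\<lambda>f. a * u f + b * v f) =
      coord_vector A (U, x) (a *\<^sub>R components (U, x) u + b *\<^sub>R components (U, x) v) p"
    by (simp add: coord_vector_linear[OF A x] coord_vector_components[OF A x] assms)
  then show ?thesis using coord_vector_tangent[OF A x] by simp
qed

lemma tangent_zero: "smooth_atlas A \<Longrightarrow> zero_tangent \<in> tangent_space A p"
  using tangent_spaceI[of A "\<lambda>t. p"] smooth_at_const[OF smooth_atlas_euclidean, of A 0 p]
  by (simp add: velocity_const)

lemma tangent_sum_in:
  assumes A: "smooth_atlas A" and "finite I" "\<And>i. i \<in> I \<Longrightarrow> u i \<in> tangent_space A p"
  shows "(\<lambda>f. \<Sum>i\<in>I. a i * u i f) \<in> tangent_space A p"
  using assms(2,3)
proof induction
  case (insert i I)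
  then show ?case using tangent_lincomb[OF A, of "u i" p "\<lambda>f. \<Sum>i\<in>I. a i * u i f" "a i" 1] by simp
qed (simp add: tangent_zero[OF A])

text \<open>Stated for a bare functional \<open>L\<close>, so that it serves for forms as well as
  for endomorphisms followed by evaluation at a function.\<close>

lemma tangent_linear_sum:
  assumes A: "smooth_atlas A"
    and L: "\<And>u v a b. u \<in> tangent_space A p \<Longrightarrow> v \<in> tangent_space A p \<Longrightarrow>
      L (\<lambda>f. a * u f + b * v f) = a * L u + b * (L v :: real)"
    and I: "finite I" "\<And>i. i \<in> I \<Longrightarrow> u i \<in> tangent_space A p"
  shows "L (\<lambda>f. \<Sum>i\<in>I. a i * u i f) = (\<Sum>i\<in>I. a i * L (u i))"
  using I
proof induction
  case empty
  show ?case using L[OF tangent_zero[OF A] tangent_zero[OF A], of 0 0] by simp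
next
  case (insert i I)
  then show ?case
    using L[of "u i" "\<lambda>f. \<Sum>i\<in>I. a i * u i f" "a i" 1] tangent_sum_in[OF A insert.hyps(1), of u p a]
    by simp
qed

lemma tangent_expand:
  assumes A: "smooth_atlas A" "(U, x) \<in> A" "p \<in> U" and v: "v \<in> tangent_space A p"
  shows "v = (\<lambda>f. \<Sum>b\<in>Basis. v (\<lambda>q. x q \<bullet> b) * coord_vector A (U, x) b p f)"
proof (rule tangent_eq_componentsI[OF A v tangent_sum_in[OF A(1)]])
  fix b :: 'b assume b: "b \<in> Basis"
  have "(\<Sum>i\<in>Basis. v (\<lambda>q. x q \<bullet> i) * (i \<bullet> b)) = v (\<lambda>q. x q \<bullet> b)"
    using b by (simp add: inner_Basis if_distrib cong: if_cong)
  then show "v (\<lambda>q. x q \<bullet> b) = (\<Sum>i\<in>Basis. v (\<lambda>q. x q \<bullet> i) * coord_vector A (U, x) i p (\<lambda>q. x q \<bullet> b))"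
    by (simp add: coord_vector_coordinate[OF A])
qed (use coord_vector_tangent[OF A] in auto)

lemma smooth_at_coord_vector_apply:
  assumes A: "smooth_atlas A" "(U, x) \<in> A" "p \<in> U" and f: "smooth_at A euclidean_atlas p f"
  shows "smooth_at A euclidean_atlas p (\<lambda>q. coord_vector A (U, x) e q f)"
proof -
  obtain S where S: "open S" "p \<in> S" "S \<subseteq> U" "smooth_on (x ` S) (\<lambda>\<xi>. f (inv_into U x \<xi>))"
    using f unfolding smooth_near_chart[OF A] by blast
  have f': "smooth_at A euclidean_atlas q f" if "q \<in> S" for q
    using smooth_near_chart[OF A(1,2), of q f] S that by blast
  have "smooth_on (x ` S) (\<lambda>\<xi>. coord_vector A (U, x) e (inv_into U x \<xi>) f)"
    by (rule smooth_on_cong[OF chart_open_image[OF A(1,2) S(1,3)] _ smooth_on_derivative[OF S(4), of e]])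
      (use S(3) chart_inv[OF A(1,2)] coord_vector_apply[OF A(1,2) _ f'] in \<open>auto simp: subset_iff\<close>)
  then show ?thesis unfolding smooth_near_chart[OF A] using S by blast
qed

text \<open>In the chart both sides are iterated directional derivatives of the same expression, so
  the symmetry of second derivatives applies.\<close>

lemma coord_vector_commute:
  assumes A: "smooth_atlas A" "(U, x) \<in> A" "p \<in> U" and f: "smooth_at A euclidean_atlas p f"
  shows "coord_vector A (U, x) a p (\<lambda>q. coord_vector A (U, x) b q f) =
         coord_vector A (U, x) b p (\<lambda>q. coord_vector A (U, x) a q f)"
proof -
  obtain S where S: "open S" "p \<in> S" "S \<subseteq> U" "smooth_on (x ` S) (\<lambda>\<xi>. f (inv_into U x \<xi>))"
    using f unfolding smooth_near_chart[OF A] by blast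
  note o = chart_open_image[OF A(1,2) S(1,3)]
  have f': "smooth_at A euclidean_atlas q f" if "q \<in> S" for q
    using smooth_near_chart[OF A(1,2), of q f] S that by blast
  have "coord_vector A (U, x) a p (\<lambda>q. coord_vector A (U, x) b q f) =
      frechet_derivative (\<lambda>\<xi>. frechet_derivative (\<lambda>\<xi>. f (inv_into U x \<xi>)) (at \<xi>) b) (at (x p)) a" for a b
  proof -
    have "(\<lambda>\<xi>. frechet_derivative (\<lambda>\<xi>. f (inv_into U x \<xi>)) (at \<xi>) b) differentiable (at (x p))"
      using smooth_on_has_derivative[OF smooth_on_derivative[OF S(4)]] S(2) by (blast intro: differentiableI)
    \<comment> \<open>The first-order formula for coordinate vectors holds on all of
      \<open>S\<close> and not just at \<open>p\<close>, so it can be differentiated once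
      more.\<close>
    then have "frechet_derivative (\<lambda>\<xi>. frechet_derivative (\<lambda>\<xi>. f (inv_into U x \<xi>)) (at \<xi>) b) (at (x p)) =
      frechet_derivative (\<lambda>\<xi>. coord_vector A (U, x) b (inv_into U x \<xi>) f) (at (x p))"
      by (rule frechet_derivative_transform_within_open[OF _ o])
        (use S(2,3) chart_inv[OF A(1,2)] coord_vector_apply[OF A(1,2) _ f'] in \<open>auto simp: subset_iff\<close>)
    then show ?thesis
      using coord_vector_apply[OF A smooth_at_coord_vector_apply[OF A f]] by simp
  qed
  then show ?thesis using frechet_derivative_commute[OF o _ S(4)] S(2) by auto
qed

section \<open>Pushforward of tangent vectors\<close>

lemma pushforward_apply:
  "smooth_at B euclidean_atlas (F p) f \<Longrightarrow> pushforward A B F p v f = v (\<lambda>q. f (F q))"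
  by (simp add: pushforward_def smooth_near_eq o_def)

lemma pushforward_velocity:
  assumes "smooth_atlas A" "smooth_atlas B" "smooth_at A B (c 0) F"
  shows "pushforward A B F (c 0) (velocity A c) = velocity B (\<lambda>t. F (c t))"
proof
  fix f
  show "pushforward A B F (c 0) (velocity A c) f = velocity B (\<lambda>t. F (c t)) f"
  proof (cases "smooth_at B euclidean_atlas (F (c 0)) f")
    case True
    then show ?thesis
      using smooth_at_compose[OF assms(1,2) smooth_atlas_euclidean assms(3) True]
      by (simp add: pushforward_apply velocity_def smooth_near_eq)
  qed (simp add: pushforward_def velocity_def smooth_near_eq)
qed

lemma pushforward_tangent:
  assumes A: "smooth_atlas A" and B: "smooth_atlas B" and F: "smooth_at A B p F"
    and v: "v \<in> tangent_space A p"
  shows "pushforward A B F p v \<in> tangent_space B (F p)"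
proof -
  obtain c where c: "c 0 = p" "v = velocity A c" "smooth_at euclidean_atlas A 0 c"
    by (rule tangent_spaceE[OF v])
  then show ?thesis
    using tangent_spaceI[OF smooth_at_compose[OF smooth_atlas_euclidean A B c(3)], of F] F
      pushforward_velocity[OF A B, of c F] by simp
qed

lemma pushforward_lincomb:
  "pushforward A B F p (\<lambda>f. a * u f + b * v f) =
    (\<lambda>f. a * pushforward A B F p u f + b * pushforward A B F p v f)"
  by (auto simp: pushforward_def)

lemma pushforward_zero: "pushforward A B F p zero_tangent = zero_tangent"
  by (auto simp: pushforward_def)

lemma pushforward_compose:
  assumes "smooth_atlas A" "smooth_atlas B" "smooth_atlas C" "smooth_at B C (F p) G"
  shows "pushforward B C G (F p) (pushforward A B F p v) = pushforward A C (\<lambda>q. G (F q)) p v"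
proof
  fix f
  show "pushforward B C G (F p) (pushforward A B F p v) f = pushforward A C (\<lambda>q. G (F q)) p v f"
    using smooth_at_compose[OF assms(2,3) smooth_atlas_euclidean assms(4), of f]
    by (simp add: pushforward_def smooth_near_eq o_def)
qed

lemma pushforward_cong:
  assumes A: "smooth_atlas A" and B: "smooth_atlas B" and v: "v \<in> tangent_space A p"
    and S: "open S" "p \<in> S" "\<And>q. q \<in> S \<Longrightarrow> F q = G q"
  shows "pushforward A B F p v = pushforward A B G p v"
proof
  fix f
  have "v (\<lambda>q. f (F q)) = v (\<lambda>q. f (G q))"
    by (rule tangent_local[OF A v S(1,2)]) (simp add: S(3))
  then show "pushforward A B F p v f = pushforward A B G p v f"
    using S by (simp add: pushforward_def o_def)
qed

lemma pushforward_id: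
  assumes "v \<in> tangent_space A p"
  shows "pushforward A A (\<lambda>q. q) p v = v"
  using tangent_not_smooth[OF assms] by (auto simp: pushforward_def smooth_near_eq o_def)

subsection \<open>Vector fields along maps\<close>

text \<open>Smooth sections near \<open>p\<close> of the pullback of the tangent bundle by
  \<open>F\<close>. Projecting a vector field of M to B gives such a section along \<pi> and in
  general no field on B, since its value depends on the point of the fibre.\<close>

definition smooth_along ::
    "('a::topological_space, 'e::euclidean_space) chart set \<Rightarrow>
     ('b::topological_space, 'f::euclidean_space) chart set \<Rightarrow> ('a \<Rightarrow> 'b) \<Rightarrow> 'a \<Rightarrow> ('a \<Rightarrow> 'b tangent) \<Rightarrow> bool" where
  "smooth_along A B F p Y \<longleftrightarrow>
     (\<exists>S. open S \<and> p \<in> S \<and> (\<forall>q\<in>S. Y q \<in> tangent_space B (F q))) \<and>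
     (\<forall>f. smooth_at B euclidean_atlas (F p) f \<longrightarrow> smooth_at A euclidean_atlas p (\<lambda>q. Y q f))"

lemma smooth_alongD:
  "smooth_along A B F p Y \<Longrightarrow> smooth_at B euclidean_atlas (F p) f \<Longrightarrow> smooth_at A euclidean_atlas p (\<lambda>q. Y q f)"
  unfolding smooth_along_def by blast

lemma smooth_vector_field_onI:
  "(\<And>p. p \<in> S \<Longrightarrow> smooth_along A A (\<lambda>q. q) p X) \<Longrightarrow> smooth_vector_field_on A S X"
  unfolding smooth_vector_field_on_def smooth_along_def smooth_near_eq by blast

lemma smooth_vector_field_along:
  assumes A: "smooth_atlas A" and B: "smooth_atlas B" and F: "smooth_at A B p F"
    and X: "smooth_vector_field_on B S X" "open S" "F p \<in> S"
  shows "smooth_along A B F p (\<lambda>q. X (F q))"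
  unfolding smooth_along_def
proof (intro conjI allI impI)
  obtain R where "open R" "p \<in> R" "F ` R \<subseteq> S" by (rule smooth_at_preimage[OF F X(2,3)])
  then show "\<exists>R. open R \<and> p \<in> R \<and> (\<forall>q\<in>R. X (F q) \<in> tangent_space B (F q))"
    using X(1) unfolding smooth_vector_field_on_def by (intro exI[of _ R]) auto
  fix f :: "_ \<Rightarrow> real" assume "smooth_at B euclidean_atlas (F p) f"
  then show "smooth_at A euclidean_atlas p (\<lambda>q. X (F q) f)"
    using X(1,3) smooth_at_compose[OF A B smooth_atlas_euclidean F]
    unfolding smooth_vector_field_on_def smooth_near_eq by blast
qed

lemma coord_vector_field: "smooth_atlas A \<Longrightarrow> (U, x) \<in> A \<Longrightarrow> smooth_vector_field_on A U (coord_vector A (U, x) e)"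
  unfolding smooth_vector_field_on_def smooth_near_eq
  using coord_vector_tangent smooth_at_coord_vector_apply by blast

lemma smooth_along_pushforward:
  assumes A: "smooth_atlas A" and B: "smooth_atlas B" and C: "smooth_atlas C"
    and F: "smooth_at A B p F" and G: "smooth_at B C (F p) G" and Y: "smooth_along A B F p Y"
  shows "smooth_along A C (\<lambda>q. G (F q)) p (\<lambda>q. pushforward B C G (F q) (Y q))"
  unfolding smooth_along_def
proof (intro conjI allI impI)
  obtain R where R: "open R" "F p \<in> R" "\<And>r. r \<in> R \<Longrightarrow> smooth_at B C r G"
    by (rule smooth_at_eventually[OF G]) blast
  obtain S where S: "open S" "p \<in> S" "F ` S \<subseteq> R" by (rule smooth_at_preimage[OF F R(1,2)])
  obtain T where T: "open T" "p \<in> T" "\<And>q. q \<in> T \<Longrightarrow> Y q \<in> tangent_space B (F q)"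
    using Y unfolding smooth_along_def by blast
  show "\<exists>S. open S \<and> p \<in> S \<and> (\<forall>q\<in>S. pushforward B C G (F q) (Y q) \<in> tangent_space C (G (F q)))"
    using S T R pushforward_tangent[OF B C] by (intro exI[of _ "S \<inter> T"]) auto
  fix f :: "_ \<Rightarrow> real" assume f: "smooth_at C euclidean_atlas (G (F p)) f"
  have GF: "smooth_at A C p (\<lambda>q. G (F q))" by (rule smooth_at_compose[OF A B C F G])
  \<comment> \<open>\<open>pushforward\<close> is 0 by default on functions that are not smooth at
    the image point, so it equals \<open>Y q (\<lambda>r. f (G r))\<close> only where
    \<open>f\<close> is smooth at the image of \<open>q\<close>. The neighbourhood \<open>Q\<close>
    obtained from \<open>W\<close> consists of such points.\<close>
  obtain W where W: "open W" "G (F p) \<in> W" "\<And>r. r \<in> W \<Longrightarrow> smooth_at C euclidean_atlas r f"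
    by (rule smooth_at_eventually[OF f]) blast
  obtain Q where Q: "open Q" "p \<in> Q" "(\<lambda>q. G (F q)) ` Q \<subseteq> W" by (rule smooth_at_preimage[OF GF W(1,2)])
  have "smooth_at A euclidean_atlas p (\<lambda>q. Y q (\<lambda>r. f (G r)))"
    by (rule smooth_alongD[OF Y smooth_at_compose[OF B C smooth_atlas_euclidean G f]])
  then show "smooth_at A euclidean_atlas p (\<lambda>q. pushforward B C G (F q) (Y q) f)"
  proof (rule smooth_at_cong[OF A smooth_atlas_euclidean _ Q(1,2)])
    fix q assume "q \<in> Q"
    then have "smooth_at C euclidean_atlas (G (F q)) f" using Q(3) W(3) by blast
    then show "Y q (\<lambda>r. f (G r)) = pushforward B C G (F q) (Y q) f" by (simp add: pushforward_apply)
  qed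
qed

lemma smooth_along_lincomb:
  assumes A: "smooth_atlas A" and B: "smooth_atlas B"
    and Y: "smooth_along A B F p Y" "smooth_along A B F p Z"
    and ab: "smooth_at A euclidean_atlas p a" "smooth_at A euclidean_atlas p b"
  shows "smooth_along A B F p (\<lambda>q f. a q * Y q f + b q * Z q f)"
  unfolding smooth_along_def
proof (intro conjI allI impI)
  obtain S T where "open S" "p \<in> S" "\<And>q. q \<in> S \<Longrightarrow> Y q \<in> tangent_space B (F q)"
    "open T" "p \<in> T" "\<And>q. q \<in> T \<Longrightarrow> Z q \<in> tangent_space B (F q)"
    using Y unfolding smooth_along_def by blast
  then show "\<exists>S. open S \<and> p \<in> S \<and> (\<forall>q\<in>S. (\<lambda>f. a q * Y q f + b q * Z q f) \<in> tangent_space B (F q))"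
    using tangent_lincomb[OF B] by (intro exI[of _ "S \<inter> T"]) auto
qed (intro smooth_at_add smooth_at_mult A ab smooth_alongD[OF Y(1)] smooth_alongD[OF Y(2)])

lemma smooth_along_sum:
  assumes A: "smooth_atlas A" and B: "smooth_atlas B" and F: "smooth_at A B p F"
    and I: "finite I" "\<And>i. i \<in> I \<Longrightarrow> smooth_along A B F p (Y i)"
      "\<And>i. i \<in> I \<Longrightarrow> smooth_at A euclidean_atlas p (a i)"
  shows "smooth_along A B F p (\<lambda>q f. \<Sum>i\<in>I. a i q * Y i q f)"
  using I
proof induction
  case empty
  then show ?case
    using tangent_zero[OF B] smooth_at_const[OF A smooth_atlas_euclidean]
    by (auto simp: smooth_along_def)
next
  case (insert i I)
  then show ?case
    using smooth_along_lincomb[OF A B, of F p "Y i" "\<lambda>q f. \<Sum>i\<in>I. a i q * Y i q f" "a i" "\<lambda>q. 1"]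
      smooth_at_const[OF A smooth_atlas_euclidean, of p "1::real"] by simp
qed

lemma smooth_along_cong:
  assumes A: "smooth_atlas A" and Y: "smooth_along A B F p Y"
    and S: "open S" "p \<in> S" "\<And>q. q \<in> S \<Longrightarrow> Y q = Z q"
  shows "smooth_along A B F p Z"
  unfolding smooth_along_def
proof (intro conjI allI impI)
  obtain T where "open T" "p \<in> T" "\<And>q. q \<in> T \<Longrightarrow> Y q \<in> tangent_space B (F q)"
    using Y unfolding smooth_along_def by blast
  then show "\<exists>S. open S \<and> p \<in> S \<and> (\<forall>q\<in>S. Z q \<in> tangent_space B (F q))"
    using S(1,2) by (intro exI[of _ "S \<inter> T"]) (auto simp: S(3)[symmetric])
  fix f :: "_ \<Rightarrow> real" assume "smooth_at B euclidean_atlas (F p) f"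
  from smooth_alongD[OF Y this] show "smooth_at A euclidean_atlas p (\<lambda>q. Z q f)"
    by (rule smooth_at_cong[OF A smooth_atlas_euclidean _ S(1,2)]) (simp add: S(3))
qed

lemma smooth_along_expand:
  assumes A: "smooth_atlas A" and B: "smooth_atlas B" "(V, y) \<in> B" "F p \<in> V"
    and F: "smooth_at A B p F" and Y: "smooth_along A B F p Y"
  obtains S where "open S" "p \<in> S" "F ` S \<subseteq> V"
    "\<And>q. q \<in> S \<Longrightarrow> Y q \<in> tangent_space B (F q)"
    "\<And>q. q \<in> S \<Longrightarrow> Y q = (\<lambda>f. \<Sum>b\<in>Basis. Y q (\<lambda>r. y r \<bullet> b) * coord_vector B (V, y) b (F q) f)"
proof -
  obtain R where R: "open R" "p \<in> R" "F ` R \<subseteq> V"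
    by (rule smooth_at_preimage[OF F chart_open[OF B(1,2)] B(3)])
  obtain T where T: "open T" "p \<in> T" "\<And>q. q \<in> T \<Longrightarrow> Y q \<in> tangent_space B (F q)"
    using Y unfolding smooth_along_def by blast
  show ?thesis
    by (rule that[of "R \<inter> T"]) (use R T tangent_expand[OF B(1,2)] in auto)
qed

subsection \<open>One-forms and endomorphisms\<close>

lemma one_form_linear:
  assumes "is_form A 1 \<beta>" "u \<in> tangent_space A p" "v \<in> tangent_space A p"
  shows "\<beta> p [\<lambda>f. a * u f + b * v f] = a * \<beta> p [u] + b * \<beta> p [v]"
proof -
  have "[u] \<in> tangent_lists A 1 p" using assms by (simp add: tangent_lists_def)
  moreover have "\<forall>vs\<in>tangent_lists A 1 p. \<forall>i<1. \<forall>u\<in>tangent_space A p. \<forall>v\<in>tangent_space A p. \<forall>a b.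
      \<beta> p (vs[i := (\<lambda>f. a * u f + b * v f)]) = a * \<beta> p (vs[i := u]) + b * \<beta> p (vs[i := v])"
    using assms(1) unfolding is_form_def by (elim conjE) (erule spec)
  ultimately have "\<beta> p ([u][0 := (\<lambda>f. a * u f + b * v f)]) = a * \<beta> p ([u][0 := u]) + b * \<beta> p ([u][0 := v])"
    using assms(2,3) by blast
  then show ?thesis by simp
qed

lemma one_form_zero:
  assumes "smooth_atlas A" "is_form A 1 \<beta>"
  shows "\<beta> p [zero_tangent] = 0"
  using one_form_linear[OF assms(2) tangent_zero[OF assms(1)] tangent_zero[OF assms(1)], of p 0 0] by simp

text \<open>For a single argument there are no two positions to compare, so the alternation clause
  is vacuous.\<close>

lemma is_form_1I:
  assumes "\<And>p u v a b. u \<in> tangent_space A p \<Longrightarrow> v \<in> tangent_space A p \<Longrightarrow>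
      \<beta> p [\<lambda>f. a * u f + b * v f] = a * \<beta> p [u] + b * \<beta> p [v]"
    and "\<And>c p e. c \<in> A \<Longrightarrow> p \<in> fst c \<Longrightarrow> smooth_at A euclidean_atlas p (\<lambda>q. \<beta> q [coord_vector A c e q])"
  shows "is_form A 1 \<beta>"
  unfolding is_form_def smooth_near_eq tangent_lists_def
  using assms by (auto simp: length_Suc_conv)

lemma one_form_coord_smooth:
  assumes "is_form A 1 \<beta>" "(U, x) \<in> A" "p \<in> U"
  shows "smooth_at A euclidean_atlas p (\<lambda>q. \<beta> q [coord_vector A (U, x) e q])"
proof -
  have "smooth_near A p (\<lambda>q. \<beta> q (map (\<lambda>e. coord_vector A (U, x) e q) [e]))"
    using assms(1)[unfolded is_form_def, THEN conjunct2, THEN conjunct2, rule_format, of "(U, x)" p "[e]"]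
      assms(2,3) by simp
  then show ?thesis by (simp add: smooth_near_eq)
qed

lemma one_form_expand:
  assumes A: "smooth_atlas A" "(U, x) \<in> A" "p \<in> U" and \<beta>: "is_form A 1 \<beta>" and v: "v \<in> tangent_space A p"
  shows "\<beta> p [v] = (\<Sum>b\<in>Basis. v (\<lambda>q. x q \<bullet> b) * \<beta> p [coord_vector A (U, x) b p])"
proof -
  have "\<beta> p [v] = \<beta> p [\<lambda>f. \<Sum>b\<in>Basis. v (\<lambda>q. x q \<bullet> b) * coord_vector A (U, x) b p f]"
    by (rule arg_cong[OF tangent_expand[OF A v], of "\<lambda>v. \<beta> p [v]"])
  also have "\<dots> = (\<Sum>b\<in>Basis. v (\<lambda>q. x q \<bullet> b) * \<beta> p [coord_vector A (U, x) b p])"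
    by (rule tangent_linear_sum[OF A(1), where p = p and L = "\<lambda>v. \<beta> p [v]"])
      (simp_all add: one_form_linear[OF \<beta>] coord_vector_tangent[OF A])
  finally show ?thesis .
qed

text \<open>\<open>is_form\<close> gives smoothness only on coordinate fields. Expanding
  \<open>Y\<close> in the coordinate fields at the image point leaves products of smooth
  coefficients with coefficient functions of the form composed with \<open>F\<close>.\<close>

lemma one_form_along_smooth:
  assumes A: "smooth_atlas A" and B: "smooth_atlas B" and F: "smooth_at A B p F"
    and \<beta>: "is_form B 1 \<beta>" and Y: "smooth_along A B F p Y"
  shows "smooth_at A euclidean_atlas p (\<lambda>q. \<beta> (F q) [Y q])"
proof -
  obtain V y where y: "(V, y) \<in> B" "F p \<in> V" using atlas_cover[OF B] by meson
  obtain S where S: "open S" "p \<in> S" "F ` S \<subseteq> V" "\<And>q. q \<in> S \<Longrightarrow> Y q \<in> tangent_space B (F q)"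
    by (rule smooth_along_expand[OF A B y F Y]) blast
  have "smooth_at A euclidean_atlas p
      (\<lambda>q. \<Sum>b\<in>Basis. Y q (\<lambda>r. y r \<bullet> b) * \<beta> (F q) [coord_vector B (V, y) b (F q)])"
    by (intro smooth_at_sum smooth_at_mult A finite_Basis smooth_alongD[OF Y] smooth_at_coordinate[OF B y]
        smooth_at_compose[OF A B smooth_atlas_euclidean F one_form_coord_smooth[OF \<beta> y]])
  then show ?thesis
    by (rule smooth_at_cong[OF A smooth_atlas_euclidean _ S(1,2)])
      (use S(3,4) one_form_expand[OF B y(1) _ \<beta>] in fastforce)
qed

lemma
  assumes "smooth_endomorphism A \<psi>"
  shows endomorphism_tangent: "v \<in> tangent_space A p \<Longrightarrow> \<psi> p v \<in> tangent_space A p"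
    and endomorphism_linear: "u \<in> tangent_space A p \<Longrightarrow> v \<in> tangent_space A p \<Longrightarrow>
        \<psi> p (\<lambda>f. a * u f + b * v f) = (\<lambda>f. a * \<psi> p u f + b * \<psi> p v f)"
    and endomorphism_coord_smooth: "(U, x) \<in> A \<Longrightarrow> smooth_vector_field_on A U (\<lambda>q. \<psi> q (coord_vector A (U, x) e q))"
proof -
  show "v \<in> tangent_space A p \<Longrightarrow> \<psi> p v \<in> tangent_space A p"
    "u \<in> tangent_space A p \<Longrightarrow> v \<in> tangent_space A p \<Longrightarrow>
        \<psi> p (\<lambda>f. a * u f + b * v f) = (\<lambda>f. a * \<psi> p u f + b * \<psi> p v f)"
    using assms unfolding smooth_endomorphism_def by blast+
  have "\<forall>c\<in>A. \<forall>e. smooth_vector_field_on A (fst c) (\<lambda>q. \<psi> q (coord_vector A c e q))"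
    using assms unfolding smooth_endomorphism_def by blast
  then show "(U, x) \<in> A \<Longrightarrow> smooth_vector_field_on A U (\<lambda>q. \<psi> q (coord_vector A (U, x) e q))"
    by fastforce
qed

lemma endomorphism_expand:
  assumes A: "smooth_atlas A" "(U, x) \<in> A" "p \<in> U" and \<psi>: "smooth_endomorphism A \<psi>"
    and v: "v \<in> tangent_space A p"
  shows "\<psi> p v = (\<lambda>f. \<Sum>b\<in>Basis. v (\<lambda>q. x q \<bullet> b) * \<psi> p (coord_vector A (U, x) b p) f)"
proof
  fix f
  have "\<psi> p v f = \<psi> p (\<lambda>f. \<Sum>b\<in>Basis. v (\<lambda>q. x q \<bullet> b) * coord_vector A (U, x) b p f) f"
    by (rule arg_cong[OF tangent_expand[OF A v], of "\<lambda>v. \<psi> p v f"])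
  also have "\<dots> = (\<Sum>b\<in>Basis. v (\<lambda>q. x q \<bullet> b) * \<psi> p (coord_vector A (U, x) b p) f)"
    by (rule tangent_linear_sum[OF A(1), where p = p and L = "\<lambda>v. \<psi> p v f"])
      (simp_all add: endomorphism_linear[OF \<psi>] coord_vector_tangent[OF A])
  finally show "\<psi> p v f = (\<Sum>b\<in>Basis. v (\<lambda>q. x q \<bullet> b) * \<psi> p (coord_vector A (U, x) b p) f)" .
qed

lemma endomorphism_along_smooth:
  assumes A: "smooth_atlas A" and B: "smooth_atlas B" and F: "smooth_at A B p F"
    and \<psi>: "smooth_endomorphism B \<psi>" and Y: "smooth_along A B F p Y"
  shows "smooth_along A B F p (\<lambda>q. \<psi> (F q) (Y q))"
proof -
  obtain V y where y: "(V, y) \<in> B" "F p \<in> V" using atlas_cover[OF B] by meson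
  obtain S where S: "open S" "p \<in> S" "F ` S \<subseteq> V" "\<And>q. q \<in> S \<Longrightarrow> Y q \<in> tangent_space B (F q)"
    by (rule smooth_along_expand[OF A B y F Y]) blast
  have "smooth_along A B F p
      (\<lambda>q f. \<Sum>b\<in>Basis. Y q (\<lambda>r. y r \<bullet> b) * \<psi> (F q) (coord_vector B (V, y) b (F q)) f)"
    by (intro smooth_along_sum A B F finite_Basis smooth_alongD[OF Y] smooth_at_coordinate[OF B y]
        smooth_vector_field_along[OF A B F endomorphism_coord_smooth[OF \<psi> y(1)] chart_open[OF B y(1)] y(2)])
  then show ?thesis
    by (rule smooth_along_cong[OF A _ S(1,2)])
      (use S(3,4) endomorphism_expand[OF B y(1) _ \<psi>] in fastforce)
qed

subsection \<open>Exterior products\<close>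

text \<open>
  A nested product of three factors, alternating or not, is a multiple of the sum below, whose
  factors can be rotated at the cost of a sign.
\<close>

definition wedge3 :: "nat \<Rightarrow> nat \<Rightarrow> nat \<Rightarrow> 'a form \<Rightarrow> 'a form \<Rightarrow> 'a form \<Rightarrow> 'a form" where
  "wedge3 a b c \<omega>\<^sub>1 \<omega>\<^sub>2 \<omega>\<^sub>3 = (\<lambda>p vs.
     \<Sum>\<sigma> | \<sigma> permutes {..<a + (b + c)}. of_int (sign \<sigma>) *
       \<omega>\<^sub>1 p (map (\<lambda>i. vs ! \<sigma> i) [0..<a]) *
       \<omega>\<^sub>2 p (map (\<lambda>i. vs ! \<sigma> i) [a..<a + b]) *
       \<omega>\<^sub>3 p (map (\<lambda>i. vs ! \<sigma> i) [a + b..<a + (b + c)]))"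

lemma map_upt_shift: "map f [a + m..<a + n] = map (\<lambda>i. f (a + i)) [m..<n]"
  by (rule nth_equalityI) (auto simp: add.assoc)

lemma permutes_lessThan: "\<sigma> permutes {..<n::nat} \<Longrightarrow> i < n \<Longrightarrow> \<sigma> i < n"
  using permutes_in_image[of \<sigma> "{..<n}" i] by simp

lemma permutation_lessThan: "\<sigma> permutes {..<n::nat} \<Longrightarrow> permutation \<sigma>"
  using permutation_permutes by blast

text \<open>Every permutation \<tau> in the inner product extends to a permutation of all positions
  that fixes the first \<open>a\<close> of them. It is absorbed by reindexing the outer sum, so each
  of the (b + c)! inner permutations contributes the same sum, and this count cancels one
  normalizing factorial.\<close>

lemma wedge_wedge:
  "wedge a (b + c) \<omega>\<^sub>1 (wedge b c \<omega>\<^sub>2 \<omega>\<^sub>3) p vs =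
     wedge3 a b c \<omega>\<^sub>1 \<omega>\<^sub>2 \<omega>\<^sub>3 p vs / (fact a * fact b * fact c)"
proof -
  define N where "N = a + (b + c)"
  define G where "G \<sigma> = of_int (sign \<sigma>) * \<omega>\<^sub>1 p (map (\<lambda>i. vs ! \<sigma> i) [0..<a]) *
       \<omega>\<^sub>2 p (map (\<lambda>i. vs ! \<sigma> i) [a..<a + b]) *
       \<omega>\<^sub>3 p (map (\<lambda>i. vs ! \<sigma> i) [a + b..<a + (b + c)])" for \<sigma>
  \<comment> \<open>\<open>s \<tau>\<close> acts as \<tau> on the block of positions from
    \<open>a\<close> on and as the identity before it.\<close>
  define s where "s \<tau> = map_permutation {..<b + c} ((+) a) \<tau>" for \<tau>
  have s: "s \<tau> permutes {..<N}" "sign (s \<tau>) = sign \<tau>" "\<And>i. i < a \<Longrightarrow> s \<tau> i = i"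
      "\<And>i. i < b + c \<Longrightarrow> s \<tau> (a + i) = a + \<tau> i"
    if \<tau>: "\<tau> permutes {..<b + c}" for \<tau>
  proof -
    have bij: "bij_betw ((+) a) {..<b + c} {a..<N}"
      by (rule bij_betw_byWitness[where f' = "\<lambda>i. i - a"]) (auto simp: N_def)
    have sN: "s \<tau> permutes {a..<N}"
      unfolding s_def by (rule map_permutation_permutes[OF bij \<tau>])
    then show "s \<tau> permutes {..<N}" by (rule permutes_subset) auto
    show "sign (s \<tau>) = sign \<tau>"
      unfolding s_def by (rule sign_map_permutation) (use \<tau> in auto)
    show "s \<tau> i = i" if "i < a" for i using sN that unfolding permutes_def by auto
    show "s \<tau> (a + i) = a + \<tau> i" if "i < b + c" for i
      unfolding s_def using map_permutation_apply[of "(+) a" "{..<b + c}" i \<tau>] that by simp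
  qed
  have summand: "of_int (sign \<sigma>) * \<omega>\<^sub>1 p (map (\<lambda>i. vs ! \<sigma> i) [0..<a]) *
        wedge b c \<omega>\<^sub>2 \<omega>\<^sub>3 p (map (\<lambda>i. vs ! \<sigma> i) [a..<a + (b + c)])
      = (\<Sum>\<tau> | \<tau> permutes {..<b + c}. G (\<sigma> \<circ> s \<tau>)) / (fact b * fact c)"
    if \<sigma>: "\<sigma> permutes {..<N}" for \<sigma>
  proof -
    have "of_int (sign \<sigma>) * \<omega>\<^sub>1 p (map (\<lambda>i. vs ! \<sigma> i) [0..<a]) *
        (of_int (sign \<tau>) *
          \<omega>\<^sub>2 p (map (\<lambda>i. map (\<lambda>i. vs ! \<sigma> i) [a..<a + (b + c)] ! \<tau> i) [0..<b]) *
          \<omega>\<^sub>3 p (map (\<lambda>i. map (\<lambda>i. vs ! \<sigma> i) [a..<a + (b + c)] ! \<tau> i) [b..<b + c])) = G (\<sigma> \<circ> s \<tau>)"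
      if \<tau>: "\<tau> permutes {..<b + c}" for \<tau>
    proof -
      have 1: "map (\<lambda>i. vs ! (\<sigma> \<circ> s \<tau>) i) [0..<a] = map (\<lambda>i. vs ! \<sigma> i) [0..<a]"
        using s(3)[OF \<tau>] by simp
      have nth: "map (\<lambda>i. vs ! \<sigma> i) [a..<a + (b + c)] ! \<tau> i = vs ! (\<sigma> \<circ> s \<tau>) (a + i)" if "i < b + c" for i
        using permutes_lessThan[OF \<tau> that] s(4)[OF \<tau> that] by simp
      have 2: "map (\<lambda>i. vs ! (\<sigma> \<circ> s \<tau>) i) [a..<a + b] =
          map (\<lambda>i. map (\<lambda>i. vs ! \<sigma> i) [a..<a + (b + c)] ! \<tau> i) [0..<b]"
        using map_upt_shift[of "\<lambda>i. vs ! (\<sigma> \<circ> s \<tau>) i" a 0 b] nth by simp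
      have 3: "map (\<lambda>i. vs ! (\<sigma> \<circ> s \<tau>) i) [a + b..<a + (b + c)] =
          map (\<lambda>i. map (\<lambda>i. vs ! \<sigma> i) [a..<a + (b + c)] ! \<tau> i) [b..<b + c]"
        using map_upt_shift[of "\<lambda>i. vs ! (\<sigma> \<circ> s \<tau>) i" a b "b + c"] nth by simp
      have 4: "sign (\<sigma> \<circ> s \<tau>) = sign \<sigma> * sign \<tau>"
        using sign_compose[OF permutation_lessThan[OF \<sigma>] permutation_lessThan[OF s(1)[OF \<tau>]]] s(2)[OF \<tau>] by simp
      show ?thesis unfolding G_def 1 2 3 4 by simp
    qed
    then show ?thesis
      unfolding wedge_def times_divide_eq_right sum_distrib_left
      by (intro arg_cong2[where f = "(/)"] sum.cong refl) blast
  qed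
  have "(\<Sum>\<sigma> | \<sigma> permutes {..<N}. \<Sum>\<tau> | \<tau> permutes {..<b + c}. G (\<sigma> \<circ> s \<tau>)) =
      (\<Sum>\<tau> | \<tau> permutes {..<b + c}. \<Sum>\<sigma> | \<sigma> permutes {..<N}. G (\<sigma> \<circ> s \<tau>))"
    by (rule sum.swap)
  also have "\<dots> = (\<Sum>\<tau> | \<tau> permutes {..<b + c}. \<Sum>\<sigma> | \<sigma> permutes {..<N}. G \<sigma>)"
    by (intro sum.cong refl sum_permutations_compose_right[symmetric]) (use s in auto)
  also have "\<dots> = fact (b + c) * (\<Sum>\<sigma> | \<sigma> permutes {..<N}. G \<sigma>)"
    by (simp add: card_permutations[of "{..<b + c}" "b + c"])
  finally have sum: "(\<Sum>\<sigma> | \<sigma> permutes {..<N}. \<Sum>\<tau> | \<tau> permutes {..<b + c}. G (\<sigma> \<circ> s \<tau>)) =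
      fact (b + c) * wedge3 a b c \<omega>\<^sub>1 \<omega>\<^sub>2 \<omega>\<^sub>3 p vs"
    unfolding wedge3_def G_def N_def .
  have "wedge a (b + c) \<omega>\<^sub>1 (wedge b c \<omega>\<^sub>2 \<omega>\<^sub>3) p vs =
      (\<Sum>\<sigma> | \<sigma> permutes {..<N}. (\<Sum>\<tau> | \<tau> permutes {..<b + c}. G (\<sigma> \<circ> s \<tau>)) / (fact b * fact c)) / (fact a * fact (b + c))"
    unfolding wedge_def[of a] N_def[symmetric]
    by (intro arg_cong2[where f = "(/)"] sum.cong refl) (use summand in \<open>simp add: N_def\<close>)
  also have "\<dots> = (\<Sum>\<sigma> | \<sigma> permutes {..<N}. \<Sum>\<tau> | \<tau> permutes {..<b + c}. G (\<sigma> \<circ> s \<tau>)) / (fact b * fact c) / (fact a * fact (b + c))"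
    by (simp only: sum_divide_distrib)
  finally show ?thesis unfolding sum by (simp add: field_simps)
qed

text \<open>The cyclic rotation of the three blocks is itself a permutation \<rho>; reindexing by
  \<sigma> \<circ> \<rho> changes every summand by its sign. The sign is left undetermined because
  only nonvanishing matters later.\<close>

lemma wedge3_rotate:
  "\<exists>s \<in> {1, -1}. wedge3 b c a \<omega>\<^sub>2 \<omega>\<^sub>3 \<omega>\<^sub>1 p vs = s * wedge3 a b c \<omega>\<^sub>1 \<omega>\<^sub>2 \<omega>\<^sub>3 p vs"
proof -
  define N where "N = a + (b + c)"
  \<comment> \<open>The first \<open>b + c\<close> positions are sent behind the block of length
    \<open>a\<close>, and the last \<open>a\<close> positions to the front.\<close>
  define \<rho> where "\<rho> i = (if i < b + c then a + i else if i < N then i - (b + c) else i)" for i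
  have "bij_betw \<rho> {..<N} {..<N}"
    by (rule bij_betw_byWitness[where f' = "\<lambda>i. if i < a then b + c + i else i - a"])
      (auto simp: \<rho>_def N_def)
  then have \<rho>: "\<rho> permutes {..<N}"
    by (rule bij_imp_permutes) (auto simp: \<rho>_def N_def)
  have "of_int (sign (\<sigma> \<circ> \<rho>)) *
       \<omega>\<^sub>2 p (map (\<lambda>i. vs ! (\<sigma> \<circ> \<rho>) i) [0..<b]) *
       \<omega>\<^sub>3 p (map (\<lambda>i. vs ! (\<sigma> \<circ> \<rho>) i) [b..<b + c]) *
       \<omega>\<^sub>1 p (map (\<lambda>i. vs ! (\<sigma> \<circ> \<rho>) i) [b + c..<b + (c + a)]) =
     of_int (sign \<rho>) * (of_int (sign \<sigma>) *
       \<omega>\<^sub>1 p (map (\<lambda>i. vs ! \<sigma> i) [0..<a]) *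
       \<omega>\<^sub>2 p (map (\<lambda>i. vs ! \<sigma> i) [a..<a + b]) *
       \<omega>\<^sub>3 p (map (\<lambda>i. vs ! \<sigma> i) [a + b..<a + (b + c)]))"
    if \<sigma>: "\<sigma> permutes {..<N}" for \<sigma>
  proof -
    have 1: "map (\<lambda>i. vs ! (\<sigma> \<circ> \<rho>) i) [0..<b] = map (\<lambda>i. vs ! \<sigma> i) [a..<a + b]"
      using map_upt_shift[of "\<lambda>i. vs ! \<sigma> i" a 0 b] by (simp add: \<rho>_def)
    have 2: "map (\<lambda>i. vs ! (\<sigma> \<circ> \<rho>) i) [b..<b + c] = map (\<lambda>i. vs ! \<sigma> i) [a + b..<a + (b + c)]"
      using map_upt_shift[of "\<lambda>i. vs ! \<sigma> i" a b "b + c"] by (simp add: \<rho>_def)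
    have 3: "map (\<lambda>i. vs ! (\<sigma> \<circ> \<rho>) i) [b + c..<b + (c + a)] = map (\<lambda>i. vs ! \<sigma> i) [0..<a]"
      using map_upt_shift[of "\<lambda>i. vs ! (\<sigma> \<circ> \<rho>) i" "b + c" 0 a] by (simp add: \<rho>_def N_def add_ac)
    have 4: "sign (\<sigma> \<circ> \<rho>) = sign \<sigma> * sign \<rho>"
      by (rule sign_compose[OF permutation_lessThan[OF \<sigma>] permutation_lessThan[OF \<rho>]])
    show ?thesis unfolding 1 2 3 4 by simp
  qed
  then have "wedge3 b c a \<omega>\<^sub>2 \<omega>\<^sub>3 \<omega>\<^sub>1 p vs = of_int (sign \<rho>) * wedge3 a b c \<omega>\<^sub>1 \<omega>\<^sub>2 \<omega>\<^sub>3 p vs"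
    unfolding wedge3_def sum_distrib_left
    by (subst sum_permutations_compose_right[of \<rho>]) (use \<rho> in \<open>auto simp: N_def add_ac intro!: sum.cong\<close>)
  then show ?thesis by (cases rule: sign_cases[of \<rho>]) auto
qed

text \<open>Both nestings are positive multiples of \<open>wedge3\<close> sums that differ by a
  rotation, hence by a sign.\<close>

lemma wedge_rotate_nonzero:
  assumes "wedge b (c + a) \<omega>\<^sub>2 (wedge c a \<omega>\<^sub>3 \<omega>\<^sub>1) p vs \<noteq> 0"
  shows "wedge a (b + c) \<omega>\<^sub>1 (wedge b c \<omega>\<^sub>2 \<omega>\<^sub>3) p vs \<noteq> 0"
  using assms wedge3_rotate[of b c a \<omega>\<^sub>2 \<omega>\<^sub>3 \<omega>\<^sub>1 p vs] unfolding wedge_wedge by auto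

text \<open>Reindexing by \<tau> \<circ> \<sigma> pulls out the sign. Antisymmetry thus comes from
  the sum over permutations itself, and is at hand for the volume form without any analysis of its
  factors.\<close>

lemma wedge_permute:
  assumes \<tau>: "\<tau> permutes {..<k + l}"
  shows "wedge k l \<omega> \<theta> p (map (\<lambda>i. vs ! \<tau> i) [0..<k + l]) = of_int (sign \<tau>) * wedge k l \<omega> \<theta> p vs"
proof -
  define G where "G vs \<sigma> = of_int (sign \<sigma>) * \<omega> p (map (\<lambda>i. vs ! \<sigma> i) [0..<k]) *
    \<theta> p (map (\<lambda>i. vs ! \<sigma> i) [k..<k + l])" for vs \<sigma>
  have "G (map (\<lambda>i. vs ! \<tau> i) [0..<k + l]) \<sigma> = of_int (sign \<tau>) * G vs (\<tau> \<circ> \<sigma>)"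
    if \<sigma>: "\<sigma> permutes {..<k + l}" for \<sigma>
  proof -
    have 1: "map (\<lambda>i. map (\<lambda>i. vs ! \<tau> i) [0..<k + l] ! \<sigma> i) [0..<k] = map (\<lambda>i. vs ! (\<tau> \<circ> \<sigma>) i) [0..<k]"
      "map (\<lambda>i. map (\<lambda>i. vs ! \<tau> i) [0..<k + l] ! \<sigma> i) [k..<k + l] = map (\<lambda>i. vs ! (\<tau> \<circ> \<sigma>) i) [k..<k + l]"
      using permutes_lessThan[OF \<sigma>] by simp_all
    have "sign (\<tau> \<circ> \<sigma>) = sign \<tau> * sign \<sigma>"
      by (rule sign_compose[OF permutation_lessThan[OF \<tau>] permutation_lessThan[OF \<sigma>]])
    then have 2: "sign \<sigma> = sign \<tau> * sign (\<tau> \<circ> \<sigma>)"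
      by (simp flip: mult.assoc)
    show ?thesis unfolding G_def 1 by (subst 2) simp
  qed
  then have "(\<Sum>\<sigma> | \<sigma> permutes {..<k + l}. G (map (\<lambda>i. vs ! \<tau> i) [0..<k + l]) \<sigma>) =
      of_int (sign \<tau>) * (\<Sum>\<sigma> | \<sigma> permutes {..<k + l}. G vs (\<tau> \<circ> \<sigma>))"
    by (simp add: sum_distrib_left)
  also have "(\<Sum>\<sigma> | \<sigma> permutes {..<k + l}. G vs (\<tau> \<circ> \<sigma>)) = (\<Sum>\<sigma> | \<sigma> permutes {..<k + l}. G vs \<sigma>)"
    by (rule setum_permutations_compose_left[OF \<tau>, symmetric])
  finally show ?thesis unfolding wedge_def G_def by simp
qed

text \<open>Only the permutations fixing \<open>0\<close> contribute, and each of them contributes the same.\<close>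

lemma wedge_one_form_Cons:
  assumes ws: "length ws = n" "\<And>w. w \<in> set ws \<Longrightarrow> \<alpha> p [w] = 0"
    and \<Omega>: "\<And>\<tau>. \<tau> permutes {..<n} \<Longrightarrow> \<Omega> p (map (\<lambda>i. ws ! \<tau> i) [0..<n]) = of_int (sign \<tau>) * \<Omega> p ws"
  shows "wedge 1 n \<alpha> \<Omega> p (u # ws) = \<alpha> p [u] * \<Omega> p ws"
proof -
  define G where "G \<sigma> = of_int (sign \<sigma>) * \<alpha> p (map (\<lambda>i. (u # ws) ! \<sigma> i) [0..<1]) *
    \<Omega> p (map (\<lambda>i. (u # ws) ! \<sigma> i) [1..<1 + n])" for \<sigma>
  have "(\<Sum>\<sigma> | \<sigma> permutes {..<1 + n}. G \<sigma>) = (\<Sum>\<sigma> | \<sigma> permutes {1..<1 + n}. G \<sigma>)"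
  proof (rule sum.mono_neutral_right)
    show "{\<sigma>. \<sigma> permutes {1..<1 + n}} \<subseteq> {\<sigma>. \<sigma> permutes {..<1 + n}}"
      by (auto intro: permutes_subset)
    show "\<forall>\<sigma>\<in>{\<sigma>. \<sigma> permutes {..<1 + n}} - {\<sigma>. \<sigma> permutes {1..<1 + n}}. G \<sigma> = 0"
    proof
      fix \<sigma> assume "\<sigma> \<in> {\<sigma>. \<sigma> permutes {..<1 + n}} - {\<sigma>. \<sigma> permutes {1..<1 + n}}"
      then have \<sigma>: "\<sigma> permutes {..<1 + n}" "\<not> \<sigma> permutes {1..<1 + n}" by auto
      have "\<sigma> 0 \<noteq> 0"
      proof
        assume "\<sigma> 0 = 0"
        then have "\<sigma> permutes {1..<1 + n}"
          by (intro permutes_superset[OF \<sigma>(1)]) (auto simp: Suc_le_eq)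
        then show False using \<sigma> by blast
      qed
      then obtain j where j: "\<sigma> 0 = Suc j" "j < n"
        using permutes_lessThan[OF \<sigma>(1), of 0] by (cases "\<sigma> 0") auto
      then show "G \<sigma> = 0" using ws by (simp add: G_def)
    qed
  qed (simp add: finite_permutations)
  also have "\<dots> = (\<Sum>\<sigma> | \<sigma> permutes {1..<1 + n}. \<alpha> p [u] * \<Omega> p ws)"
  proof (intro sum.cong refl, clarify)
    fix \<sigma> assume \<sigma>: "\<sigma> permutes {1..<1 + n}"
    \<comment> \<open>Positions 1 to \<open>n\<close> of the full list are positions 0 to
      \<open>n - 1\<close> of \<open>ws\<close>; \<tau> is \<sigma> after this shift and has the
      same sign, so the two signs cancel.\<close>
    define \<tau> where "\<tau> = map_permutation {1..<1 + n} (\<lambda>i. i - 1) \<sigma>"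
    have inj: "inj_on (\<lambda>i. i - 1) {1..<1 + n}" by (auto simp: inj_on_def)
    have "bij_betw (\<lambda>i. i - 1) {1..<1 + n} {..<n}"
      by (rule bij_betw_byWitness[where f' = Suc]) auto
    then have \<tau>: "\<tau> permutes {..<n}" unfolding \<tau>_def by (rule map_permutation_permutes[OF _ \<sigma>])
    have sgn: "sign \<tau> = sign \<sigma>"
      unfolding \<tau>_def by (rule sign_map_permutation[OF inj \<sigma>]) simp
    have \<sigma>0: "\<sigma> 0 = 0" using \<sigma> unfolding permutes_def by auto
    have "(u # ws) ! \<sigma> (1 + i) = ws ! \<tau> i" if "i < n" for i
    proof -
      have "\<tau> i = \<sigma> (1 + i) - 1"
        using map_permutation_apply[OF inj, of "1 + i" \<sigma>] that unfolding \<tau>_def by simp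
      moreover have "\<sigma> (1 + i) \<in> {1..<1 + n}" using permutes_in_image[OF \<sigma>, of "1 + i"] that by simp
      ultimately show ?thesis by (simp add: nth_Cons')
    qed
    then have "map (\<lambda>i. (u # ws) ! \<sigma> i) [1..<1 + n] = map (\<lambda>i. ws ! \<tau> i) [0..<n]"
      using map_upt_shift[of "\<lambda>i. (u # ws) ! \<sigma> i" 1 0 n] by simp
    then have "G \<sigma> = of_int (sign \<sigma>) * \<alpha> p [u] * (of_int (sign \<tau>) * \<Omega> p ws)"
      unfolding G_def using \<Omega>[OF \<tau>] \<sigma>0 by simp
    also have "\<dots> = of_int (sign \<sigma> * sign \<sigma>) * (\<alpha> p [u] * \<Omega> p ws)" unfolding sgn by (simp only: of_int_mult mult_ac)
    finally show "G \<sigma> = \<alpha> p [u] * \<Omega> p ws" by (simp only: sign_idempotent of_int_1 mult_1)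
  qed
  also have "\<dots> = fact n * (\<alpha> p [u] * \<Omega> p ws)"
  \<comment> \<open>The number of permutations fixing 0 is n!, exactly the normalizing factor of a
    product of degrees 1 and \<open>n\<close>.\<close>
  proof -
    have "card {\<sigma>. \<sigma> permutes {1..<1 + n}} = fact n" by (rule card_permutations) auto
    then show ?thesis by (simp only: sum_constant of_nat_fact)
  qed
  finally show ?thesis unfolding wedge_def G_def by simp
qed

lemma tangent_lists_nth_map:
  assumes "vs \<in> tangent_lists A n p" "\<And>i. i \<in> set is \<Longrightarrow> \<sigma> i < n" "length is = m"
  shows "map (\<lambda>i. vs ! \<sigma> i) is \<in> tangent_lists A m p"
  using assms by (auto simp: tangent_lists_def subset_iff)

lemma form_eq_refl: "form_eq A k \<omega> \<omega>"
  and form_eq_trans: "form_eq A k \<omega> \<theta> \<Longrightarrow> form_eq A k \<theta> \<zeta> \<Longrightarrow> form_eq A k \<omega> \<zeta>"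
  and form_eq_sym: "form_eq A k \<omega> \<theta> \<Longrightarrow> form_eq A k \<theta> \<omega>"
  by (simp_all add: form_eq_def)

lemma form_eq_wedge:
  assumes "form_eq A k \<omega> \<omega>'" "form_eq A l \<theta> \<theta>'"
  shows "form_eq A (k + l) (wedge k l \<omega> \<theta>) (wedge k l \<omega>' \<theta>')"
  unfolding form_eq_def
proof (intro allI ballI)
  fix p vs assume vs: "vs \<in> tangent_lists A (k + l) p"
  have "\<omega> p (map (\<lambda>i. vs ! \<sigma> i) [0..<k]) = \<omega>' p (map (\<lambda>i. vs ! \<sigma> i) [0..<k]) \<and>
      \<theta> p (map (\<lambda>i. vs ! \<sigma> i) [k..<k + l]) = \<theta>' p (map (\<lambda>i. vs ! \<sigma> i) [k..<k + l])"
    if "\<sigma> permutes {..<k + l}" for \<sigma>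
    using assms tangent_lists_nth_map[OF vs, of "[0..<k]" \<sigma> k]
      tangent_lists_nth_map[OF vs, of "[k..<k + l]" \<sigma> l] permutes_lessThan[OF that]
    by (simp add: form_eq_def)
  then show "wedge k l \<omega> \<theta> p vs = wedge k l \<omega>' \<theta>' p vs"
    unfolding wedge_def by (intro arg_cong2[where f = "(/)"] sum.cong refl) auto
qed

lemma form_eq_wedge_power:
  "form_eq A k \<omega> \<omega>' \<Longrightarrow> form_eq A (k * n) (wedge_power k \<omega> n) (wedge_power k \<omega>' n)"
  by (induction n) (auto simp: form_eq_refl intro: form_eq_wedge)

text \<open>The length matters because \<open>nth\<close> commutes with \<open>map\<close> only at
  positions inside the list.\<close>

lemma pullback_wedge:
  assumes "length vs = k + l"
  shows "pullback A B F (wedge k l \<omega> \<theta>) p vs = wedge k l (pullback A B F \<omega>) (pullback A B F \<theta>) p vs"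
proof -
  let ?P = "pushforward A B F p"
  have "map (\<lambda>i. map ?P vs ! \<sigma> i) [0..<k] = map ?P (map (\<lambda>i. vs ! \<sigma> i) [0..<k]) \<and>
      map (\<lambda>i. map ?P vs ! \<sigma> i) [k..<k + l] = map ?P (map (\<lambda>i. vs ! \<sigma> i) [k..<k + l])"
    if "\<sigma> permutes {..<k + l}" for \<sigma>
    using permutes_lessThan[OF that] assms by simp
  then show ?thesis
    unfolding wedge_def pullback_def
    by (intro arg_cong2[where f = "(/)"] sum.cong refl) (simp only: mem_Collect_eq)
qed

lemma form_eq_pullback_wedge:
  "form_eq A (k + l) (pullback A B F (wedge k l \<omega> \<theta>)) (wedge k l (pullback A B F \<omega>) (pullback A B F \<theta>))"
  by (simp add: form_eq_def tangent_lists_def pullback_wedge)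

lemma form_eq_pullback_wedge_power:
  "form_eq A (k * n) (pullback A B F (wedge_power k \<omega> n)) (wedge_power k (pullback A B F \<omega>) n)"
proof (induction n)
  case 0
  then show ?case by (simp add: form_eq_def pullback_def)
next
  case (Suc n)
  then show ?case
    using form_eq_trans[OF form_eq_pullback_wedge form_eq_wedge[OF form_eq_refl Suc]] by simp
qed

subsection \<open>Pullback of one-forms\<close>

lemma pullback_1: "pullback A B F \<beta> p [v] = \<beta> (F p) [pushforward A B F p v]"
  by (simp add: pullback_def)

lemma is_form_1_pullback:
  assumes A: "smooth_atlas A" and B: "smooth_atlas B" and F: "\<And>p. smooth_at A B p F"
    and \<beta>: "is_form B 1 \<beta>"
  shows "is_form A 1 (pullback A B F \<beta>)"
proof (rule is_form_1I)
  fix p u v and a b :: real assume "u \<in> tangent_space A p" "v \<in> tangent_space A p"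
  then show "pullback A B F \<beta> p [\<lambda>f. a * u f + b * v f] =
      a * pullback A B F \<beta> p [u] + b * pullback A B F \<beta> p [v]"
    unfolding pullback_1 pushforward_lincomb
    by (intro one_form_linear[OF \<beta>] pushforward_tangent[OF A B F])
next
  fix c p e assume c: "c \<in> A" "p \<in> fst c"
  obtain U x where x: "c = (U, x)" by fastforce
  have "smooth_along A A (\<lambda>q. q) p (coord_vector A (U, x) e)"
    using smooth_vector_field_along[OF A A smooth_at_id[OF A] coord_vector_field[OF A] chart_open[OF A]] c x
    by simp
  then show "smooth_at A euclidean_atlas p (\<lambda>q. pullback A B F \<beta> q [coord_vector A c e q])"
    unfolding pullback_1 x
    by (intro one_form_along_smooth[OF A B F \<beta>] smooth_along_pushforward[OF A A B smooth_at_id[OF A] F])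
qed

text \<open>The chart picked by \<open>SOME\<close> is named once and serves all forms and all pairs
  of vectors at \<open>p\<close>. Nothing else is known of it than that it is a chart of the atlas
  around \<open>p\<close>.\<close>

lemma ext_deriv_1:
  assumes A: "smooth_atlas A"
  obtains U x where "(U, x) \<in> A" "p \<in> U"
    "\<And>\<omega> u v. ext_deriv A \<omega> p [u, v] =
      u (\<lambda>q. \<omega> q [coord_vector A (U, x) (components (U, x) v) q]) -
      v (\<lambda>q. \<omega> q [coord_vector A (U, x) (components (U, x) u) q])"
proof -
  obtain U x where x: "(SOME c. c \<in> A \<and> p \<in> fst c) = (U, x)" by fastforce
  have "\<exists>c. c \<in> A \<and> p \<in> fst c" using atlas_cover[OF A] by force
  from someI_ex[OF this] have "(U, x) \<in> A" "p \<in> U" unfolding x by auto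
  moreover have "ext_deriv A \<omega> p [u, v] =
      u (\<lambda>q. \<omega> q [coord_vector A (U, x) (components (U, x) v) q]) -
      v (\<lambda>q. \<omega> q [coord_vector A (U, x) (components (U, x) u) q])" for \<omega> u v
    by (simp add: ext_deriv_def ext_deriv_chart_def x lessThan_Suc numeral_2_eq_2)
  ultimately show ?thesis using that by blast
qed

lemma ext_deriv_zero_left:
  assumes A: "smooth_atlas A" and \<beta>: "is_form A 1 \<beta>" and v: "v \<in> tangent_space A p"
  shows "ext_deriv A \<beta> p [zero_tangent, v] = 0"
proof -
  obtain U x where x: "(U, x) \<in> A" "p \<in> U" and d: "\<And>\<omega> u v. ext_deriv A \<omega> p [u, v] =
      u (\<lambda>q. \<omega> q [coord_vector A (U, x) (components (U, x) v) q]) -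
      v (\<lambda>q. \<omega> q [coord_vector A (U, x) (components (U, x) u) q])"
    by (rule ext_deriv_1[OF A]) blast
  have "components (U, x) zero_tangent = 0" by (simp add: components_def)
  then show ?thesis
    by (simp add: d coord_vector_zero one_form_zero[OF A \<beta>] tangent_const[OF A v])
qed

text \<open>The coefficients of \<open>e\<close> are constants and pass through the derivation
  \<open>v\<close>, so only derivatives of the coefficient functions of \<beta> remain.\<close>

lemma one_form_coord_derivative:
  assumes A: "smooth_atlas A" "(U, x) \<in> A" and p: "p \<in> U" and v: "v \<in> tangent_space A p" and \<beta>: "is_form A 1 \<beta>"
  shows "v (\<lambda>q. \<beta> q [coord_vector A (U, x) e q]) =
    (\<Sum>b\<in>Basis. (e \<bullet> b) * v (\<lambda>q. \<beta> q [coord_vector A (U, x) b q]))"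
proof -
  have "v (\<lambda>q. \<beta> q [coord_vector A (U, x) e q]) =
      v (\<lambda>q. \<Sum>b\<in>Basis. (e \<bullet> b) * \<beta> q [coord_vector A (U, x) b q])"
    by (rule tangent_local[OF A(1) v chart_open[OF A] p])
      (simp add: one_form_expand[OF A _ \<beta> coord_vector_tangent[OF A]] coord_vector_coordinate[OF A])
  also have "\<dots> = (\<Sum>b\<in>Basis. v (\<lambda>q. (e \<bullet> b) * \<beta> q [coord_vector A (U, x) b q]))"
    by (rule tangent_sum[OF A(1) v finite_Basis])
      (intro smooth_at_mult A smooth_at_const smooth_atlas_euclidean one_form_coord_smooth[OF \<beta> A(2) p])
  also have "\<dots> = (\<Sum>b\<in>Basis. (e \<bullet> b) * v (\<lambda>q. \<beta> q [coord_vector A (U, x) b q]))"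
    by (simp add: tangent_cmult[OF A(1) v one_form_coord_smooth[OF \<beta> A(2) p]])
  finally show ?thesis .
qed

text \<open>The second derivatives of \<open>F\<close> cancel because coordinate vector fields commute.\<close>

lemma ext_deriv_pullback:
  assumes A: "smooth_atlas A" and B: "smooth_atlas B" and F: "\<And>p. smooth_at A B p F"
    and \<beta>: "is_form B 1 \<beta>" and uv: "u \<in> tangent_space A p" "v \<in> tangent_space A p"
  shows "ext_deriv A (pullback A B F \<beta>) p [u, v] =
    ext_deriv B \<beta> (F p) [pushforward A B F p u, pushforward A B F p v]"
proof -
  obtain U x where x: "(U, x) \<in> A" "p \<in> U" and dA: "\<And>\<omega> u v. ext_deriv A \<omega> p [u, v] =
      u (\<lambda>q. \<omega> q [coord_vector A (U, x) (components (U, x) v) q]) -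
      v (\<lambda>q. \<omega> q [coord_vector A (U, x) (components (U, x) u) q])"
    by (rule ext_deriv_1[OF A]) blast
  obtain V y where y: "(V, y) \<in> B" "F p \<in> V" and dB: "\<And>\<omega> u v. ext_deriv B \<omega> (F p) [u, v] =
      u (\<lambda>q. \<omega> q [coord_vector B (V, y) (components (V, y) v) q]) -
      v (\<lambda>q. \<omega> q [coord_vector B (V, y) (components (V, y) u) q])"
    by (rule ext_deriv_1[OF B]) blast
  obtain S where S: "open S" "p \<in> S" "F ` S \<subseteq> V"
    by (rule smooth_at_preimage[OF F chart_open[OF B y(1)] y(2)])
  \<comment> \<open>With \<open>g b\<close> the coordinates of \<open>F\<close> and
    \<open>\<beta>' b\<close> the coefficients of \<beta>, the pullback is the sum of the functions
    \<open>\<beta>' b \<circ> F\<close> times the differentials of \<open>g b\<close>. Both sides of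
    the claim become the sum of the products of the differentials of these two functions.\<close>
  define g where "g b q = y (F q) \<bullet> b" for b q
  define \<beta>' where "\<beta>' b r = \<beta> r [coord_vector B (V, y) b r]" for b r
  have g: "smooth_at A euclidean_atlas p (g b)" for b
    unfolding g_def by (rule smooth_at_compose[OF A B smooth_atlas_euclidean F smooth_at_coordinate[OF B y]])
  have \<beta>': "smooth_at B euclidean_atlas (F p) (\<beta>' b)" for b
    unfolding \<beta>'_def by (rule one_form_coord_smooth[OF \<beta> y])
  have \<beta>'F: "smooth_at A euclidean_atlas p (\<lambda>q. \<beta>' b (F q))" for b
    by (rule smooth_at_compose[OF A B smooth_atlas_euclidean F \<beta>'])
  have push: "pushforward A B F q w (\<lambda>r. y r \<bullet> b) = w (g b)" if "q \<in> S" for q w b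
    unfolding g_def using smooth_at_coordinate[OF B y(1)] S(3) that by (intro pushforward_apply) auto
  have deriv: "w (\<lambda>q. pullback A B F \<beta> q [coord_vector A (U, x) e q]) =
      (\<Sum>b\<in>Basis. coord_vector A (U, x) e p (g b) * w (\<lambda>q. \<beta>' b (F q)) +
        w (\<lambda>q. coord_vector A (U, x) e q (g b)) * \<beta>' b (F p))"
    if w: "w \<in> tangent_space A p" for w e
  proof -
    have "w (\<lambda>q. pullback A B F \<beta> q [coord_vector A (U, x) e q]) =
        w (\<lambda>q. \<Sum>b\<in>Basis. coord_vector A (U, x) e q (g b) * \<beta>' b (F q))"
    proof (rule tangent_local[OF A w, where S = "S \<inter> U"])
      fix q assume q: "q \<in> S \<inter> U"
      then show "pullback A B F \<beta> q [coord_vector A (U, x) e q] =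
          (\<Sum>b\<in>Basis. coord_vector A (U, x) e q (g b) * \<beta>' b (F q))"
        unfolding pullback_1 \<beta>'_def
        using one_form_expand[OF B y(1) _ \<beta> pushforward_tangent[OF A B F coord_vector_tangent[OF A x(1)]], of q e] S(3) push
        by auto
    qed (use S x chart_open[OF A x(1)] in auto)
    also have "\<dots> = (\<Sum>b\<in>Basis. w (\<lambda>q. coord_vector A (U, x) e q (g b) * \<beta>' b (F q)))"
      by (intro tangent_sum[OF A w finite_Basis] smooth_at_mult A smooth_at_coord_vector_apply x g \<beta>'F)
    also have "\<dots> = (\<Sum>b\<in>Basis. coord_vector A (U, x) e p (g b) * w (\<lambda>q. \<beta>' b (F q)) +
        w (\<lambda>q. coord_vector A (U, x) e q (g b)) * \<beta>' b (F p))"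
      by (intro sum.cong refl tangent_mult[OF A w] smooth_at_coord_vector_apply A x g \<beta>'F)
    finally show ?thesis .
  qed
  let ?cu = "components (U, x) u" and ?cv = "components (U, x) v"
  have cu: "coord_vector A (U, x) ?cu p = u" and cv: "coord_vector A (U, x) ?cv p = v"
    using coord_vector_components[OF A x] uv by auto
  have comm: "u (\<lambda>q. coord_vector A (U, x) ?cv q (g b)) = v (\<lambda>q. coord_vector A (U, x) ?cu q (g b))" for b
    using coord_vector_commute[OF A x g, of ?cu ?cv b] unfolding cu cv .
  have "ext_deriv A (pullback A B F \<beta>) p [u, v] =
      (\<Sum>b\<in>Basis. v (g b) * u (\<lambda>q. \<beta>' b (F q)) - u (g b) * v (\<lambda>q. \<beta>' b (F q)))"
    unfolding dA deriv[OF uv(1)] deriv[OF uv(2)] cu cv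
    by (simp add: comm flip: sum_subtractf)
  \<comment> \<open>On the side of B the components of the pushed vector are frozen constants with
    entries \<open>w' (g b)\<close>, so no second derivative appears.\<close>
  moreover have "pushforward A B F p w (\<lambda>r. \<beta> r [coord_vector B (V, y) (components (V, y) (pushforward A B F p w')) r]) =
      (\<Sum>b\<in>Basis. w' (g b) * w (\<lambda>q. \<beta>' b (F q)))"
    if "w \<in> tangent_space A p" for w w'
  proof -
    have "pushforward A B F p w (\<lambda>r. \<beta> r [coord_vector B (V, y) (components (V, y) (pushforward A B F p w')) r]) =
        (\<Sum>b\<in>Basis. (components (V, y) (pushforward A B F p w') \<bullet> b) * pushforward A B F p w (\<beta>' b))"
      unfolding \<beta>'_def by (rule one_form_coord_derivative[OF B y pushforward_tangent[OF A B F that] \<beta>])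
    also have "\<dots> = (\<Sum>b\<in>Basis. w' (g b) * w (\<lambda>q. \<beta>' b (F q)))"
      by (intro sum.cong refl) (simp only: components_inner push[OF S(2)] pushforward_apply[of B F p, OF \<beta>'])
    finally show ?thesis .
  qed
  ultimately show ?thesis unfolding dB using uv by (simp add: sum_subtractf)
qed

lemma pushforward_sum:
  "pushforward A B F p (\<lambda>f. \<Sum>i\<in>I. a i * u i f) = (\<lambda>f. \<Sum>i\<in>I. a i * pushforward A B F p (u i) f)"
  by (auto simp: pushforward_def)

lemma smooth_along_cong_map:
  assumes A: "smooth_atlas A" and Y: "smooth_along A B F p Y"
    and S: "open S" "p \<in> S" "\<And>q. q \<in> S \<Longrightarrow> F q = G q"
  shows "smooth_along A B G p Y"
  unfolding smooth_along_def
proof (intro conjI allI impI)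
  obtain T where "open T" "p \<in> T" "\<And>q. q \<in> T \<Longrightarrow> Y q \<in> tangent_space B (F q)"
    using Y unfolding smooth_along_def by blast
  then show "\<exists>S. open S \<and> p \<in> S \<and> (\<forall>q\<in>S. Y q \<in> tangent_space B (G q))"
    using S(1,2) by (intro exI[of _ "S \<inter> T"]) (auto simp: S(3)[symmetric])
qed (use smooth_alongD[OF Y] S(2,3) in simp)

text \<open>The inverse of the product chart splits only while both coordinates stay in the chart
  ranges. This holds for small \<open>t\<close>, which is all that a velocity sees.\<close>

lemma coord_vector_prod:
  assumes A: "smooth_atlas A" "(U, x) \<in> A" "p \<in> U" and B: "smooth_atlas B" "(V, y) \<in> B" "q \<in> V"
  shows "coord_vector (prod_atlas A B) (U \<times> V, map_prod x y) (a, b) (p, q) =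
    velocity (prod_atlas A B) (\<lambda>t. (inv_into U x (x p + t *\<^sub>R a), inv_into V y (y q + t *\<^sub>R b)))"
proof -
  define S where "S = (\<lambda>t. x p + t *\<^sub>R a) -` x ` U \<inter> (\<lambda>t. y q + t *\<^sub>R b) -` y ` V"
  have "open S"
    unfolding S_def
    by (intro open_Int open_vimage chart_open_range[OF A(1,2)] chart_open_range[OF B(1,2)] continuous_intros)
  moreover have "0 \<in> S" using A(3) B(3) by (simp add: S_def)
  ultimately show ?thesis
    unfolding coord_vector_def
    by (rule velocity_cong)
      (auto simp: S_def intro!: inv_into_map_prod chart_inj[OF A(1,2)] chart_inj[OF B(1,2)])
qed

subsection \<open>Horizontal lifts\<close>

locale circle_bundle_connection =
  fixes AM :: "('m::{t2_space,second_countable_topology}, 'em::euclidean_space) chart set"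
    and AB :: "('b::{t2_space,second_countable_topology}, 'eb::euclidean_space) chart set"
    and \<pi> :: "'m \<Rightarrow> 'b" and act :: "complex \<Rightarrow> 'm \<Rightarrow> 'm" and T :: real and \<alpha> :: "'m form"
  assumes AM: "smooth_atlas AM" and AB: "smooth_atlas AB" and T: "T > 0"
    and principal: "principal_circle_bundle AM AB \<pi> act"
    and connection: "connection_form AM act T \<alpha>"
begin

abbreviation "vert \<equiv> circle_generator AM act T"
abbreviation "lift \<equiv> horizontal_lift AM AB \<pi> \<alpha>"
abbreviation "push \<equiv> pushforward AM AB \<pi>"

lemma proj_smooth: "smooth_at AM AB p \<pi>"
  using principal unfolding principal_circle_bundle_def smooth_at_def by blast

lemma act_one: "act 1 p = p"
  and proj_act: "norm z = 1 \<Longrightarrow> \<pi> (act z p) = \<pi> p"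
  using principal unfolding principal_circle_bundle_def by blast+

lemma action_smooth:
  "smooth_at (prod_atlas (euclidean_atlas :: (real, real) chart set) AM) AM q (\<lambda>(t, p). act (cis t) p)"
  using principal unfolding principal_circle_bundle_def smooth_at_def by blast

text \<open>Smoothness of the action is given in the angle, so \<open>z\<close> is written as
  \<open>cis t\<close> and the action is restricted to the slice at \<open>t\<close>.\<close>

lemma act_smooth: "norm z = 1 \<Longrightarrow> smooth_at AM AM p (act z)"
proof -
  assume "norm z = 1"
  then obtain t where t: "z = cis t" by (metis complex_norm_eq_1_exp cis_conv_exp)
  have "smooth_at AM AM p (\<lambda>q. case (t, q) of (t, p) \<Rightarrow> act (cis t) p)"
    by (rule smooth_at_compose[OF AM smooth_atlas_prod[OF smooth_atlas_euclidean AM] AM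
          smooth_at_Pair[OF AM smooth_atlas_euclidean AM smooth_at_const[OF AM smooth_atlas_euclidean] smooth_at_id[OF AM]]
          action_smooth])
  then show ?thesis unfolding t by simp
qed

lemma form_\<alpha>: "is_form AM 1 \<alpha>"
  and \<alpha>_vert: "\<alpha> p [vert p] = 1"
  and \<alpha>_invariant: "circle_invariant_form AM act 1 \<alpha>"
  using connection unfolding connection_form_def by blast+

text \<open>Here the circle-valued fibre coordinate is replaced by a real one. \<Phi> is defined for
  all real angles and is periodic in them; the inverse angle \<theta> exists only near
  \<open>p\<close>, because it needs a branch of the logarithm.\<close>

lemma local_trivialization:
  obtains U \<Phi> \<theta> S where "open U" "\<pi> p \<in> U"
    "\<And>b t. b \<in> U \<Longrightarrow> smooth_at (prod_atlas AB (euclidean_atlas :: (real, real) chart set)) AM (b, t) \<Phi>"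
    "\<And>b t. b \<in> U \<Longrightarrow> \<pi> (\<Phi> (b, t)) = b"
    "\<And>b t s. b \<in> U \<Longrightarrow> \<Phi> (b, t + s) = act (cis s) (\<Phi> (b, t))"
    "open S" "p \<in> S" "\<pi> ` S \<subseteq> U" "\<And>q. q \<in> S \<Longrightarrow> smooth_at AM euclidean_atlas q \<theta>"
    "\<And>q. q \<in> S \<Longrightarrow> \<Phi> (\<pi> q, \<theta> q) = q"
proof -
  have "\<exists>U g. open U \<and> \<pi> p \<in> U \<and>
        (\<forall>z p. norm z = 1 \<and> \<pi> p \<in> U \<longrightarrow> g (act z p) = z * g p) \<and>
        smooth_map_on AM (euclidean_atlas :: (complex, complex) chart set) (\<pi> -` U) g \<and>
        bij_betw (\<lambda>p. (\<pi> p, g p)) (\<pi> -` U) (U \<times> sphere 0 1) \<and>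
        smooth_map_on (prod_atlas AB (euclidean_atlas :: (real, real) chart set)) AM (U \<times> UNIV)
          (\<lambda>(b, t). inv_into (\<pi> -` U) (\<lambda>p. (\<pi> p, g p)) (b, cis t))"
    using principal unfolding principal_circle_bundle_def by (elim conjE) (erule spec)
  then obtain U g where U: "open U" "\<pi> p \<in> U"
    and g_act: "\<forall>z p. norm z = 1 \<and> \<pi> p \<in> U \<longrightarrow> g (act z p) = z * g p"
    and g_smooth: "smooth_map_on AM (euclidean_atlas :: (complex, complex) chart set) (\<pi> -` U) g"
    and bij: "bij_betw (\<lambda>p. (\<pi> p, g p)) (\<pi> -` U) (U \<times> sphere 0 1)"
    and \<Phi>_smooth: "smooth_map_on (prod_atlas AB (euclidean_atlas :: (real, real) chart set)) AM (U \<times> UNIV)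
          (\<lambda>(b, t). inv_into (\<pi> -` U) (\<lambda>p. (\<pi> p, g p)) (b, cis t))"
    by (elim exE conjE) (rule that; assumption)
  define \<Phi> where "\<Phi> = (\<lambda>(b, t). inv_into (\<pi> -` U) (\<lambda>p. (\<pi> p, g p)) (b, cis t))"
  have inj: "inj_on (\<lambda>p. (\<pi> p, g p)) (\<pi> -` U)" using bij by (rule bij_betw_imp_inj_on)
  have \<Phi>: "\<pi> (\<Phi> (b, t)) = b" "g (\<Phi> (b, t)) = cis t" if "b \<in> U" for b t
  proof -
    have "(b, cis t) \<in> (\<lambda>p. (\<pi> p, g p)) ` (\<pi> -` U)"
      using bij that unfolding bij_betw_def by auto
    from f_inv_into_f[OF this] show "\<pi> (\<Phi> (b, t)) = b" "g (\<Phi> (b, t)) = cis t"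
      by (simp_all add: \<Phi>_def)
  qed
  have \<Phi>_eq: "\<Phi> (\<pi> q, t) = q" if "\<pi> q \<in> U" "g q = cis t" for q t
    using inj_onD[OF inj, of "\<Phi> (\<pi> q, t)" q] that \<Phi>[OF that(1)] by simp
  have norm_g: "norm (g q) = 1" if "\<pi> q \<in> U" for q
    using bspec[OF bij_betwE[OF bij], of q] that by simp
  have g_at: "smooth_at AM euclidean_atlas q g" if "\<pi> q \<in> U" for q
    using g_smooth that unfolding smooth_at_def by auto
  \<comment> \<open>Division by \<open>g p\<close> moves the value at \<open>p\<close> to 1, away
    from the branch cut, whatever \<open>g p\<close> is.\<close>
  define w where "w q = g q / g p" for q
  have w_at: "smooth_at AM euclidean_atlas q w" if "\<pi> q \<in> U" for q
    unfolding w_def by (rule smooth_at_compose_linear[OF AM bounded_linear_divide g_at[OF that]])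
  have o: "open (- \<real>\<^sub>\<le>\<^sub>0 :: complex set)" by (simp add: open_Compl)
  have wp: "w p \<in> - \<real>\<^sub>\<le>\<^sub>0" using norm_g[OF U(2)] by (auto simp: w_def)
  obtain R where R: "open R" "p \<in> R" "w ` R \<subseteq> - \<real>\<^sub>\<le>\<^sub>0"
    by (rule smooth_at_preimage[OF w_at[OF U(2)] o wp])
  obtain Q where Q: "open Q" "p \<in> Q" "\<pi> ` Q \<subseteq> U" by (rule smooth_at_preimage[OF proj_smooth U])
  \<comment> \<open>The argument of \<open>g p\<close> undoes the division. Since \<open>w q\<close>
    has norm 1, its logarithm is purely imaginary and \<open>Im (Ln (w q))\<close> is a true angle
    of \<open>w q\<close>.\<close>
  define \<theta> where "\<theta> q = Im (Ln (w q)) + Arg (g p)" for q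
  have g_cis: "g q = cis (\<theta> q)" if "\<pi> q \<in> U" for q
  proof -
    have w1: "norm (w q) = 1" using norm_g[OF U(2)] norm_g[OF that] by (simp add: w_def norm_divide)
    then have "w q \<noteq> 0" by auto
    then have "Ln (w q) = \<i> * Im (Ln (w q))"
      using w1 by (simp add: complex_eq_iff)
    then have "cis (Im (Ln (w q))) = w q"
      using \<open>w q \<noteq> 0\<close> by (metis cis_conv_exp exp_Ln)
    moreover have "g p \<noteq> 0" using norm_g[OF U(2)] by auto
    moreover from this have "cis (Arg (g p)) = g p"
      using norm_g[OF U(2)] cis_Arg[of "g p"] by (simp add: sgn_eq)
    ultimately show ?thesis by (simp add: \<theta>_def w_def flip: cis_mult)
  qed
  show ?thesis
  proof (rule that[of U \<Phi> "R \<inter> Q" \<theta>, OF U])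
    show "smooth_at (prod_atlas AB (euclidean_atlas :: (real, real) chart set)) AM (b, t) \<Phi>" if "b \<in> U" for b t
      unfolding smooth_at_def \<Phi>_def
      by (rule exI[of _ "U \<times> UNIV"], rule conjI[OF _ \<Phi>_smooth]) (simp add: that)
    show "\<pi> (\<Phi> (b, t)) = b" if "b \<in> U" for b t by (rule \<Phi>(1)[OF that])
    show "\<Phi> (b, t + s) = act (cis s) (\<Phi> (b, t))" if "b \<in> U" for b t s
    proof -
      have "\<pi> (act (cis s) (\<Phi> (b, t))) = b" using proj_act \<Phi>(1)[OF that] by simp
      moreover have "g (act (cis s) (\<Phi> (b, t))) = cis (t + s)"
        using g_act \<Phi>[OF that] that by (simp add: cis_mult add.commute)
      ultimately show ?thesis using \<Phi>_eq[of "act (cis s) (\<Phi> (b, t))" "t + s"] that by simp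
    qed
    show "smooth_at AM euclidean_atlas q \<theta>" if q: "q \<in> R \<inter> Q" for q
    proof -
      have wq: "smooth_at euclidean_atlas euclidean_atlas (w q) Ln"
        unfolding smooth_at_euclidean using o smooth_on_Ln R(3) q by blast
      have "smooth_at AM euclidean_atlas q (\<lambda>q. Im (Ln (w q)))"
        using q Q(3)
        by (intro smooth_at_compose_linear[OF AM bounded_linear_Im]
            smooth_at_compose[OF AM smooth_atlas_euclidean smooth_atlas_euclidean w_at wq]) auto
      then show ?thesis
        unfolding \<theta>_def by (intro smooth_at_add AM smooth_at_const smooth_atlas_euclidean)
    qed
    show "\<Phi> (\<pi> q, \<theta> q) = q" if "q \<in> R \<inter> Q" for q
      using \<Phi>_eq g_cis that Q(3) by blast
  qed (use R Q in auto)
qed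

lemma orbit_smooth: "smooth_at euclidean_atlas AM 0 (\<lambda>t. act (cis (2 * pi * t / T)) p)"
proof -
  have lin: "smooth_at euclidean_atlas euclidean_atlas 0 (\<lambda>t. 2 * pi * t / T)"
    unfolding smooth_at_euclidean
    using smooth_on_linear[OF open_UNIV bounded_linear_mult_right[of "2 * pi / T"]] by (intro exI[of _ UNIV]) simp
  have "smooth_at euclidean_atlas AM 0 (\<lambda>t. case (2 * pi * t / T, p) of (t, p) \<Rightarrow> act (cis t) p)"
    by (rule smooth_at_compose[OF smooth_atlas_euclidean smooth_atlas_prod[OF smooth_atlas_euclidean AM] AM
          smooth_at_Pair[OF smooth_atlas_euclidean smooth_atlas_euclidean AM lin smooth_at_const[OF smooth_atlas_euclidean AM]]
          action_smooth])
  then show ?thesis by simp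
qed

lemma vert_tangent: "vert p \<in> tangent_space AM p"
  using tangent_spaceI[OF orbit_smooth[of p]] act_one by (simp add: circle_generator_def)

lemma push_vert: "push p (vert p) = zero_tangent"
  using pushforward_velocity[OF AM AB, of "\<lambda>t. act (cis (2 * pi * t / T)) p" \<pi>] proj_smooth
  by (simp add: circle_generator_def act_one proj_act velocity_const)

text \<open>The generator is the image, under the action map on \<real> x M, of a constant multiple
  of the field in the direction of \<real>, taken at the points (0, q). The factor 2 * pi / T is the
  angular speed in \<open>circle_generator\<close>.\<close>

lemma vert_smooth: "smooth_along AM AM (\<lambda>q. q) p vert"
proof -
  let ?P = "prod_atlas (euclidean_atlas :: (real, real) chart set) AM"
  have P: "smooth_atlas ?P" by (rule smooth_atlas_prod[OF smooth_atlas_euclidean AM])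
  obtain U x where x: "(U, x) \<in> AM" "p \<in> U" using atlas_cover[OF AM] by meson
  let ?c = "(UNIV \<times> U, map_prod (\<lambda>x. x) x) :: (real \<times> 'm, real \<times> 'em) chart"
  have c: "?c \<in> ?P" by (rule prod_atlas_chart[OF euclidean_chart x(1)])
  let ?act = "\<lambda>(t, p). act (cis t) p"
  have F: "smooth_at AM ?P p (\<lambda>q. (0, q))"
    by (intro smooth_at_Pair AM smooth_atlas_euclidean smooth_at_const smooth_at_id)
  have "smooth_along AM ?P (\<lambda>q. (0, q)) p (\<lambda>q. coord_vector ?P ?c (2 * pi / T, 0) (0, q))"
    by (rule smooth_vector_field_along[OF AM P F coord_vector_field[OF P c] chart_open[OF P c]]) (use x in simp)
  from smooth_along_pushforward[OF AM P AM F action_smooth this]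
  have "smooth_along AM AM (\<lambda>q. ?act (0, q)) p
      (\<lambda>q. pushforward ?P AM ?act (0, q) (coord_vector ?P ?c (2 * pi / T, 0) (0, q)))" .
  then have "smooth_along AM AM (\<lambda>q. q) p
      (\<lambda>q. pushforward ?P AM ?act (0, q) (coord_vector ?P ?c (2 * pi / T, 0) (0, q)))"
    by (simp add: act_one)
  then show ?thesis
  proof (rule smooth_along_cong[OF AM _ chart_open[OF AM x(1)] x(2)])
    fix q assume q: "q \<in> U"
    have "coord_vector ?P ?c (2 * pi / T, 0) (0, q) = velocity ?P (\<lambda>t. (2 * pi * t / T, q))"
      using coord_vector_prod[OF smooth_atlas_euclidean euclidean_chart _ AM x(1) q, of 0 "2 * pi / T" 0]
      by (simp add: chart_inv[OF AM x(1) q] mult_ac)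
    then show "pushforward ?P AM ?act (0, q) (coord_vector ?P ?c (2 * pi / T, 0) (0, q)) = vert q"
      using pushforward_velocity[OF P AM, of "\<lambda>t. (2 * pi * t / T, q)" ?act] action_smooth
      by (simp add: circle_generator_def)
  qed
qed

text \<open>In a local trivialization, a vector that projects to \<open>0\<close> is a multiple of the derivative in the
  fibre direction.\<close>

lemma vertical_if_push_zero:
  assumes u: "u \<in> tangent_space AM p" and 0: "push p u = zero_tangent"
  shows "u = (\<lambda>f. \<alpha> p [u] * vert p f)"
proof -
  let ?P = "prod_atlas AB (euclidean_atlas :: (real, real) chart set)"
  have P: "smooth_atlas ?P" by (rule smooth_atlas_prod[OF AB smooth_atlas_euclidean])
  obtain U \<Phi> \<theta> S where U: "open U" "\<pi> p \<in> U"
    and \<Phi>_smooth: "\<And>b t. b \<in> U \<Longrightarrow> smooth_at ?P AM (b, t) \<Phi>"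
    and \<Phi>_act: "\<And>b t s. b \<in> U \<Longrightarrow> \<Phi> (b, t + s) = act (cis s) (\<Phi> (b, t))"
    and S: "open S" "p \<in> S" "\<pi> ` S \<subseteq> U" and \<theta>: "\<And>q. q \<in> S \<Longrightarrow> smooth_at AM euclidean_atlas q \<theta>"
    and \<Phi>: "\<And>q. q \<in> S \<Longrightarrow> \<Phi> (\<pi> q, \<theta> q) = q"
    by (rule local_trivialization[of p]) blast
  obtain V y where y: "(V, y) \<in> AB" "\<pi> p \<in> V" using atlas_cover[OF AB] by meson
  let ?c = "(V \<times> UNIV, map_prod y (\<lambda>x. x)) :: ('b \<times> real, 'eb \<times> real) chart"
  have c: "?c \<in> ?P" by (rule prod_atlas_chart[OF y(1) euclidean_chart])
  define F where "F q = (\<pi> q, \<theta> q)" for q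
  have Fc: "F p \<in> V \<times> UNIV" using y by (simp add: F_def)
  have F: "smooth_at AM ?P p F"
    unfolding F_def by (intro smooth_at_Pair AM AB smooth_atlas_euclidean proj_smooth \<theta> S)
  \<comment> \<open>Near \<open>p\<close> the map \<Phi> \<circ> F is the identity, so
    \<open>u\<close> is recovered from its image \<open>w\<close> in B x \<real>. The base component
    of \<open>w\<close> is the projection of \<open>u\<close>, that is, zero.\<close>
  define w where "w = pushforward AM ?P F p u"
  have w: "w \<in> tangent_space ?P (F p)" unfolding w_def by (rule pushforward_tangent[OF AM P F u])
  have \<Phi>_Fp: "smooth_at ?P AM (F p) \<Phi>" unfolding F_def by (rule \<Phi>_smooth[OF U(2)])
  have "pushforward ?P AM \<Phi> (F p) w = pushforward AM AM (\<lambda>q. \<Phi> (F q)) p u"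
    unfolding w_def by (rule pushforward_compose[where F = F and p = p, OF AM P AM \<Phi>_Fp])
  also have "\<dots> = pushforward AM AM (\<lambda>q. q) p u"
    by (rule pushforward_cong[OF AM AM u S(1,2)]) (use \<Phi> in \<open>simp add: F_def\<close>)
  also have "\<dots> = u" by (rule pushforward_id[OF u])
  finally have push_w: "pushforward ?P AM \<Phi> (F p) w = u" .
  have "fst (components ?c w) = 0"
  proof (rule euclidean_eqI)
    fix b :: 'eb assume b: "b \<in> Basis"
    have "fst (components ?c w) \<bullet> b = components ?c w \<bullet> (b, 0)" by (simp add: inner_prod_def)
    also have "\<dots> = w (\<lambda>r. y (fst r) \<bullet> b)"
      using components_inner[of "(b, 0)" "V \<times> UNIV" "map_prod y (\<lambda>x. x)" w] b
      by (simp add: Basis_prod_def inner_prod_def map_prod_def case_prod_unfold)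
    also have "\<dots> = pushforward ?P AB fst (F p) w (\<lambda>r. y r \<bullet> b)"
      by (rule pushforward_apply[symmetric]) (use smooth_at_coordinate[OF AB y] in \<open>simp add: F_def\<close>)
    also have "pushforward ?P AB fst (F p) w = push p u"
      unfolding w_def pushforward_compose[OF AM P AB smooth_at_fst[OF AB smooth_atlas_euclidean]]
      by (simp add: F_def)
    finally show "fst (components ?c w) \<bullet> b = 0 \<bullet> b" using 0 by simp
  qed
  then obtain l where l: "components ?c w = (0, l)" by (metis prod.collapse)
  \<comment> \<open>The coefficient rescales the unit direction of the fibre to angular speed 2 * pi
    / T, whose image under \<Phi> is the generator.\<close>
  have "w = coord_vector ?P ?c ((l * T / (2 * pi)) *\<^sub>R (0, 2 * pi / T) + 0 *\<^sub>R 0) (F p)"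
    using coord_vector_components[OF P c Fc w] l T by simp
  then have w_eq: "w = (\<lambda>f. (l * T / (2 * pi)) * coord_vector ?P ?c (0, 2 * pi / T) (F p) f)"
    unfolding coord_vector_linear[OF P c Fc] by simp
  have "coord_vector ?P ?c (0, 2 * pi / T) (F p) = velocity ?P (\<lambda>t. (\<pi> p, \<theta> p + 2 * pi * t / T))"
    unfolding F_def using coord_vector_prod[OF AB y smooth_atlas_euclidean euclidean_chart, of "\<theta> p" 0 "2 * pi / T"]
    by (simp add: chart_inv[OF AB y] mult_ac)
  then have "pushforward ?P AM \<Phi> (F p) (coord_vector ?P ?c (0, 2 * pi / T) (F p)) =
      velocity AM (\<lambda>t. \<Phi> (\<pi> p, \<theta> p + 2 * pi * t / T))"
    using pushforward_velocity[OF P AM, of "\<lambda>t. (\<pi> p, \<theta> p + 2 * pi * t / T)" \<Phi>] \<Phi>_Fp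
    by (simp add: F_def)
  also have "\<dots> = vert p"
    unfolding circle_generator_def \<Phi>_act[OF U(2)] by (simp add: \<Phi>[OF S(2)])
  finally have "pushforward ?P AM \<Phi> (F p) (coord_vector ?P ?c (0, 2 * pi / T) (F p)) = vert p" .
  then have u_eq: "u = (\<lambda>f. (l * T / (2 * pi)) * vert p f)"
    using pushforward_lincomb[of ?P AM \<Phi> "F p" "l * T / (2 * pi)" "coord_vector ?P ?c (0, 2 * pi / T) (F p)" 0 zero_tangent]
      push_w w_eq by simp
  \<comment> \<open>Since \<alpha> is 1 on the generator, evaluating \<alpha> identifies the
    coefficient intrinsically.\<close>
  then have "\<alpha> p [u] = l * T / (2 * pi)"
    using one_form_linear[OF form_\<alpha> vert_tangent vert_tangent, of p "l * T / (2 * pi)" 0] \<alpha>_vert by simp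
  then show ?thesis using u_eq by simp
qed

section \<open>Existence, uniqueness and smoothness of horizontal lifts\<close>

lemma push_tangent: "u \<in> tangent_space AM p \<Longrightarrow> push p u \<in> tangent_space AB (\<pi> p)"
  by (rule pushforward_tangent[OF AM AB proj_smooth])

text \<open>A curve in B is lifted by keeping the angle of \<open>p\<close> fixed in a
  trivialization; subtracting the vertical part of its velocity makes the lift horizontal and leaves
  the projection unchanged.\<close>

lemma push_surj:
  assumes Y: "Y \<in> tangent_space AB (\<pi> p)"
  obtains u where "u \<in> tangent_space AM p" "\<alpha> p [u] = 0" "push p u = Y"
proof -
  let ?P = "prod_atlas AB (euclidean_atlas :: (real, real) chart set)"
  have P: "smooth_atlas ?P" by (rule smooth_atlas_prod[OF AB smooth_atlas_euclidean])
  obtain U \<Phi> \<theta> S where U: "open U" "\<pi> p \<in> U"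
    and \<Phi>_smooth: "\<And>b t. b \<in> U \<Longrightarrow> smooth_at ?P AM (b, t) \<Phi>"
    and \<Phi>_proj: "\<And>b t. b \<in> U \<Longrightarrow> \<pi> (\<Phi> (b, t)) = b"
    and S: "open S" "p \<in> S" and \<Phi>: "\<And>q. q \<in> S \<Longrightarrow> \<Phi> (\<pi> q, \<theta> q) = q"
    by (rule local_trivialization[of p]) blast
  obtain c where c: "c 0 = \<pi> p" "Y = velocity AB c" "smooth_at euclidean_atlas AB 0 c"
    by (rule tangent_spaceE[OF Y])
  define d where "d t = \<Phi> (c t, \<theta> p)" for t
  have d: "smooth_at euclidean_atlas AM 0 d"
    unfolding d_def
    by (rule smooth_at_compose[OF smooth_atlas_euclidean P AM
        smooth_at_Pair[OF smooth_atlas_euclidean AB smooth_atlas_euclidean c(3)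
          smooth_at_const[OF smooth_atlas_euclidean smooth_atlas_euclidean]]])
      (use \<Phi>_smooth U c in simp)
  have d0: "d 0 = p" using \<Phi>[OF S(2)] c(1) by (simp add: d_def)
  obtain R where R: "open R" "0 \<in> R" "c ` R \<subseteq> U"
    using smooth_at_preimage[OF c(3) U(1)] U(2) c(1) by metis
  let ?u = "velocity AM d"
  have u: "?u \<in> tangent_space AM p" using tangent_spaceI[OF d] d0 by simp
  have "push p ?u = velocity AB (\<lambda>t. \<pi> (d t))"
    using pushforward_velocity[OF AM AB proj_smooth, of d] d0 by simp
  also have "\<dots> = Y"
    unfolding c(2) by (rule velocity_cong[OF R(1,2)]) (use R(3) \<Phi>_proj in \<open>auto simp: d_def\<close>)
  finally have Yu: "push p ?u = Y" .
  let ?v = "\<lambda>f. 1 * ?u f + (- \<alpha> p [?u]) * vert p f"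
  show ?thesis
  proof (rule that[of ?v])
    show "?v \<in> tangent_space AM p" by (rule tangent_lincomb[OF AM u vert_tangent])
    show "\<alpha> p [?v] = 0" unfolding one_form_linear[OF form_\<alpha> u vert_tangent] by (simp add: \<alpha>_vert)
    show "push p ?v = Y" unfolding pushforward_lincomb by (simp add: Yu push_vert)
  qed
qed

text \<open>The difference projects to zero, so it is a multiple of the generator, and the factor is
  its value under \<alpha>, which is zero too.\<close>

lemma horizontal_unique:
  assumes "u \<in> tangent_space AM p" "v \<in> tangent_space AM p" "\<alpha> p [u] = \<alpha> p [v]" "push p u = push p v"
  shows "u = v"
proof -
  let ?w = "\<lambda>f. 1 * u f + (- 1) * v f"
  have "push p ?w = zero_tangent" unfolding pushforward_lincomb assms(4) by simp
  moreover have "\<alpha> p [?w] = 0" unfolding one_form_linear[OF form_\<alpha> assms(1,2)] by (simp add: assms(3))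
  ultimately have "?w = (\<lambda>f. 0 * vert p f)"
    using vertical_if_push_zero[OF tangent_lincomb[OF AM assms(1,2)], of 1 "-1"] by simp
  then show ?thesis by (simp add: fun_eq_iff)
qed

text \<open>Every identity for lifts below is obtained by exhibiting a horizontal vector with the
  right projection.\<close>

lemma lift_eqI:
  assumes "u \<in> tangent_space AM p" "\<alpha> p [u] = 0" "push p u = Y"
  shows "lift p Y = u"
  unfolding horizontal_lift_def ker_1form_def
  by (rule the_equality) (use assms horizontal_unique in auto)

lemma
  assumes "Y \<in> tangent_space AB (\<pi> p)"
  shows lift_tangent: "lift p Y \<in> tangent_space AM p"
    and lift_horizontal: "\<alpha> p [lift p Y] = 0"
    and push_lift: "push p (lift p Y) = Y"
proof -
  obtain u where u: "u \<in> tangent_space AM p" "\<alpha> p [u] = 0" "push p u = Y"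
    by (rule push_surj[OF assms])
  then have "lift p Y = u" by (rule lift_eqI)
  then show "lift p Y \<in> tangent_space AM p" "\<alpha> p [lift p Y] = 0" "push p (lift p Y) = Y"
    using u by auto
qed

lemma lift_lincomb:
  assumes "Y \<in> tangent_space AB (\<pi> p)" "Z \<in> tangent_space AB (\<pi> p)"
  shows "lift p (\<lambda>f. a * Y f + b * Z f) = (\<lambda>f. a * lift p Y f + b * lift p Z f)"
  by (rule lift_eqI)
    (simp_all add: tangent_lincomb[OF AM] one_form_linear[OF form_\<alpha>] pushforward_lincomb
      lift_tangent lift_horizontal push_lift assms)

lemma lift_zero: "lift p zero_tangent = zero_tangent"
  by (rule lift_eqI) (simp_all add: tangent_zero[OF AM] one_form_zero[OF AM form_\<alpha>] pushforward_zero)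

text \<open>The definite description does not say how lifts vary with the point. In a trivialization
  the coordinate fields of B have explicit smooth lifts; the lift of \<open>Y\<close> is their
  combination with the smooth coefficients of \<open>Y\<close>, by uniqueness.\<close>

lemma lift_smooth:
  assumes Y: "smooth_along AM AB \<pi> p Y"
  shows "smooth_along AM AM (\<lambda>q. q) p (\<lambda>q. lift q (Y q))"
proof -
  let ?P = "prod_atlas AB (euclidean_atlas :: (real, real) chart set)"
  have P: "smooth_atlas ?P" by (rule smooth_atlas_prod[OF AB smooth_atlas_euclidean])
  obtain U \<Phi> \<theta> S where U: "open U" "\<pi> p \<in> U"
    and \<Phi>_smooth: "\<And>b t. b \<in> U \<Longrightarrow> smooth_at ?P AM (b, t) \<Phi>"
    and \<Phi>_proj: "\<And>b t. b \<in> U \<Longrightarrow> \<pi> (\<Phi> (b, t)) = b"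
    and S: "open S" "p \<in> S" "\<pi> ` S \<subseteq> U" and \<theta>: "\<And>q. q \<in> S \<Longrightarrow> smooth_at AM euclidean_atlas q \<theta>"
    and \<Phi>: "\<And>q. q \<in> S \<Longrightarrow> \<Phi> (\<pi> q, \<theta> q) = q"
    by (rule local_trivialization[of p]) blast
  obtain V y where y: "(V, y) \<in> AB" "\<pi> p \<in> V" using atlas_cover[OF AB] by meson
  obtain R where R: "open R" "p \<in> R" "\<pi> ` R \<subseteq> V" "\<And>q. q \<in> R \<Longrightarrow> Y q \<in> tangent_space AB (\<pi> q)"
      "\<And>q. q \<in> R \<Longrightarrow> Y q = (\<lambda>f. \<Sum>b\<in>Basis. Y q (\<lambda>r. y r \<bullet> b) * coord_vector AB (V, y) b (\<pi> q) f)"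
    by (rule smooth_along_expand[OF AM AB y proj_smooth Y]) blast
  let ?c = "(V \<times> UNIV, map_prod y (\<lambda>x. x)) :: ('b \<times> real, 'eb \<times> real) chart"
  have c: "?c \<in> ?P" by (rule prod_atlas_chart[OF y(1) euclidean_chart])
  define F where "F q = (\<pi> q, \<theta> q)" for q
  have F: "smooth_at AM ?P q F" if "q \<in> S" for q
    unfolding F_def by (intro smooth_at_Pair AM AB smooth_atlas_euclidean proj_smooth \<theta> that)
  \<comment> \<open>The coordinate field of B, extended to B x \<real> with no component along the
    fibre and carried over by \<Phi>. It has the right projection but need not be
    horizontal.\<close>
  define X where "X b q = pushforward ?P AM \<Phi> (F q) (coord_vector ?P ?c (b, 0) (F q))" for b q
  have \<Phi>_F: "smooth_at ?P AM (F q) \<Phi>" if "q \<in> S" for q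
    unfolding F_def using \<Phi>_smooth S(3) that by blast
  have X_smooth: "smooth_along AM AM (\<lambda>q. q) p (X b)" for b
  \<comment> \<open>\<open>X b\<close> arises as a field along \<Phi> \<circ> F, a map known to be
    the identity only on \<open>S\<close>.\<close>
  proof (rule smooth_along_cong_map[OF AM _ S(1,2)])
    show "smooth_along AM AM (\<lambda>q. \<Phi> (F q)) p (X b)"
      unfolding X_def
      by (intro smooth_along_pushforward[OF AM P AM F[OF S(2)] \<Phi>_F[OF S(2)]]
          smooth_vector_field_along[OF AM P F[OF S(2)] coord_vector_field[OF P c] chart_open[OF P c]])
        (use y in \<open>simp add: F_def\<close>)
  qed (use \<Phi> in \<open>simp add: F_def\<close>)
  have X: "X b q \<in> tangent_space AM q \<and> push q (X b q) = coord_vector AB (V, y) b (\<pi> q)"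
    if q: "q \<in> S \<inter> R" for b q
  proof
    have qV: "\<pi> q \<in> V" "q \<in> S" using q R(3) by auto
    have Fq: "\<Phi> (F q) = q" using \<Phi> q by (simp add: F_def)
    have e: "coord_vector ?P ?c (b, 0) (F q) \<in> tangent_space ?P (F q)"
      by (rule coord_vector_tangent[OF P c]) (use qV in \<open>simp add: F_def\<close>)
    show "X b q \<in> tangent_space AM q"
      using pushforward_tangent[OF P AM \<Phi>_F[OF qV(2)] e] unfolding X_def Fq .
    have "push q (X b q) = pushforward ?P AB (\<lambda>r. \<pi> (\<Phi> r)) (F q) (coord_vector ?P ?c (b, 0) (F q))"
      using pushforward_compose[OF P AM AB proj_smooth, of \<Phi> "F q"] unfolding X_def Fq .
    also have "\<dots> = pushforward ?P AB fst (F q) (coord_vector ?P ?c (b, 0) (F q))"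
      by (rule pushforward_cong[OF P AB e, where S = "U \<times> UNIV"])
        (use U(1) S(3) qV \<Phi>_proj in \<open>auto simp: F_def open_Times\<close>)
    also have "coord_vector ?P ?c (b, 0) (F q) = velocity ?P (\<lambda>t. (inv_into V y (y (\<pi> q) + t *\<^sub>R b), \<theta> q))"
      unfolding F_def using coord_vector_prod[OF AB y(1) qV(1) smooth_atlas_euclidean euclidean_chart, of "\<theta> q" b 0]
      by simp
    also have "pushforward ?P AB fst (F q) (velocity ?P (\<lambda>t. (inv_into V y (y (\<pi> q) + t *\<^sub>R b), \<theta> q))) =
        coord_vector AB (V, y) b (\<pi> q)"
      using pushforward_velocity[OF P AB smooth_at_fst[OF AB smooth_atlas_euclidean],
          of "\<lambda>t. (inv_into V y (y (\<pi> q) + t *\<^sub>R b), \<theta> q)"]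
      by (simp add: F_def chart_inv[OF AB y(1) qV(1)] coord_vector_def)
    finally show "push q (X b q) = coord_vector AB (V, y) b (\<pi> q)" .
  qed
  \<comment> \<open>Subtracting the vertical part makes the field horizontal and, as the generator
    projects to zero, keeps its projection.\<close>
  define H where "H b q = (\<lambda>f. 1 * X b q f + (- \<alpha> q [X b q]) * vert q f)" for b q
  have H_smooth: "smooth_along AM AM (\<lambda>q. q) p (H b)" for b
    unfolding H_def
    by (intro smooth_along_lincomb[OF AM AM X_smooth vert_smooth] smooth_at_const AM smooth_atlas_euclidean
        smooth_at_uminus one_form_along_smooth[OF AM AM smooth_at_id[OF AM] form_\<alpha> X_smooth])
  have H: "H b q \<in> tangent_space AM q" "\<alpha> q [H b q] = 0" "push q (H b q) = coord_vector AB (V, y) b (\<pi> q)"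
    if q: "q \<in> S \<inter> R" for b q
  proof -
    show "H b q \<in> tangent_space AM q"
      unfolding H_def using X[OF q] by (intro tangent_lincomb[OF AM _ vert_tangent]) blast
    show "\<alpha> q [H b q] = 0"
      unfolding H_def using X[OF q, of b] by (subst one_form_linear[OF form_\<alpha> _ vert_tangent]) (auto simp: \<alpha>_vert)
    show "push q (H b q) = coord_vector AB (V, y) b (\<pi> q)"
      unfolding H_def pushforward_lincomb using X[OF q, of b] by (simp add: push_vert)
  qed
  have "smooth_along AM AM (\<lambda>q. q) p (\<lambda>q f. \<Sum>b\<in>Basis. Y q (\<lambda>r. y r \<bullet> b) * H b q f)"
    by (intro smooth_along_sum AM smooth_at_id finite_Basis H_smooth smooth_alongD[OF Y] smooth_at_coordinate[OF AB y])
  then show ?thesis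
  proof (rule smooth_along_cong[OF AM, of _ _ _ _ "S \<inter> R"])
    fix q assume q: "q \<in> S \<inter> R"
    show "(\<lambda>f. \<Sum>b\<in>Basis. Y q (\<lambda>r. y r \<bullet> b) * H b q f) = lift q (Y q)"
    proof (rule lift_eqI[symmetric])
      show "(\<lambda>f. \<Sum>b\<in>Basis. Y q (\<lambda>r. y r \<bullet> b) * H b q f) \<in> tangent_space AM q"
        by (rule tangent_sum_in[OF AM finite_Basis H(1)[OF q]])
      have "\<alpha> q [\<lambda>f. \<Sum>b\<in>Basis. Y q (\<lambda>r. y r \<bullet> b) * H b q f] =
          (\<Sum>b\<in>Basis. Y q (\<lambda>r. y r \<bullet> b) * \<alpha> q [H b q])"
        by (rule tangent_linear_sum[OF AM, where p = q and L = "\<lambda>v. \<alpha> q [v]"])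
          (simp_all add: one_form_linear[OF form_\<alpha>] H(1)[OF q])
      then show "\<alpha> q [\<lambda>f. \<Sum>b\<in>Basis. Y q (\<lambda>r. y r \<bullet> b) * H b q f] = 0" by (simp add: H(2)[OF q])
      show "push q (\<lambda>f. \<Sum>b\<in>Basis. Y q (\<lambda>r. y r \<bullet> b) * H b q f) = Y q"
        unfolding pushforward_sum H(3)[OF q] using R(5)[of q] q by auto
    qed
  qed (use S R in auto)
qed

end

subsection \<open>The contact pair on the total space\<close>

lemma form_eq_D2: "form_eq A 2 \<omega> \<theta> \<Longrightarrow> u \<in> tangent_space A p \<Longrightarrow> v \<in> tangent_space A p \<Longrightarrow> \<omega> p [u, v] = \<theta> p [u, v]"
  by (simp add: form_eq_def tangent_lists_def)

lemma two_form_zero_left: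
  assumes A: "smooth_atlas A" and \<omega>: "is_form A 2 \<omega>" and w: "w \<in> tangent_space A p"
  shows "\<omega> p [zero_tangent, w] = 0"
proof -
  have vs: "[w, w] \<in> tangent_lists A 2 p" using w by (simp add: tangent_lists_def)
  have "\<forall>p. \<forall>vs\<in>tangent_lists A 2 p. \<forall>i<2. \<forall>u\<in>tangent_space A p. \<forall>v\<in>tangent_space A p. \<forall>a b.
      \<omega> p (vs[i := (\<lambda>f. a * u f + b * v f)]) = a * \<omega> p (vs[i := u]) + b * \<omega> p (vs[i := v])"
    using \<omega> unfolding is_form_def by (elim conjE)
  from this[rule_format, OF vs, of 0 w w 0 0] w show ?thesis by simp
qed

lemma pushforward_tangent_lists:
  assumes "smooth_atlas A" "smooth_atlas B" "\<And>p. smooth_at A B p F" "vs \<in> tangent_lists A k p"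
  shows "map (pushforward A B F p) vs \<in> tangent_lists B k (F p)"
  using assms(4) pushforward_tangent[OF assms(1-3)] by (auto simp: tangent_lists_def)

lemma form_eq_pullback:
  assumes "smooth_atlas A" "smooth_atlas B" "\<And>p. smooth_at A B p F" "form_eq B k \<omega> \<theta>"
  shows "form_eq A k (pullback A B F \<omega>) (pullback A B F \<theta>)"
  using assms(4) pushforward_tangent_lists[OF assms(1-3)] unfolding form_eq_def pullback_def by blast

lemma form_eq_ext_deriv_pullback:
  assumes "smooth_atlas A" "smooth_atlas B" "\<And>p. smooth_at A B p F" "is_form B 1 \<beta>"
  shows "form_eq A 2 (ext_deriv A (pullback A B F \<beta>)) (pullback A B F (ext_deriv B \<beta>))"
  unfolding form_eq_def
proof (intro allI ballI)
  fix p vs assume vs: "vs \<in> tangent_lists A 2 p"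
  then obtain u v where "vs = [u, v]" by (auto simp: tangent_lists_def numeral_2_eq_2 length_Suc_conv)
  then show "ext_deriv A (pullback A B F \<beta>) p vs = pullback A B F (ext_deriv B \<beta>) p vs"
    using ext_deriv_pullback[OF assms] vs by (simp add: tangent_lists_def pullback_def)
qed

text \<open>\<open>\<psi>\<^sup>2 W = 0\<close> makes \<open>\<psi> W\<close> a multiple \<open>c W\<close>, and then \<open>c\<^sup>2 = 0\<close>.\<close>

lemma endomorphism_reeb:
  assumes A: "smooth_atlas A" and \<psi>: "smooth_endomorphism A \<psi>"
    and W: "W \<in> tangent_space A p" "\<beta> p [W] = 1"
    and sq: "\<And>v. v \<in> tangent_space A p \<Longrightarrow> \<psi> p (\<psi> p v) = (\<lambda>f. - v f + \<beta> p [v] * W f)"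
  shows "\<psi> p W = zero_tangent"
proof
  fix f
  define X where "X = \<psi> p W"
  have X: "X \<in> tangent_space A p" unfolding X_def by (rule endomorphism_tangent[OF \<psi> W(1)])
  have \<psi>0: "\<psi> p zero_tangent = zero_tangent"
    using endomorphism_linear[OF \<psi> W(1) W(1), of 0 0] by simp
  have \<psi>X: "\<psi> p X = zero_tangent" using sq[OF W(1)] W(2) by (simp add: X_def)
  have XW: "X = (\<lambda>f. \<beta> p [X] * W f)"
  proof
    fix f show "X f = \<beta> p [X] * W f"
      using fun_cong[OF sq[OF X], of f] by (simp add: \<psi>X \<psi>0)
  qed
  have "\<psi> p X = \<psi> p (\<lambda>f. \<beta> p [X] * W f)" by (rule arg_cong[OF XW])
  also have "\<dots> = (\<lambda>f. \<beta> p [X] * X f)"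
    using endomorphism_linear[OF \<psi> W(1) W(1), of "\<beta> p [X]" 0] by (simp add: X_def)
  finally have "\<beta> p [X] * X f = 0" unfolding \<psi>X by (rule fun_cong[symmetric])
  then have "\<beta> p [X] = 0 \<or> X f = 0" by simp
  then show "\<psi> p W f = 0" using fun_cong[OF XW, of f] unfolding X_def by (elim disjE) simp_all
qed

context circle_bundle_connection
begin

lemma push_act:
  assumes "norm z = 1"
  shows "push (act z p) (pushforward AM AM (act z) p v) = push p v"
  using pushforward_compose[OF AM AM AB proj_smooth, of "act z" p v] assms proj_act by simp

text \<open>The action preserves \<alpha> and the projection, so it carries a horizontal lift to a
  vector with the defining properties of the lift at the new point.\<close>

lemma act_lift:
  assumes z: "norm z = 1" and Y: "Y \<in> tangent_space AB (\<pi> p)"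
  shows "pushforward AM AM (act z) p (lift p Y) = lift (act z p) Y"
proof (rule lift_eqI[symmetric])
  show "pushforward AM AM (act z) p (lift p Y) \<in> tangent_space AM (act z p)"
    by (rule pushforward_tangent[OF AM AM act_smooth[OF z] lift_tangent[OF Y]])
  have "pullback AM AM (act z) \<alpha> p [lift p Y] = \<alpha> p [lift p Y]"
    using \<alpha>_invariant z lift_tangent[OF Y]
    by (simp add: circle_invariant_form_def form_eq_def tangent_lists_def)
  then show "\<alpha> (act z p) [pushforward AM AM (act z) p (lift p Y)] = 0"
    by (simp add: pullback_1 lift_horizontal[OF Y])
  show "push (act z p) (pushforward AM AM (act z) p (lift p Y)) = Y"
    by (simp add: push_act[OF z] push_lift[OF Y])
qed

text \<open>The definition of the bundle does not mention dimensions. Projection and \<alpha>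
  together give, in coordinates, a linear bijection of the model of M onto the model of B times
  \<real>: injective by \<open>horizontal_unique\<close>, surjective by adding a multiple of the
  generator to a lift.\<close>

lemma dimension: "DIM('em) = DIM('eb) + 1"
proof -
  fix p :: 'm
  obtain U x where x: "(U, x) \<in> AM" "p \<in> U" using atlas_cover[OF AM] by meson
  obtain V y where y: "(V, y) \<in> AB" "\<pi> p \<in> V" using atlas_cover[OF AB] by meson
  define L where "L e = (components (V, y) (push p (coord_vector AM (U, x) e p)), \<alpha> p [coord_vector AM (U, x) e p])" for e
  have comb: "L (a *\<^sub>R e + b *\<^sub>R e') = a *\<^sub>R L e + b *\<^sub>R L e'" for a b e e'
    unfolding L_def coord_vector_linear[OF AM x] pushforward_lincomb components_lincomb
    by (simp add: one_form_linear[OF form_\<alpha> coord_vector_tangent[OF AM x] coord_vector_tangent[OF AM x]])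
  have lin: "linear L"
    using comb[of 1 _ 1] comb[of _ _ 0 0] by (intro linearI) auto
  have "inj L"
  proof (rule injI)
    fix e e' assume "L e = L e'"
    then have "components (V, y) (push p (coord_vector AM (U, x) e p)) =
        components (V, y) (push p (coord_vector AM (U, x) e' p))"
      and \<alpha>: "\<alpha> p [coord_vector AM (U, x) e p] = \<alpha> p [coord_vector AM (U, x) e' p]"
      unfolding L_def by auto
    then have "push p (coord_vector AM (U, x) e p) = push p (coord_vector AM (U, x) e' p)"
      using coord_vector_components[OF AB y push_tangent[OF coord_vector_tangent[OF AM x]]] by metis
    then have "coord_vector AM (U, x) e p = coord_vector AM (U, x) e' p"
      by (rule horizontal_unique[OF coord_vector_tangent[OF AM x] coord_vector_tangent[OF AM x] \<alpha>])
    then show "e = e'" using components_coord_vector[OF AM x] by metis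
  qed
  moreover have "surj L"
  proof (rule surjI)
    fix w :: "'eb \<times> real"
    define Y where "Y = coord_vector AB (V, y) (fst w) (\<pi> p)"
    have Y: "Y \<in> tangent_space AB (\<pi> p)" unfolding Y_def by (rule coord_vector_tangent[OF AB y])
    define u where "u = (\<lambda>f. 1 * lift p Y f + snd w * vert p f)"
    have "u \<in> tangent_space AM p"
      unfolding u_def by (rule tangent_lincomb[OF AM lift_tangent[OF Y] vert_tangent])
    moreover have "push p u = Y" unfolding u_def pushforward_lincomb by (simp add: push_lift[OF Y] push_vert)
    moreover have "\<alpha> p [u] = snd w"
      unfolding u_def one_form_linear[OF form_\<alpha> lift_tangent[OF Y] vert_tangent]
      by (simp add: lift_horizontal[OF Y] \<alpha>_vert)
    ultimately show "L (components (U, x) (\<lambda>f. 1 * lift p (coord_vector AB (V, y) (fst w) (\<pi> p)) f + snd w * vert p f)) = w"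
      unfolding Y_def[symmetric] u_def[symmetric] L_def
      using coord_vector_components[OF AM x, of u] components_coord_vector[OF AB y, of "fst w"]
      by (simp add: Y_def)
  qed
  ultimately have "dim (UNIV :: ('eb \<times> real) set) = dim (UNIV :: 'em set)"
    using dim_image_eq[OF lin, of UNIV] by simp
  then show ?thesis by simp
qed

text \<open>The form is evaluated on the generator followed by lifts of vectors on which the form of
  B is nonzero: \<alpha> is 1 on the first and 0 on the others. The form of B is kept as a
  \<open>wedge\<close> so that \<open>wedge_permute\<close> supplies the antisymmetry.\<close>

lemma wedge_connection_nowhere_vanishing:
  assumes \<Omega>: "nowhere_vanishing AB (k + l) (wedge k l \<omega> \<theta>)"
  shows "nowhere_vanishing AM (1 + (k + l)) (wedge 1 (k + l) \<alpha> (pullback AM AB \<pi> (wedge k l \<omega> \<theta>)))"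
  unfolding nowhere_vanishing_def
proof
  fix p
  obtain ws where ws: "ws \<in> tangent_lists AB (k + l) (\<pi> p)" "wedge k l \<omega> \<theta> (\<pi> p) ws \<noteq> 0"
    using \<Omega> unfolding nowhere_vanishing_def by blast
  define us where "us = map (lift p) ws"
  have len: "length ws = k + l" and T_ws: "\<And>w. w \<in> set ws \<Longrightarrow> w \<in> tangent_space AB (\<pi> p)"
    using ws(1) by (auto simp: tangent_lists_def)
  have push_us: "map push' us = ws" if "push' = push p" for push'
    unfolding us_def that map_map o_def by (rule map_idI) (simp add: push_lift T_ws)
  have "wedge 1 (k + l) \<alpha> (pullback AM AB \<pi> (wedge k l \<omega> \<theta>)) p (vert p # us) =
      \<alpha> p [vert p] * pullback AM AB \<pi> (wedge k l \<omega> \<theta>) p us"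
  proof (rule wedge_one_form_Cons)
    show "length us = k + l" by (simp add: us_def len)
    show "\<alpha> p [w] = 0" if "w \<in> set us" for w
      using that T_ws lift_horizontal by (auto simp: us_def)
    fix \<tau> assume \<tau>: "\<tau> permutes {..<k + l}"
    have "map (push p) (map (\<lambda>i. us ! \<tau> i) [0..<k + l]) = map (\<lambda>i. ws ! \<tau> i) [0..<k + l]"
      using permutes_lessThan[OF \<tau>] len T_ws by (auto simp: us_def push_lift)
    then show "pullback AM AB \<pi> (wedge k l \<omega> \<theta>) p (map (\<lambda>i. us ! \<tau> i) [0..<k + l]) =
        of_int (sign \<tau>) * pullback AM AB \<pi> (wedge k l \<omega> \<theta>) p us"
      unfolding pullback_def push_us[OF refl] by (simp only: wedge_permute[OF \<tau>])
  qed
  also have "\<dots> = wedge k l \<omega> \<theta> (\<pi> p) ws" unfolding pullback_def push_us[OF refl] by (simp add: \<alpha>_vert)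
  finally have "wedge 1 (k + l) \<alpha> (pullback AM AB \<pi> (wedge k l \<omega> \<theta>)) p (vert p # us) \<noteq> 0"
    using ws(2) by simp
  moreover have "vert p # us \<in> tangent_lists AM (1 + (k + l)) p"
    using vert_tangent lift_tangent T_ws len by (auto simp: tangent_lists_def us_def)
  ultimately show "\<exists>vs\<in>tangent_lists AM (1 + (k + l)) p.
      wedge 1 (k + l) \<alpha> (pullback AM AB \<pi> (wedge k l \<omega> \<theta>)) p vs \<noteq> 0" by blast
qed

text \<open>The two degrees are exchanged because the curvature, hence the nilpotency of \<eta>,
  belongs to the first form of the pair.\<close>

lemma contact_pair_total_space:
  assumes pair: "contact_symplectic_pair AB h k \<beta> \<eta>"
    and curvature: "form_eq AM 2 (ext_deriv AM \<alpha>) (pullback AM AB \<pi> \<eta>)"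
  shows "contact_pair AM k h \<alpha> (pullback AM AB \<pi> \<beta>)"
proof -
  have \<beta>: "is_form AB 1 \<beta>" and dim: "DIM('eb) = 2 * h + 2 * k + 1"
    and vol: "nowhere_vanishing AB (2 * h + 2 * k + 1)
       (wedge 1 (2 * h + 2 * k) \<beta>
         (wedge (2 * h) (2 * k) (wedge_power 2 (ext_deriv AB \<beta>) h) (wedge_power 2 \<eta> k)))"
    and zero: "form_eq AB (2 * (h + 1)) (wedge_power 2 (ext_deriv AB \<beta>) (h + 1)) zero_form"
      "form_eq AB (2 * (k + 1)) (wedge_power 2 \<eta> (k + 1)) zero_form"
    using pair unfolding contact_symplectic_pair_def by blast+
  let ?\<beta> = "pullback AM AB \<pi> \<beta>"
  have d\<beta>: "form_eq AM 2 (ext_deriv AM ?\<beta>) (pullback AM AB \<pi> (ext_deriv AB \<beta>))"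
    by (rule form_eq_ext_deriv_pullback[OF AM AB proj_smooth \<beta>])
  have pow: "form_eq AM (2 * n) (wedge_power 2 \<omega> n) (pullback AM AB \<pi> (wedge_power 2 \<theta> n))"
    if "form_eq AM 2 \<omega> (pullback AM AB \<pi> \<theta>)" for \<omega> \<theta> n
    by (rule form_eq_trans[OF form_eq_wedge_power[OF that] form_eq_sym[OF form_eq_pullback_wedge_power]])
  have pow_zero: "form_eq AM (2 * n) (wedge_power 2 \<omega> n) zero_form"
    if "form_eq AM 2 \<omega> (pullback AM AB \<pi> \<theta>)" "form_eq AB (2 * n) (wedge_power 2 \<theta> n) zero_form" for \<omega> \<theta> n
    using form_eq_trans[OF pow[OF that(1)] form_eq_pullback[OF AM AB proj_smooth that(2)]]
    by (simp add: pullback_def)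
  \<comment> \<open>\<open>contact_pair\<close> lists the powers of the first differential before
    the second form. The volume form of B is therefore rotated to begin with the power of \<eta>, so
    that \<alpha> can simply be put in front.\<close>
  have "nowhere_vanishing AB (2 * k + (1 + 2 * h))
      (wedge (2 * k) (1 + 2 * h) (wedge_power 2 \<eta> k) (wedge 1 (2 * h) \<beta> (wedge_power 2 (ext_deriv AB \<beta>) h)))"
    using vol wedge_rotate_nonzero[of 1 "2 * h" "2 * k" \<beta>] unfolding nowhere_vanishing_def
    by (simp add: add_ac) meson
  from wedge_connection_nowhere_vanishing[OF this]
  have "nowhere_vanishing AM (1 + (2 * k + (1 + 2 * h)))
      (wedge 1 (2 * k + (1 + 2 * h)) \<alpha> (pullback AM AB \<pi>
        (wedge (2 * k) (1 + 2 * h) (wedge_power 2 \<eta> k) (wedge 1 (2 * h) \<beta> (wedge_power 2 (ext_deriv AB \<beta>) h)))))" .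
  moreover have "form_eq AM (1 + (2 * k + (1 + 2 * h)))
      (wedge 1 (2 * k + (1 + 2 * h)) \<alpha>
         (wedge (2 * k) (1 + 2 * h) (wedge_power 2 (ext_deriv AM \<alpha>) k)
           (wedge 1 (2 * h) ?\<beta> (wedge_power 2 (ext_deriv AM ?\<beta>) h))))
      (wedge 1 (2 * k + (1 + 2 * h)) \<alpha> (pullback AM AB \<pi>
        (wedge (2 * k) (1 + 2 * h) (wedge_power 2 \<eta> k) (wedge 1 (2 * h) \<beta> (wedge_power 2 (ext_deriv AB \<beta>) h)))))"
    by (intro form_eq_wedge form_eq_refl form_eq_trans[OF _ form_eq_sym[OF form_eq_pullback_wedge]]
        pow[OF curvature] pow[OF d\<beta>])
  ultimately have "nowhere_vanishing AM (1 + (2 * k + (1 + 2 * h)))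
      (wedge 1 (2 * k + (1 + 2 * h)) \<alpha>
         (wedge (2 * k) (1 + 2 * h) (wedge_power 2 (ext_deriv AM \<alpha>) k)
           (wedge 1 (2 * h) ?\<beta> (wedge_power 2 (ext_deriv AM ?\<beta>) h))))"
    unfolding nowhere_vanishing_def form_eq_def by metis
  moreover have "1 + (2 * k + (1 + 2 * h)) = 2 * k + 2 * h + 2" by simp
  ultimately show ?thesis
    unfolding contact_pair_def
    using form_\<alpha> is_form_1_pullback[OF AM AB proj_smooth \<beta>] dimension dim
      pow_zero[OF curvature zero(2)] pow_zero[OF d\<beta> zero(1)] by simp
qed

lemma lifted_endomorphism_smooth:
  assumes \<psi>: "smooth_endomorphism AB \<psi>"
  shows "smooth_endomorphism AM (\<lambda>p X. lift p (\<psi> (\<pi> p) (push p X)))"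
  unfolding smooth_endomorphism_def
proof (intro conjI allI ballI)
  fix p v assume v: "v \<in> tangent_space AM p"
  note \<psi>v = endomorphism_tangent[OF \<psi> push_tangent[OF v]]
  show "lift p (\<psi> (\<pi> p) (push p v)) \<in> tangent_space AM p" by (rule lift_tangent[OF \<psi>v])
  fix u and a b :: real assume u: "u \<in> tangent_space AM p"
  show "lift p (\<psi> (\<pi> p) (push p (\<lambda>f. a * u f + b * v f))) =
      (\<lambda>f. a * lift p (\<psi> (\<pi> p) (push p u)) f + b * lift p (\<psi> (\<pi> p) (push p v)) f)"
    unfolding pushforward_lincomb endomorphism_linear[OF \<psi> push_tangent[OF u] push_tangent[OF v]]
    by (rule lift_lincomb[OF endomorphism_tangent[OF \<psi> push_tangent[OF u]] \<psi>v])
next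
  fix c e assume c: "c \<in> AM"
  obtain U x where x: "c = (U, x)" by fastforce
  show "smooth_vector_field_on AM (fst c) (\<lambda>q. lift q (\<psi> (\<pi> q) (push q (coord_vector AM c e q))))"
  proof (rule smooth_vector_field_onI, rule lift_smooth, rule endomorphism_along_smooth[OF AM AB proj_smooth \<psi>])
    fix p assume "p \<in> fst c"
    then have "smooth_along AM AM (\<lambda>q. q) p (coord_vector AM c e)"
      using smooth_vector_field_along[OF AM AM smooth_at_id[OF AM] coord_vector_field[OF AM] chart_open[OF AM]] c x
      by simp
    then show "smooth_along AM AB \<pi> p (\<lambda>q. push q (coord_vector AM c e q))"
      by (rule smooth_along_pushforward[OF AM AM AB smooth_at_id[OF AM] proj_smooth])
  qed
qed

end

theorem theorem28:
  fixes AB :: "('b::{t2_space,second_countable_topology}, 'eb::euclidean_space) chart set"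
    and AM :: "('m::{t2_space,second_countable_topology}, 'em::euclidean_space) chart set"
    and h k :: nat and T :: real
    and \<beta> \<eta> :: "'b form" and \<psi> :: "'b \<Rightarrow> 'b tangent \<Rightarrow> 'b tangent"
    and \<pi> :: "'m \<Rightarrow> 'b" and act :: "complex \<Rightarrow> 'm \<Rightarrow> 'm"
    and \<alpha>\<^sub>1 \<alpha>\<^sub>2 :: "'m form" and \<phi> :: "'m \<Rightarrow> 'm tangent \<Rightarrow> 'm tangent"
  assumes "closed_manifold AB"
    and "almost_contact_symplectic_structure AB h k \<beta> \<eta> \<psi>"
    and "T > 0"
    and "represents_integral_class AB T \<eta>"
    and "smooth_atlas AM"
    and "boothby_wang_fibration AM AB \<pi> act T \<eta> \<alpha>\<^sub>1"
    and "\<alpha>\<^sub>2 = pullback AM AB \<pi> \<beta>"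
    and "\<phi> = (\<lambda>p X. horizontal_lift AM AB \<pi> \<alpha>\<^sub>1 p (\<psi> (\<pi> p) (pushforward AM AB \<pi> p X)))"
  shows "contact_pair_structure AM k h \<alpha>\<^sub>1 \<alpha>\<^sub>2 \<phi> \<and>
         circle_invariant_structure AM act \<alpha>\<^sub>1 \<alpha>\<^sub>2 \<phi> \<and>
         (contact_symplectic_decomposable AB \<beta> \<eta> \<psi> \<longrightarrow> contact_pair_decomposable AM \<alpha>\<^sub>1 \<alpha>\<^sub>2 \<phi>)"
proof -
  interpret circle_bundle_connection AM AB \<pi> act T \<alpha>\<^sub>1
    using assms(1,3,5,6) unfolding closed_manifold_def boothby_wang_fibration_def
    by unfold_locales blast+
  have curvature: "form_eq AM 2 (ext_deriv AM \<alpha>\<^sub>1) (pullback AM AB \<pi> \<eta>)"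
    using assms(6) unfolding boothby_wang_fibration_def by blast
  have pair: "contact_symplectic_pair AB h k \<beta> \<eta>" and \<psi>: "smooth_endomorphism AB \<psi>"
    using assms(2) unfolding almost_contact_symplectic_structure_def by blast+
  have \<beta>: "is_form AB 1 \<beta>" and \<eta>: "is_form AB 2 \<eta>"
    using pair unfolding contact_symplectic_pair_def closed_form_def by blast+
  obtain W where reeb: "contact_symplectic_reeb AB \<beta> \<eta> W"
    and \<psi>_sq: "\<And>p v. v \<in> tangent_space AB p \<Longrightarrow> \<psi> p (\<psi> p v) = (\<lambda>f. - v f + \<beta> p [v] * W p f)"
    using assms(2) unfolding almost_contact_symplectic_structure_def by blast
  have W_smooth: "smooth_vector_field_on AB UNIV W" and \<beta>W: "\<And>p. \<beta> p [W p] = 1"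
    and iW: "\<And>p v. v \<in> tangent_space AB p \<Longrightarrow> ext_deriv AB \<beta> p [W p, v] = 0 \<and> \<eta> p [W p, v] = 0"
    using reeb unfolding contact_symplectic_reeb_def by blast+
  have W: "W p \<in> tangent_space AB p" for p
    using W_smooth unfolding smooth_vector_field_on_def by blast
  have \<psi>W: "\<psi> p (W p) = zero_tangent" for p
    by (rule endomorphism_reeb[where \<beta> = \<beta>, OF AB \<psi> W \<beta>W \<psi>_sq])
  have \<psi>0: "\<psi> p zero_tangent = zero_tangent" for p
    using endomorphism_linear[OF \<psi> W W, of p 0 0] by simp

  have \<alpha>\<^sub>2: "\<alpha>\<^sub>2 p [v] = \<beta> (\<pi> p) [push p v]" for p v
    unfolding assms(7) by (rule pullback_1)
  have \<phi>: "\<phi> p v = lift p (\<psi> (\<pi> p) (push p v))" for p v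
    by (simp add: assms(8))
  have d\<alpha>\<^sub>1: "ext_deriv AM \<alpha>\<^sub>1 p [u, v] = \<eta> (\<pi> p) [push p u, push p v]"
    if "u \<in> tangent_space AM p" "v \<in> tangent_space AM p" for p u v
    using form_eq_D2[OF curvature that] by (simp add: pullback_def)
  have d\<alpha>\<^sub>2: "ext_deriv AM \<alpha>\<^sub>2 p [u, v] = ext_deriv AB \<beta> (\<pi> p) [push p u, push p v]"
    if "u \<in> tangent_space AM p" "v \<in> tangent_space AM p" for p u v
    unfolding assms(7) by (rule ext_deriv_pullback[OF AM AB proj_smooth \<beta> that])
  have \<psi>_push: "\<psi> (\<pi> p) (push p v) \<in> tangent_space AB (\<pi> p)" if "v \<in> tangent_space AM p" for p v
    by (rule endomorphism_tangent[OF \<psi> push_tangent[OF that]])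

  define Z where "Z p = lift p (W (\<pi> p))" for p
  have Z: "Z p \<in> tangent_space AM p" "\<alpha>\<^sub>1 p [Z p] = 0" "push p (Z p) = W (\<pi> p)" for p
    unfolding Z_def using lift_tangent lift_horizontal push_lift W by auto

  have "contact_pair_reeb AM \<alpha>\<^sub>1 \<alpha>\<^sub>2 vert Z"
    unfolding contact_pair_reeb_def
  proof (intro conjI allI ballI)
    show "smooth_vector_field_on AM UNIV vert"
      by (rule smooth_vector_field_onI[OF vert_smooth])
    show "smooth_vector_field_on AM UNIV Z"
      unfolding Z_def
      by (intro smooth_vector_field_onI lift_smooth
          smooth_vector_field_along[OF AM AB proj_smooth W_smooth]) auto
    fix p
    show "\<alpha>\<^sub>1 p [vert p] = 1" by (rule \<alpha>_vert)
    show "\<alpha>\<^sub>1 p [Z p] = 0" by (rule Z(2))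
    show "\<alpha>\<^sub>2 p [vert p] = 0" unfolding \<alpha>\<^sub>2 push_vert by (rule one_form_zero[OF AB \<beta>])
    show "\<alpha>\<^sub>2 p [Z p] = 1" unfolding \<alpha>\<^sub>2 Z(3) by (rule \<beta>W)
    fix v assume v: "v \<in> tangent_space AM p"
    show "ext_deriv AM \<alpha>\<^sub>1 p [vert p, v] = 0"
      unfolding d\<alpha>\<^sub>1[OF vert_tangent v] push_vert by (rule two_form_zero_left[OF AB \<eta> push_tangent[OF v]])
    show "ext_deriv AM \<alpha>\<^sub>2 p [vert p, v] = 0"
      unfolding d\<alpha>\<^sub>2[OF vert_tangent v] push_vert by (rule ext_deriv_zero_left[OF AB \<beta> push_tangent[OF v]])
    show "ext_deriv AM \<alpha>\<^sub>1 p [Z p, v] = 0" "ext_deriv AM \<alpha>\<^sub>2 p [Z p, v] = 0"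
      using iW[OF push_tangent[OF v]] by (simp_all add: d\<alpha>\<^sub>1[OF Z(1) v] d\<alpha>\<^sub>2[OF Z(1) v] Z(3))
  qed
  moreover have "\<phi> p (\<phi> p v) = (\<lambda>f. - v f + \<alpha>\<^sub>1 p [v] * vert p f + \<alpha>\<^sub>2 p [v] * Z p f)"
    if v: "v \<in> tangent_space AM p" for p v
  proof -
    let ?u = "\<lambda>f. (- 1) * v f + \<alpha>\<^sub>1 p [v] * vert p f"
    \<comment> \<open>The candidate for the lift: its \<alpha>-value cancels between
      \<open>v\<close> and the generator, and since the generator projects to zero, its projection
      is \<psi> applied twice to the projection of \<open>v\<close>. The factors -1 and 1 fit the
      shape of the linearity rules.\<close>
    let ?w = "\<lambda>f. 1 * ?u f + \<alpha>\<^sub>2 p [v] * Z p f"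
    have u: "?u \<in> tangent_space AM p" by (rule tangent_lincomb[OF AM v vert_tangent])
    have "\<phi> p (\<phi> p v) = lift p (\<lambda>f. - push p v f + \<beta> (\<pi> p) [push p v] * W (\<pi> p) f)"
      unfolding \<phi> push_lift[OF \<psi>_push[OF v]] by (simp only: \<psi>_sq[OF push_tangent[OF v]])
    also have "\<dots> = ?w"
    proof (rule lift_eqI)
      show "?w \<in> tangent_space AM p" by (rule tangent_lincomb[OF AM u Z(1)])
      show "\<alpha>\<^sub>1 p [?w] = 0"
        unfolding one_form_linear[OF form_\<alpha> u Z(1)] one_form_linear[OF form_\<alpha> v vert_tangent]
        by (simp add: \<alpha>_vert Z(2))
      show "push p ?w = (\<lambda>f. - push p v f + \<beta> (\<pi> p) [push p v] * W (\<pi> p) f)"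
        unfolding pushforward_lincomb by (simp add: push_vert Z(3) \<alpha>\<^sub>2)
    qed
    finally show ?thesis by simp
  qed
  moreover have "\<phi> p (vert p) = zero_tangent" "\<phi> p (Z p) = zero_tangent" for p
    by (simp_all add: \<phi> push_vert Z(3) \<psi>0 \<psi>W lift_zero)
  moreover have "smooth_endomorphism AM \<phi>"
    unfolding assms(8) by (rule lifted_endomorphism_smooth[OF \<psi>])
  moreover have "contact_pair AM k h \<alpha>\<^sub>1 \<alpha>\<^sub>2"
    unfolding assms(7) by (rule contact_pair_total_space[OF pair curvature])
  ultimately have "contact_pair_structure AM k h \<alpha>\<^sub>1 \<alpha>\<^sub>2 \<phi>"
    unfolding contact_pair_structure_def by blast
  moreover have "circle_invariant_structure AM act \<alpha>\<^sub>1 \<alpha>\<^sub>2 \<phi>"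
    unfolding circle_invariant_structure_def
  proof (intro conjI)
    show "circle_invariant_form AM act 1 \<alpha>\<^sub>1" by (rule \<alpha>_invariant)
    show "circle_invariant_form AM act 1 \<alpha>\<^sub>2"
      unfolding circle_invariant_form_def form_eq_def
      by (auto simp: tangent_lists_def length_Suc_conv pullback_1 \<alpha>\<^sub>2 push_act proj_act)
    show "circle_invariant_endomorphism AM act \<phi>"
      unfolding circle_invariant_endomorphism_def
      by (auto simp: \<phi> act_lift[OF _ \<psi>_push] push_act proj_act)
  qed
  moreover have "contact_pair_decomposable AM \<alpha>\<^sub>1 \<alpha>\<^sub>2 \<phi>" if dec: "contact_symplectic_decomposable AB \<beta> \<eta> \<psi>"
  proof -
    have dec1: "\<psi> b v \<in> ker_2form AB \<eta> b" if "v \<in> ker_2form AB \<eta> b" for b v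
      using dec that unfolding contact_symplectic_decomposable_def preserves_distribution_def by blast
    have dec2: "\<psi> b v \<in> characteristic_distribution AB \<beta> b" if "v \<in> characteristic_distribution AB \<beta> b" for b v
      using dec that unfolding contact_symplectic_decomposable_def preserves_distribution_def by blast
    \<comment> \<open>Every vector of B is the projection of its lift, so quantifying over tangent
      vectors of M amounts to quantifying over those of B.\<close>
    have char1: "v \<in> characteristic_distribution AM \<alpha>\<^sub>1 p \<longleftrightarrow> \<alpha>\<^sub>1 p [v] = 0 \<and> push p v \<in> ker_2form AB \<eta> (\<pi> p)"
      if v: "v \<in> tangent_space AM p" for p v
    proof -
      have "(\<forall>w\<in>tangent_space AM p. \<eta> (\<pi> p) [push p v, push p w] = 0) \<longleftrightarrow>
          (\<forall>w\<in>tangent_space AB (\<pi> p). \<eta> (\<pi> p) [push p v, w] = 0)"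
        using push_lift lift_tangent push_tangent by metis
      then show ?thesis
        using v push_tangent[OF v]
        by (simp add: characteristic_distribution_def ker_1form_def ker_2form_def d\<alpha>\<^sub>1 cong: ball_cong)
    qed
    \<comment> \<open>This distribution is the full preimage under the projection and contains the
      generator, so no condition on \<open>\<alpha>\<^sub>1\<close> occurs.\<close>
    have char2: "v \<in> characteristic_distribution AM \<alpha>\<^sub>2 p \<longleftrightarrow> push p v \<in> characteristic_distribution AB \<beta> (\<pi> p)"
      if v: "v \<in> tangent_space AM p" for p v
    proof -
      have "(\<forall>w\<in>tangent_space AM p. ext_deriv AB \<beta> (\<pi> p) [push p v, push p w] = 0) \<longleftrightarrow>
          (\<forall>w\<in>tangent_space AB (\<pi> p). ext_deriv AB \<beta> (\<pi> p) [push p v, w] = 0)"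
        using push_lift lift_tangent push_tangent by metis
      then show ?thesis
        using v push_tangent[OF v]
        by (simp add: characteristic_distribution_def ker_1form_def ker_2form_def \<alpha>\<^sub>2 d\<alpha>\<^sub>2 cong: ball_cong)
    qed
    have tangent: "v \<in> tangent_space AM p" if "v \<in> characteristic_distribution AM \<alpha> p" for \<alpha> p v
      using that by (simp add: characteristic_distribution_def ker_1form_def)
    have \<phi>_char: "\<phi> p v \<in> tangent_space AM p" "\<alpha>\<^sub>1 p [\<phi> p v] = 0" "push p (\<phi> p v) = \<psi> (\<pi> p) (push p v)"
      if "v \<in> tangent_space AM p" for p v
      unfolding \<phi> using lift_tangent lift_horizontal push_lift \<psi>_push[OF that] by auto
    show ?thesis
      unfolding contact_pair_decomposable_def preserves_distribution_def
    proof (intro conjI allI image_subsetI)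
      fix p v
      \<comment> \<open>The values of \<phi> are horizontal by construction, so only the condition
        on the projection is left.\<close>
      show "\<phi> p v \<in> characteristic_distribution AM \<alpha>\<^sub>1 p" if "v \<in> characteristic_distribution AM \<alpha>\<^sub>1 p"
        using that tangent[OF that] char1 dec1 \<phi>_char by simp
      show "\<phi> p v \<in> characteristic_distribution AM \<alpha>\<^sub>2 p" if "v \<in> characteristic_distribution AM \<alpha>\<^sub>2 p"
        using that tangent[OF that] char2 dec2 \<phi>_char by simp
    qed
  qed
  ultimately show ?thesis by blast
qed

end
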